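(* Let $\mathbf{a}\in\mathfrak{A}_3$ with $a_{(12)}\neq a_{(13)}=a_{(23)}$. Write $M=M_{(12)}$ for the Verma module and put, in $M$, $m_{\mathsf{o}}=m_{(13)(12)(13)}+f_{13}((23))\,m_{(23)}$ and $N_{(12)}=\mathcal{A}_{[\mathbf{a}]}\cdot\bigl(M[(13)(23)]\oplus M[e]\bigr)$. Let $v$ and $w$ stand for elements satisfying $M[(13)(23)]=\langle v,m_{\mathsf{o}}\rangle$ and $M[e]=\langle w,m_{(13)(12)(23)}\rangle$. The proper nonzero submodules of $M$ are exactly $$N_{(12)},\quad \mathcal{A}_{[\mathbf{a}]}\cdot M[(13)(23)],\quad \mathcal{A}_{[\mathbf{a}]}\cdot M[e],\quad \mathcal{A}_{[\mathbf{a}]}\cdot v,\quad \mathcal{A}_{[\mathbf{a}]}\cdot\langle m_{(13)(12)(23)},m_{\mathsf{o}}\rangle,$$ $$\mathcal{A}_{[\mathbf{a}]}\cdot w,\quad \mathcal{A}_{[\mathbf{a}]}\cdot m_{(13)(12)(23)},\quad \mathcal{A}_{[\mathbf{a}]}\cdot m_{\mathsf{o}},\quad \langle m_{\mathrm{top}}\rangle,$$ where $v$ runs over all elements of $M[(13)(23)]$ with $M[(13)(23)]=\langle v,m_{\mathsf{o}}\rangle$ and $w$ runs over all elements of $M[e]$ with $M[e]=\langle w,m_{(13)(12)(23)}\rangle$. The Hasse diagram of this lattice is given by the following covering inclusions $X\supset Y$, where $X\overset{Q}{\supset}Y$ means in addition $X/Y\simeq Q$ (for every such $v$, $w$): - $N_{(12)}\overset{\Bbbk_e}{\supset}\mathcal{A}_{[\mathbf{a}]}\cdot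 M[(13)(23)]$ and $N_{(12)}\overset{L}{\supset}\mathcal{A}_{[\mathbf{a}]}\cdot M[e]$; - $\mathcal{A}_{[\mathbf{a}]}\cdot M[(13)(23)]\overset{L}{\supset}\mathcal{A}_{[\mathbf{a}]}\cdot v$ and $\mathcal{A}_{[\mathbf{a}]}\cdot M[(13)(23)]\overset{L}{\supset}\mathcal{A}_{[\mathbf{a}]}\cdot\langle m_{(13)(12)(23)},m_{\mathsf{o}}\rangle$; - $\mathcal{A}_{[\mathbf{a}]}\cdot M[e]\overset{\Bbbk_e}{\supset}\mathcal{A}_{[\mathbf{a}]}\cdot w$ and $\mathcal{A}_{[\mathbf{a}]}\cdot M[e]\overset{\Bbbk_e}{\supset}\mathcal{A}_{[\mathbf{a}]}\cdot\langle m_{(13)(12)(23)},m_{\mathsf{o}}\rangle$; - $\mathcal{A}_{[\mathbf{a}]}\cdot v\overset{L}{\supset}\mathcal{A}_{[\mathbf{a}]}\cdot m_{(13)(12)(23)}$ and $\mathcal{A}_{[\mathbf{a}]}\cdot w\overset{\Bbbk_e}{\supset}\mathcal{A}_{[\mathbf{a}]}\cdot m_{\mathsf{o}}$; - $\mathcal{A}_{[\mathbf{a}]}\cdot\langle m_{(13)(12)(23)},m_{\mathsf{o}}\rangle\overset{L}{\supset}\mathcal{A}_{[\mathbf{a}]}\cdot m_{(13)(12)(23)}$ and $\mathcal{A}_{[\mathbf{a}]}\cdot\langle m_{(13)(12)(23)},m_{\mathsf{o}}\rangle\overset{\Bbbk_e}{\supset}\mathcal{A}_{[\mathbf{a}]}\cdot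 m_{\mathsf{o}}$; - $\mathcal{A}_{[\mathbf{a}]}\cdot m_{(13)(12)(23)}\overset{\Bbbk_e}{\supset}\langle m_{\mathrm{top}}\rangle$ and $\mathcal{A}_{[\mathbf{a}]}\cdot m_{\mathsf{o}}\overset{L}{\supset}\langle m_{\mathrm{top}}\rangle$. The submodules $\mathcal{A}_{[\mathbf{a}]}\cdot v$ and $\mathcal{A}_{[\mathbf{a}]}\cdot v_1$ (resp. $\mathcal{A}_{[\mathbf{a}]}\cdot w$ and $\mathcal{A}_{[\mathbf{a}]}\cdot w_1$) coincide if and only if $v\in\langle v_1\rangle$ (resp. $w\in\langle w_1\rangle$), for $v,v_1$ with $M[(13)(23)]=\langle v,m_{\mathsf{o}}\rangle=\langle v_1,m_{\mathsf{o}}\rangle$ (resp. $w,w_1$ with $M[e]=\langle w,m_{(13)(12)(23)}\rangle=\langle w_1,m_{(13)(12)(23)}\rangle$).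
   Context: $\Bbbk$ is an algebraically closed field of characteristic $0$; $\langle S\rangle$ denotes the linear span of $S$. $\mathcal{O}_2^3=\{(12),(13),(23)\}\subset\mathbb{S}_3$; $\Bbbk^{\mathbb{S}_3}$ is the algebra of functions on $\mathbb{S}_3$ with basis the characteristic functions $\delta_g$ of $\{g\}$, $g\in\mathbb{S}_3$. $\mathfrak{A}_3=\{\mathbf{a}=(a_{(12)},a_{(13)},a_{(23)})\in\Bbbk^3: a_{(12)}+a_{(13)}+a_{(23)}=0\}$. For $\mathbf{a}\in\mathfrak{A}_3$ and $(ij)\in\mathcal{O}_2^3$ put $f_{ij}=\sum_{g\in\mathbb{S}_3}(a_{(ij)}-a_{g^{-1}(ij)g})\delta_g\in\Bbbk^{\mathbb{S}_3}$. $\mathcal{A}_{[\mathbf{a}]}$ is the algebra generated by $\Bbbk^{\mathbb{S}_3}$ and $x_{(12)},x_{(13)},x_{(23)}$ with relations $\delta_h x_{(ij)}=x_{(ij)}\delta_{(ij)h}$ ($h\in\mathbb{S}_3$), $x_{(ij)}^2=f_{ij}$, $x_{(13)}x_{(23)}+x_{(23)}x_{(12)}+x_{(12)}x_{(13)}=0$ and $x_{(23)}x_{(13)}+x_{(13)}x_{(12)}+x_{(12)}x_{(23)}=0$. (It is known to have dimension $72$ and to contain $\Bbbk^{\mathbb{S}_3}$ as a subalgebra.) Modules are left modules. For an $\mathcal{A}_{[\mathbf{a}]}$-module $M$ and $g\in\mathbb{S}_3$, $M[g]=\delta_g\cdot M$. The Verma module is $M_g=\mathcal{A}_{[\mathbf{a}]}\otimes_{\Bbbk^{\mathbb{S}_3}}\Bbbk_g$,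 where $\Bbbk_g$ is the one-dimensional $\Bbbk^{\mathbb{S}_3}$-module with $f\cdot 1=f(g)1$. In $M_g$ write $m_{(ij)\cdots(rs)}=x_{(ij)}\cdots x_{(rs)}\otimes 1$ and $m_{\mathrm{top}}=m_{(13)(12)(23)(12)}$. For a subspace $U$ of a module, $\mathcal{A}_{[\mathbf{a}]}\cdot U$ is the submodule it generates. Assume $a_{(12)}\neq a_{(13)}=a_{(23)}$. $\Bbbk_e$ also denotes the one-dimensional $\mathcal{A}_{[\mathbf{a}]}$-module on which every $x_{(ij)}$ acts by $0$ and $f\in\Bbbk^{\mathbb{S}_3}$ acts by $f(e)$. $L$ is the $\mathcal{A}_{[\mathbf{a}]}$-module with basis $\{v_{(13)},v_{(23)},v_{(13)(23)},v_{(23)(13)}\}$, $v_g\in L[g]$, and $x_{(ij)}\cdot v_g=0$ if $g=(ij)$; $x_{(ij)}\cdot v_g=v_{(ij)g}$ if $g\neq(ij)$ and $\operatorname{sgn} g=-1$; $x_{(ij)}\cdot v_g=f_{ij}(g)v_{(ij)g}$ if $\operatorname{sgn} g=1$ (read as $0$ when $(ij)g=(12)$, since then $f_{ij}(g)=0$). *)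

theory Defs
  imports
    "HOL-Library.Numeral_Type"
    "HOL-Library.Function_Algebras"
    "HOL-Combinatorics.Perm"
    "HOL-Combinatorics.Permutations"
    "HOL-Computational_Algebra.Polynomial"
    "HOL-Algebra.Module"
    "HOL-Algebra.QuotRing"
    "HOL-Algebra.Free_Abelian_Groups"
    "HOL-Algebra.Algebraic_Closure_Type"
begin

text \<open>The type \<open>3\<close> is the integers modulo 3, so its elements are \<open>1\<close>, \<open>2\<close> and \<open>3 = 0\<close>. The product of
  permutations is composition.\<close>

type_synonym S3 = "3 Perm.perm"

instance Perm.perm :: (finite) finite
proof
  have "inj (Perm.apply :: 'a Perm.perm \<Rightarrow> 'a \<Rightarrow> 'a)"
    by (rule injI) (simp add: Perm.apply_inject)
  then show "finite (UNIV :: 'a Perm.perm set)"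
    by (rule finite_imageD[rotated]) (rule finite_subset[OF subset_UNIV finite])
qed

datatype transp = T12 | T13 | T23

primrec perm_of :: "transp \<Rightarrow> S3" where
  "perm_of T12 = Perm.swap 1 2"
| "perm_of T13 = Perm.swap 1 3"
| "perm_of T23 = Perm.swap 2 3"

definition conj_transp :: "S3 \<Rightarrow> transp \<Rightarrow> transp" where
  "conj_transp g t = (THE s. perm_of s = inverse g * perm_of t * g)"

definition f_fun :: "(transp \<Rightarrow> 'k::field) \<Rightarrow> transp \<Rightarrow> S3 \<Rightarrow> 'k" where
  "f_fun a t g = a t - a (conj_transp g t)"

text \<open>Lists under concatenation are the free monoid, so \<open>gen list \<Rightarrow>\<^sub>0 'k\<close> with the convolution
  product of \<^theory>\<open>HOL-Library.Poly_Mapping\<close> is the free associative algebra on \<open>gen\<close>.\<close>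

instantiation list :: (type) monoid_add
begin
definition zero_list :: "'a list" where "zero_list = []"
definition plus_list :: "'a list \<Rightarrow> 'a list \<Rightarrow> 'a list" where "plus_list = (@)"
instance by standard (simp_all add: zero_list_def plus_list_def)
end

datatype gen = Delta S3 | Refl transp

type_synonym 'k free_alg = "gen list \<Rightarrow>\<^sub>0 'k"

abbreviation delta :: "S3 \<Rightarrow> 'k::field free_alg" where
  "delta g \<equiv> Poly_Mapping.single [Delta g] 1"

abbreviation xgen :: "transp \<Rightarrow> 'k::field free_alg" where
  "xgen t \<equiv> Poly_Mapping.single [Refl t] 1"

definition fun_elt :: "(S3 \<Rightarrow> 'k::field) \<Rightarrow> 'k free_alg" where
  "fun_elt f = (\<Sum>g\<in>UNIV. Poly_Mapping.single [Delta g] (f g))"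

text \<open>The first two families present the function algebra on the symmetric group.\<close>

definition relations :: "(transp \<Rightarrow> 'k::field) \<Rightarrow> 'k free_alg set" where
  "relations a =
     {delta g * delta h - (if g = h then delta g else 0) | g h. True}
   \<union> {(\<Sum>g\<in>UNIV. delta g) - 1}
   \<union> {delta h * xgen t - xgen t * delta (perm_of t * h) | h t. True}
   \<union> {xgen t * xgen t - fun_elt (f_fun a t) | t. True}
   \<union> {xgen T13 * xgen T23 + xgen T23 * xgen T12 + xgen T12 * xgen T13,
      xgen T23 * xgen T13 + xgen T13 * xgen T12 + xgen T12 * xgen T23}"

definition rel_ideal :: "(transp \<Rightarrow> 'k::field) \<Rightarrow> 'k free_alg set" where
  "rel_ideal a = genideal ring_of_type_algebra (relations a)"

definition alg :: "(transp \<Rightarrow> 'k::field) \<Rightarrow> 'k free_alg set ring" where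
  "alg a = ring_of_type_algebra Quot rel_ideal a"

definition cls :: "(transp \<Rightarrow> 'k::field) \<Rightarrow> 'k free_alg \<Rightarrow> 'k free_alg set" where
  "cls a p = rel_ideal a +>\<^bsub>ring_of_type_algebra\<^esub> p"

definition scalars :: "(transp \<Rightarrow> 'k::field) \<Rightarrow> 'k free_alg set ring" where
  "scalars a = (alg a)\<lparr>carrier := range (\<lambda>c. cls a (Poly_Mapping.single 0 c))\<rparr>"

text \<open>Left modules over a noncommutative ring are written with the record \<open>module\<close>, whose ring
  multiplication fields are irrelevant and left \<open>undefined\<close>. The locale \<open>submodule\<close> makes sense over
  any ring: additive subgroup closed under the action.\<close>

definition gen_submodule ::
    "('r, 's) ring_scheme \<Rightarrow> ('r, 'm, 't) module_scheme \<Rightarrow> 'm set \<Rightarrow> 'm set" where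
  "gen_submodule R M U = \<Inter>{N. submodule N R M \<and> U \<subseteq> N}"

text \<open>A subspace is a submodule for the subring of scalars.\<close>

definition lin_span ::
    "(transp \<Rightarrow> 'k::field) \<Rightarrow> ('k free_alg set, 'm) module \<Rightarrow> 'm set \<Rightarrow> 'm set" where
  "lin_span a M U = gen_submodule (scalars a) M U"

definition quot_module :: "('r, 'm) module \<Rightarrow> 'm set \<Rightarrow> ('r, 'm set) module" where
  "quot_module M Y =
     \<lparr>carrier = a_rcosets\<^bsub>M\<^esub> Y, monoid.mult = undefined, one = undefined, zero = Y, add = set_add M,
      module.smult = (\<lambda>r C. \<Union>m\<in>C. Y +>\<^bsub>M\<^esub> (r \<odot>\<^bsub>M\<^esub> m))\<rparr>"

definition subquotient :: "('r, 'm) module \<Rightarrow> 'm set \<Rightarrow> 'm set \<Rightarrow> ('r, 'm set) module" where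
  "subquotient M U Y = quot_module (M\<lparr>carrier := U\<rparr>) Y"

definition module_isomorphic ::
    "('r, 's) ring_scheme \<Rightarrow> ('r, 'm) module \<Rightarrow> ('r, 'n) module \<Rightarrow> bool" where
  "module_isomorphic R M N \<longleftrightarrow>
     (\<exists>h \<in> iso (add_monoid M) (add_monoid N).
        \<forall>r\<in>carrier R. \<forall>m\<in>carrier M. h (r \<odot>\<^bsub>M\<^esub> m) = r \<odot>\<^bsub>N\<^esub> h m)"

definition weight_space ::
    "(transp \<Rightarrow> 'k::field) \<Rightarrow> ('k free_alg set, 'm) module \<Rightarrow> S3 \<Rightarrow> 'm set" where
  "weight_space a M g = (\<lambda>m. cls a (delta g) \<odot>\<^bsub>M\<^esub> m) ` carrier M"

text \<open>The tensor product of \<open>R\<close>, a right module over \<open>B\<close> through \<open>\<iota>\<close>, with a left \<open>B\<close>-module \<open>N\<close>: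
  the free abelian group on pairs modulo biadditivity and balancedness.\<close>

definition tensor_free :: "'r ring \<Rightarrow> ('b, 'n) module \<Rightarrow> (('r \<times> 'n) \<Rightarrow>\<^sub>0 int) monoid" where
  "tensor_free R N = free_Abelian_group (carrier R \<times> carrier N)"

definition tensor_rel ::
    "'r ring \<Rightarrow> 'b ring \<Rightarrow> ('b \<Rightarrow> 'r) \<Rightarrow> ('b, 'n) module \<Rightarrow> (('r \<times> 'n) \<Rightarrow>\<^sub>0 int) set" where
  "tensor_rel R B \<iota> N = generate (tensor_free R N)
     ({frag_of (r \<oplus>\<^bsub>R\<^esub> s, n) - frag_of (r, n) - frag_of (s, n) | r s n.
         r \<in> carrier R \<and> s \<in> carrier R \<and> n \<in> carrier N}
    \<union> {frag_of (r, n \<oplus>\<^bsub>N\<^esub> n') - frag_of (r, n) - frag_of (r, n') | r n n'.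
         r \<in> carrier R \<and> n \<in> carrier N \<and> n' \<in> carrier N}
    \<union> {frag_of (r \<otimes>\<^bsub>R\<^esub> \<iota> b, n) - frag_of (r, b \<odot>\<^bsub>N\<^esub> n) | r b n.
         r \<in> carrier R \<and> b \<in> carrier B \<and> n \<in> carrier N})"

definition pure_tensor ::
    "'r ring \<Rightarrow> 'b ring \<Rightarrow> ('b \<Rightarrow> 'r) \<Rightarrow> ('b, 'n) module \<Rightarrow> 'r \<Rightarrow> 'n \<Rightarrow> (('r \<times> 'n) \<Rightarrow>\<^sub>0 int) set"
  where
  "pure_tensor R B \<iota> N r n = tensor_rel R B \<iota> N #>\<^bsub>tensor_free R N\<^esub> frag_of (r, n)"

definition tensor_module ::
    "'r ring \<Rightarrow> 'b ring \<Rightarrow> ('b \<Rightarrow> 'r) \<Rightarrow> ('b, 'n) module \<Rightarrow>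
       ('r, (('r \<times> 'n) \<Rightarrow>\<^sub>0 int) set) module" where
  "tensor_module R B \<iota> N =
     \<lparr>carrier = carrier (tensor_free R N Mod tensor_rel R B \<iota> N),
      monoid.mult = undefined, one = undefined,
      zero = \<one>\<^bsub>tensor_free R N Mod tensor_rel R B \<iota> N\<^esub>,
      add = monoid.mult (tensor_free R N Mod tensor_rel R B \<iota> N),
      module.smult = (\<lambda>r C. \<Union>p\<in>C. tensor_rel R B \<iota> N #>\<^bsub>tensor_free R N\<^esub>
                 frag_extend (\<lambda>(s, n). frag_of (r \<otimes>\<^bsub>R\<^esub> s, n)) p)\<rparr>"

abbreviation fun_ring :: "(S3 \<Rightarrow> 'k::field) ring" where
  "fun_ring \<equiv> ring_of_type_algebra"

definition fun_module :: "S3 \<Rightarrow> (S3 \<Rightarrow> 'k::field, 'k) module" where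
  "fun_module g = \<lparr>carrier = UNIV, monoid.mult = undefined, one = undefined, zero = 0, add = (+),
     module.smult = (\<lambda>f c. f g * c)\<rparr>"

type_synonym 'k verma_elt = "(('k free_alg set \<times> 'k) \<Rightarrow>\<^sub>0 int) set"

definition verma :: "(transp \<Rightarrow> 'k::field) \<Rightarrow> S3 \<Rightarrow> ('k free_alg set, 'k verma_elt) module" where
  "verma a g = tensor_module (alg a) fun_ring (\<lambda>f. cls a (fun_elt f)) (fun_module g)"

definition verma_mon :: "(transp \<Rightarrow> 'k::field) \<Rightarrow> S3 \<Rightarrow> transp list \<Rightarrow> 'k verma_elt" where
  "verma_mon a g ts = pure_tensor (alg a) fun_ring (\<lambda>f. cls a (fun_elt f)) (fun_module g)
     (cls a (prod_list (map xgen ts))) 1"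

definition rep_act ::
    "('k::field \<Rightarrow> 'v::ab_group_add \<Rightarrow> 'v) \<Rightarrow> (gen \<Rightarrow> 'v \<Rightarrow> 'v) \<Rightarrow> 'k free_alg \<Rightarrow> 'v \<Rightarrow> 'v" where
  "rep_act scale \<rho> p v =
     (\<Sum>w\<in>Poly_Mapping.keys p. scale (Poly_Mapping.lookup p w) (foldr \<rho> w v))"

text \<open>The module on the vector space \<open>V\<close> on which the generators act by \<open>\<rho>\<close>; meaningful when \<open>\<rho>\<close>
  satisfies the relations, so that all representatives of a class act in the same way.\<close>

definition rep_module ::
    "('k::field \<Rightarrow> 'v::ab_group_add \<Rightarrow> 'v) \<Rightarrow> 'v set \<Rightarrow> (gen \<Rightarrow> 'v \<Rightarrow> 'v) \<Rightarrow>
       ('k free_alg set, 'v) module" where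
  "rep_module scale V \<rho> = \<lparr>carrier = V, monoid.mult = undefined, one = undefined, zero = 0, add = (+),
     module.smult = (\<lambda>C v. the_elem ((\<lambda>p. rep_act scale \<rho> p v) ` C))\<rparr>"

primrec Ke_op :: "gen \<Rightarrow> 'k::field \<Rightarrow> 'k" where
  "Ke_op (Delta g) c = (if g = 1 then c else 0)"
| "Ke_op (Refl t) c = 0"

definition Ke :: "('k::field free_alg set, 'k) module" where
  "Ke = rep_module (*) UNIV Ke_op"

text \<open>The space of \<open>L\<close> is realised as the functions on the group supported on \<open>L_index\<close>. The vector
  \<open>L_vec h\<close> is the basis vector at \<open>h\<close>, and zero when \<open>h\<close> is not an index (which
  happens for \<open>perm_of t * g\<close> with \<open>g\<close> even only at coefficients \<open>f_fun a t g\<close> that vanish).\<close>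

definition fun_scale :: "'k::field \<Rightarrow> (S3 \<Rightarrow> 'k) \<Rightarrow> S3 \<Rightarrow> 'k" where
  "fun_scale c u = (\<lambda>h. c * u h)"

definition L_index :: "S3 set" where
  "L_index = {perm_of T13, perm_of T23, perm_of T13 * perm_of T23, perm_of T23 * perm_of T13}"

definition L_vec :: "S3 \<Rightarrow> S3 \<Rightarrow> 'k::field" where
  "L_vec h = (\<lambda>i. if i = h \<and> h \<in> L_index then 1 else 0)"

definition L_x :: "(transp \<Rightarrow> 'k::field) \<Rightarrow> transp \<Rightarrow> S3 \<Rightarrow> S3 \<Rightarrow> 'k" where
  "L_x a t g =
     (if g = perm_of t then 0
      else if sign (Perm.apply g) = - 1 then L_vec (perm_of t * g)
      else fun_scale (f_fun a t g) (L_vec (perm_of t * g)))"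

primrec L_op :: "(transp \<Rightarrow> 'k::field) \<Rightarrow> gen \<Rightarrow> (S3 \<Rightarrow> 'k) \<Rightarrow> S3 \<Rightarrow> 'k" where
  "L_op a (Delta g) u = fun_scale (u g) (L_vec g)"
| "L_op a (Refl t) u = (\<Sum>g\<in>L_index. fun_scale (u g) (L_x a t g))"

definition L_module :: "(transp \<Rightarrow> 'k::field) \<Rightarrow> ('k free_alg set, S3 \<Rightarrow> 'k) module" where
  "L_module a = rep_module fun_scale {u. \<forall>h. h \<notin> L_index \<longrightarrow> u h = 0} (L_op a)"

definition covering_pairs :: "'a set set \<Rightarrow> ('a set \<times> 'a set) set" where
  "covering_pairs P = {(U, Y). U \<in> P \<and> Y \<in> P \<and> Y \<subset> U \<and> \<not> (\<exists>Z\<in>P. Y \<subset> Z \<and> Z \<subset> U)}"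

definition M12 :: "(transp \<Rightarrow> 'k::field) \<Rightarrow> ('k free_alg set, 'k verma_elt) module" where
  "M12 a = verma a (perm_of T12)"

definition proper_submodules :: "(transp \<Rightarrow> 'k::field) \<Rightarrow> 'k verma_elt set set" where
  "proper_submodules a =
     {U. submodule U (alg a) (M12 a) \<and> U \<noteq> carrier (M12 a) \<and> U \<noteq> {\<zero>\<^bsub>M12 a\<^esub>}}"

definition sub12 :: "(transp \<Rightarrow> 'k::field) \<Rightarrow> 'k verma_elt set \<Rightarrow> 'k verma_elt set" where
  "sub12 a U = gen_submodule (alg a) (M12 a) U"

definition span12 :: "(transp \<Rightarrow> 'k::field) \<Rightarrow> 'k verma_elt set \<Rightarrow> 'k verma_elt set" where
  "span12 a U = lin_span a (M12 a) U"

definition Mh :: "(transp \<Rightarrow> 'k::field) \<Rightarrow> 'k verma_elt set" where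
  "Mh a = weight_space a (M12 a) (perm_of T13 * perm_of T23)"

definition Me :: "(transp \<Rightarrow> 'k::field) \<Rightarrow> 'k verma_elt set" where
  "Me a = weight_space a (M12 a) 1"

definition m12 :: "(transp \<Rightarrow> 'k::field) \<Rightarrow> transp list \<Rightarrow> 'k verma_elt" where
  "m12 a ts = verma_mon a (perm_of T12) ts"

definition m_o :: "(transp \<Rightarrow> 'k::field) \<Rightarrow> 'k verma_elt" where
  "m_o a = m12 a [T13, T12, T13] \<oplus>\<^bsub>M12 a\<^esub>
     cls a (Poly_Mapping.single 0 (f_fun a T13 (perm_of T23))) \<odot>\<^bsub>M12 a\<^esub> m12 a [T23]"

definition m_3 :: "(transp \<Rightarrow> 'k::field) \<Rightarrow> 'k verma_elt" where
  "m_3 a = m12 a [T13, T12, T23]"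

definition m_top :: "(transp \<Rightarrow> 'k::field) \<Rightarrow> 'k verma_elt" where
  "m_top a = m12 a [T13, T12, T23, T12]"

definition N12 :: "(transp \<Rightarrow> 'k::field) \<Rightarrow> 'k verma_elt set" where
  "N12 a = sub12 a (Mh a <+>\<^bsub>M12 a\<^esub> Me a)"

definition v_set :: "(transp \<Rightarrow> 'k::field) \<Rightarrow> 'k verma_elt set" where
  "v_set a = {v \<in> Mh a. Mh a = span12 a {v, m_o a}}"

definition w_set :: "(transp \<Rightarrow> 'k::field) \<Rightarrow> 'k verma_elt set" where
  "w_set a = {w \<in> Me a. Me a = span12 a {w, m_3 a}}"

text \<open>The edges of the Hasse diagram, larger submodule first, by the isomorphism type of the
  subquotient.\<close>

definition edges_Ke :: "(transp \<Rightarrow> 'k::field) \<Rightarrow> ('k verma_elt set \<times> 'k verma_elt set) set" where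
  "edges_Ke a =
     {(N12 a, sub12 a (Mh a)),
      (sub12 a (Me a), sub12 a (span12 a {m_3 a, m_o a})),
      (sub12 a (span12 a {m_3 a, m_o a}), sub12 a {m_o a}),
      (sub12 a {m_3 a}, span12 a {m_top a})}
   \<union> {(sub12 a (Me a), sub12 a {w}) | w. w \<in> w_set a}
   \<union> {(sub12 a {w}, sub12 a {m_o a}) | w. w \<in> w_set a}"

definition edges_L :: "(transp \<Rightarrow> 'k::field) \<Rightarrow> ('k verma_elt set \<times> 'k verma_elt set) set" where
  "edges_L a =
     {(N12 a, sub12 a (Me a)),
      (sub12 a (Mh a), sub12 a (span12 a {m_3 a, m_o a})),
      (sub12 a (span12 a {m_3 a, m_o a}), sub12 a {m_3 a}),
      (sub12 a {m_o a}, span12 a {m_top a})}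
   \<union> {(sub12 a (Mh a), sub12 a {v}) | v. v \<in> v_set a}
   \<union> {(sub12 a {v}, sub12 a {m_3 a}) | v. v \<in> v_set a}"

end

theory Submission
  imports Defs "HOL-Library.Product_Plus"
begin

text \<open>The module \<open>M = M\<^sub>(\<^sub>1\<^sub>2\<^sub>)\<close> is identified with an explicit twelve-dimensional representation whose six
  weight spaces are all copies of \<open>k\<^sup>2\<close>. In suitable coordinates the generators act between the four
  weight spaces that occur in \<open>L\<close> by the scalars of \<open>L\<close>, and between the other weight spaces by maps that
  are triangular for the line \<open>0 \<times> k\<close>. Hence a submodule amounts to three subspaces \<open>P\<close>, \<open>Q\<close>, \<open>R\<close> of
  \<open>k\<^sup>2\<close> (the common component at the weights of \<open>L\<close>, the component at \<open>e\<close> and the one at \<open>(12)\<close>), and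
  a proper nonzero one to \<open>R = 0 \<times> k\<close> and a pair \<open>(P, Q)\<close> in which either component contains \<open>0 \<times> k\<close> as soon
  as the other one is not contained in \<open>0 \<times> k\<close>. Enlarging \<open>Q\<close> by one dimension gives a subquotient
  \<open>k\<^sub>e\<close>, and enlarging \<open>P\<close> by one dimension gives \<open>L\<close>.\<close>

text \<open>In a tensor product built from a free abelian group, the independence of twelve given
  elements cannot be read off. The identification therefore runs both ways: \<open>lift\<close>
  turns a model vector into a combination of words in the free algebra, and acting on the cyclic
  vector \<open>emb g0 (1, 0)\<close> leads back to the model. The second map is well defined on the
  Verma module because the relations hold in the model; the first is onto modulo \<open>vann\<close>
  because words can be rewritten. The coordinates are dictated by \<open>x_t^2 = f_t\<close>. All
  values of \<open>f_t\<close> are \<open>0\<close>, \<open>b\<close> or \<open>-b\<close> with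
  \<open>b = a T13 - a T12\<close>, and the pairs of weights \<open>g\<close>, \<open>t g\<close>
  with a nonzero value form a four-cycle through \<open>L_index\<close>. Along this cycle the
  generators are invertible and a full turn is a scalar, so that a single plane with a single basis
  can serve all four weights. Across every other pair \<open>x_t\<close> squares to zero, and these
  maps are what couples \<open>P\<close>, \<open>Q\<close> and \<open>R\<close>.\<close>

lemma poly_mapping_induct_single [case_names zero single add]:
  fixes p :: "'a \<Rightarrow>\<^sub>0 'b::comm_monoid_add"
  assumes zero: "P 0" and single: "\<And>k c. P (Poly_Mapping.single k c)"
    and add: "\<And>p q. P p \<Longrightarrow> P q \<Longrightarrow> P (p + q)"
  shows "P p"
proof -
  have eq: "p = (\<Sum>k\<in>Poly_Mapping.keys p. Poly_Mapping.single k (Poly_Mapping.lookup p k))"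
  proof (rule poly_mapping_eqI)
    fix k
    have "(\<Sum>j\<in>Poly_Mapping.keys p. Poly_Mapping.lookup (Poly_Mapping.single j (Poly_Mapping.lookup p j)) k)
      = (\<Sum>j\<in>Poly_Mapping.keys p. if k = j then Poly_Mapping.lookup p j else 0)"
      by (rule sum.cong) (auto simp: lookup_single when_def)
    also have "\<dots> = Poly_Mapping.lookup p k"
      by (auto simp: in_keys_iff)
    finally show "Poly_Mapping.lookup p k = Poly_Mapping.lookup
        (\<Sum>k\<in>Poly_Mapping.keys p. Poly_Mapping.single k (Poly_Mapping.lookup p k)) k"
      by (simp add: lookup_sum)
  qed
  have "P (\<Sum>k\<in>A. Poly_Mapping.single k (Poly_Mapping.lookup p k))" if "finite A" for A
    using that by induction (auto intro: assms)
  then show ?thesis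
    by (subst eq) simp
qed

lemma gen_list_zero: "(0 :: 'a list) = []" and gen_list_add: "(xs + ys :: 'a list) = xs @ ys"
  by (simp_all add: zero_list_def plus_list_def)

subsection \<open>Representations of the free algebra\<close>

text \<open>Only linearity is imposed, so the model and the operators of \<open>Ke\<close> and
  \<open>L_module\<close> are all instances. The relations of the algebra are verified for the
  model; the other two inherit them through the surjection in
  \<open>subquotient_isomorphic\<close>.\<close>

locale free_alg_rep = vector_space scale
  for scale :: "'k::field \<Rightarrow> 'v::ab_group_add \<Rightarrow> 'v" +
  fixes \<rho> :: "gen \<Rightarrow> 'v \<Rightarrow> 'v"
  assumes \<rho>_add: "\<rho> x (u + v) = \<rho> x u + \<rho> x v"
    and \<rho>_scale: "\<rho> x (scale c u) = scale c (\<rho> x u)"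
begin

abbreviation act :: "'k free_alg \<Rightarrow> 'v \<Rightarrow> 'v" where "act \<equiv> rep_act scale \<rho>"

lemma foldr_add: "foldr \<rho> w (u + v) = foldr \<rho> w u + foldr \<rho> w v"
  by (induction w) (auto simp: \<rho>_add)

lemma foldr_scale: "foldr \<rho> w (scale c u) = scale c (foldr \<rho> w u)"
  by (induction w) (auto simp: \<rho>_scale)

lemma act_zero [simp]: "act 0 v = 0"
  by (simp add: rep_act_def)

lemma act_single: "act (Poly_Mapping.single w c) v = scale c (foldr \<rho> w v)"
  by (simp add: rep_act_def)

lemma act_plus: "act (p + q) v = act p v + act q v"
  unfolding rep_act_def by (rule setsum_keys_plus_distrib) (auto simp: scale_left_distrib)

lemma act_minus: "act (p - q) v = act p v - act q v"
  using act_plus[of "p - q" q v] by (simp add: algebra_simps)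

lemma act_uminus: "act (- p) v = - act p v"
  using act_minus[of 0 p v] by simp

lemma act_sum: "act (\<Sum>i\<in>I. f i) v = (\<Sum>i\<in>I. act (f i) v)"
  by (induction I rule: infinite_finite_induct) (auto simp: act_plus)

lemma act_add_right: "act p (u + v) = act p u + act p v"
  by (simp add: rep_act_def foldr_add scale_right_distrib sum.distrib)

lemma act_scale: "act p (scale c v) = scale c (act p v)"
  by (simp add: rep_act_def foldr_scale scale_sum_right mult.commute)

lemma act_zero_right [simp]: "act p 0 = 0"
  using act_scale[of p 0 0] by simp

lemma act_mult: "act (p * q) v = act p (act q v)"
proof (induction p rule: poly_mapping_induct_single)
  case (single k c)
  show ?case
  proof (induction q rule: poly_mapping_induct_single)
    case (single l d)
    show ?case by (simp add: mult_single act_single gen_list_add foldr_scale)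
  qed (simp_all add: distrib_left act_plus act_add_right)
qed (simp_all add: distrib_right act_plus)

lemma act_const: "act (Poly_Mapping.single 0 c) v = scale c v"
  by (simp add: act_single gen_list_zero)

lemma act_one [simp]: "act 1 v = v"
  using act_const[of 1 v] by simp

lemma act_gen: "act (Poly_Mapping.single [x] 1) v = \<rho> x v"
  by (simp add: act_single)

definition invariant :: "'v set \<Rightarrow> bool" where
  "invariant W \<longleftrightarrow> subspace W \<and> (\<forall>x. \<forall>u\<in>W. \<rho> x u \<in> W)"

lemma invariant_foldr: "invariant W \<Longrightarrow> u \<in> W \<Longrightarrow> foldr \<rho> w u \<in> W"
  by (induction w) (auto simp: invariant_def)

lemma invariant_act: "invariant W \<Longrightarrow> u \<in> W \<Longrightarrow> act p u \<in> W"
  unfolding rep_act_def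
  by (intro subspace_sum subspace_scale invariant_foldr) (auto simp: invariant_def)

text \<open>Scalars are constants of the free algebra and generators are words of length one, so
  closure under \<open>act\<close> contains closure under both. This is the form that matches
  \<open>submodule\<close>, which knows only addition and the ring action.\<close>

lemma invariant_iff_act:
  "invariant W \<longleftrightarrow> 0 \<in> W \<and> (\<forall>u\<in>W. \<forall>v\<in>W. u + v \<in> W) \<and> (\<forall>p. \<forall>u\<in>W. act p u \<in> W)" (is "_ \<longleftrightarrow> ?R")
proof
  assume "invariant W"
  then show ?R
    by (meson invariant_act invariant_def subspace_def)
next
  assume R: ?R
  then have "scale c u \<in> W" if "u \<in> W" for c u
    using that act_const[of c u] by metis
  moreover have "\<rho> x u \<in> W" if "u \<in> W" for x u
    using R that act_gen[of x u] by metis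
  ultimately show "invariant W"
    using R by (simp add: invariant_def subspace_def)
qed

end

text \<open>Linearity and compatibility are asked for on \<open>W\<close> only, because the
  projection of a submodule onto a simple subquotient need not commute with the generators outside
  that submodule.\<close>

lemma free_alg_rep_equivariant:
  assumes "free_alg_rep s1 \<rho>1" "free_alg_rep s2 \<rho>2" "free_alg_rep.invariant s1 \<rho>1 W"
    and add: "\<And>u v. u \<in> W \<Longrightarrow> v \<in> W \<Longrightarrow> T (u + v) = T u + T v"
    and scale: "\<And>c u. u \<in> W \<Longrightarrow> T (s1 c u) = s2 c (T u)"
    and gen: "\<And>x u. u \<in> W \<Longrightarrow> T (\<rho>1 x u) = \<rho>2 x (T u)"
    and u: "u \<in> W"
  shows "T (rep_act s1 \<rho>1 p u) = rep_act s2 \<rho>2 p (T u)"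
proof -
  interpret R1: free_alg_rep s1 \<rho>1 by fact
  interpret R2: free_alg_rep s2 \<rho>2 by fact
  note W = R1.invariant_act[OF assms(3)]
  have w: "T (foldr \<rho>1 w u) = foldr \<rho>2 w (T u)" for w
    by (induction w) (auto simp: gen R1.invariant_foldr[OF assms(3) u])
  have T0: "T 0 = 0"
    using scale[OF u, of 0] by simp
  show ?thesis
  proof (induction p rule: poly_mapping_induct_single)
    case (single k c)
    show ?case
      by (simp add: R1.act_single R2.act_single scale w R1.invariant_foldr[OF assms(3) u])
  qed (simp_all add: T0 R1.act_plus R2.act_plus add W u)
qed

subsection \<open>The presented algebra\<close>

lemma comm_group_type:
  "comm_group \<lparr>carrier = UNIV, monoid.mult = (+), one = (0 :: 'a::ab_group_add)\<rparr>"
proof (rule comm_groupI)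
  show "\<exists>y\<in>carrier \<lparr>carrier = UNIV, monoid.mult = (+), one = 0\<rparr>.
      y \<otimes>\<^bsub>\<lparr>carrier = UNIV, monoid.mult = (+), one = 0\<rparr>\<^esub> x = \<one>\<^bsub>\<lparr>carrier = UNIV, monoid.mult = (+), one = (0 :: 'a)\<rparr>\<^esub>" for x
    by (auto intro: exI[of _ "- x"])
qed (auto simp: add_ac)

lemma inv_type [simp]:
  "inv\<^bsub>\<lparr>carrier = UNIV, monoid.mult = (+), one = (0 :: 'a::ab_group_add)\<rparr>\<^esub> x = - x"
  by (rule group.inv_equality[OF comm_group.axioms(2)[OF comm_group_type]]) auto

lemma ring_type_algebra: "ring (ring_of_type_algebra :: 'a::ring_1 ring)"
proof -
  have "\<exists>y. x + y = 0" for x :: 'a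
    using add.right_inverse by blast
  then show ?thesis
    unfolding ring_of_type_algebra_def
    by unfold_locales (auto simp: algebra_simps Units_def)
qed

lemma ring_type_algebra_sel [simp]:
  "carrier ring_of_type_algebra = UNIV" "monoid.mult ring_of_type_algebra = (*)"
  "one ring_of_type_algebra = 1" "zero ring_of_type_algebra = 0" "add ring_of_type_algebra = (+)"
  by (simp_all add: ring_of_type_algebra_def fun_eq_iff)

lemma ideal_rel_ideal: "ideal (rel_ideal a) ring_of_type_algebra"
  unfolding rel_ideal_def by (rule ring.genideal_ideal[OF ring_type_algebra]) simp

lemma relations_subset_rel_ideal: "relations a \<subseteq> rel_ideal a"
  unfolding rel_ideal_def by (rule ring.genideal_self[OF ring_type_algebra]) simp

lemma cls_eq: "cls a p = {r + p |r. r \<in> rel_ideal a}"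
  by (auto simp: cls_def a_r_coset_def r_coset_def)

lemma mem_cls: "q \<in> cls a p \<longleftrightarrow> q - p \<in> rel_ideal a"
proof -
  have "q = (q - p) + p"
    by simp
  then show ?thesis
    unfolding cls_eq by force
qed

lemma cls_self: "p \<in> cls a p"
  unfolding cls_def
  by (rule abelian_subgroup.a_rcos_self[OF abelian_subgroupI3])
    (simp_all add: ideal.axioms(1)[OF ideal_rel_ideal] ring.is_abelian_group[OF ring_type_algebra])

lemma cls_eqI: "p - q \<in> rel_ideal a \<Longrightarrow> cls a p = cls a q"
  unfolding cls_def
  by (rule sym, rule abelian_subgroup.a_repr_independence'[OF abelian_subgroupI3])
    (simp_all add: ideal.axioms(1)[OF ideal_rel_ideal] ring.is_abelian_group[OF ring_type_algebra]
      mem_cls[unfolded cls_def])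

lemma ring_alg: "ring (alg a)"
  unfolding alg_def by (rule ideal.quotient_is_ring[OF ideal_rel_ideal])

lemma carrier_alg: "carrier (alg a) = range (cls a)"
  by (auto simp: alg_def FactRing_def A_RCOSETS_def RCOSETS_def a_r_coset_def cls_def[abs_def])

lemma cls_hom: "cls a \<in> ring_hom ring_of_type_algebra (alg a)"
  using ideal.rcos_ring_hom[OF ideal_rel_ideal] by (simp add: alg_def cls_def[abs_def])

lemma cls_mult: "cls a p \<otimes>\<^bsub>alg a\<^esub> cls a q = cls a (p * q)"
  using ring_hom_mult[OF cls_hom, of p q] by simp

lemma cls_add: "cls a p \<oplus>\<^bsub>alg a\<^esub> cls a q = cls a (p + q)"
  using ring_hom_add[OF cls_hom, of p q] by simp

context free_alg_rep
begin

text \<open>The elements that kill all of \<open>W\<close> form a two-sided ideal: closure under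
  right multiplication is where the invariance of \<open>W\<close> enters. It contains the
  relations, hence the ideal that they generate.\<close>

lemma act_rel_ideal:
  assumes W: "invariant W" and rel: "\<And>r v. r \<in> relations a \<Longrightarrow> v \<in> W \<Longrightarrow> act r v = 0"
    and "p \<in> rel_ideal a" "v \<in> W"
  shows "act p v = 0"
proof -
  define I where "I = {p. \<forall>v\<in>W. act p v = 0}"
  have "ideal I ring_of_type_algebra"
  proof (intro idealI ring_type_algebra)
    have "subgroup I \<lparr>carrier = UNIV, monoid.mult = (+), one = 0\<rparr>"
    proof (rule group.subgroupI[OF comm_group.axioms(2)[OF comm_group_type]])
      show "I \<noteq> {}" unfolding I_def using act_zero by blast
    qed (auto simp: I_def act_plus act_uminus)
    then show "subgroup I (add_monoid ring_of_type_algebra)"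
      by simp
  qed (auto simp: I_def act_mult intro: invariant_act[OF W])
  then have "rel_ideal a \<subseteq> I"
    unfolding rel_ideal_def genideal_def using rel by (auto simp: I_def)
  then show ?thesis
    using assms by (auto simp: I_def)
qed

end

subsection \<open>Tensor products\<close>

locale balanced_tensor = ring R
  for R :: "'r ring" (structure) +
  fixes B :: "'b ring" and \<iota> :: "'b \<Rightarrow> 'r" and N :: "('b, 'n) module"
  assumes \<iota>_closed: "b \<in> carrier B \<Longrightarrow> \<iota> b \<in> carrier R"
    and N_add_closed: "n \<in> carrier N \<Longrightarrow> n' \<in> carrier N \<Longrightarrow> n \<oplus>\<^bsub>N\<^esub> n' \<in> carrier N"
    and N_smult_closed: "b \<in> carrier B \<Longrightarrow> n \<in> carrier N \<Longrightarrow> b \<odot>\<^bsub>N\<^esub> n \<in> carrier N"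
begin

abbreviation "F \<equiv> tensor_free R N"
abbreviation "K \<equiv> tensor_rel R B \<iota> N"
abbreviation "T \<equiv> tensor_module R B \<iota> N"
abbreviation "pure \<equiv> pure_tensor R B \<iota> N"

definition gens :: "(('r \<times> 'n) \<Rightarrow>\<^sub>0 int) set" where
  "gens = {frag_of (r \<oplus> s, n) - frag_of (r, n) - frag_of (s, n) | r s n.
         r \<in> carrier R \<and> s \<in> carrier R \<and> n \<in> carrier N}
    \<union> {frag_of (r, n \<oplus>\<^bsub>N\<^esub> n') - frag_of (r, n) - frag_of (r, n') | r n n'.
         r \<in> carrier R \<and> n \<in> carrier N \<and> n' \<in> carrier N}
    \<union> {frag_of (r \<otimes> \<iota> b, n) - frag_of (r, b \<odot>\<^bsub>N\<^esub> n) | r b n.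
         r \<in> carrier R \<and> b \<in> carrier B \<and> n \<in> carrier N}"

lemma K_eq: "K = generate F gens"
  by (simp add: tensor_rel_def gens_def)

lemma comm_group_F: "comm_group F"
  by (simp add: tensor_free_def abelian_free_Abelian_group)

lemma F_mult [simp]: "x \<otimes>\<^bsub>F\<^esub> y = x + y" and F_one [simp]: "\<one>\<^bsub>F\<^esub> = 0"
  and F_carrier: "x \<in> carrier F \<longleftrightarrow> Poly_Mapping.keys x \<subseteq> carrier R \<times> carrier N"
  by (simp_all add: tensor_free_def)

lemma F_inv: "x \<in> carrier F \<Longrightarrow> inv\<^bsub>F\<^esub> x = - x"
  unfolding tensor_free_def by (rule inv_free_Abelian_group) simp

lemma F_frag [simp]: "frag_of p \<in> carrier F \<longleftrightarrow> p \<in> carrier R \<times> carrier N"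
  by (simp add: tensor_free_def)

lemma F_add: "x \<in> carrier F \<Longrightarrow> y \<in> carrier F \<Longrightarrow> x + y \<in> carrier F"
  using group.is_monoid[OF comm_group.axioms(2)[OF comm_group_F]] monoid.m_closed[of F x y] by simp

lemma F_diff: "x \<in> carrier F \<Longrightarrow> y \<in> carrier F \<Longrightarrow> x - y \<in> carrier F"
  using group.inv_closed[OF comm_group.axioms(2)[OF comm_group_F], of y] F_add[of x "- y"]
  by (simp add: F_inv)

lemma gens_subset: "gens \<subseteq> carrier F"
  unfolding gens_def by (auto intro!: F_diff simp: N_add_closed N_smult_closed \<iota>_closed)

lemma K_subgroup: "subgroup K F"
  unfolding K_eq using group.generate_is_subgroup[OF comm_group.axioms(2)[OF comm_group_F] gens_subset] .

lemma K_normal: "normal K F"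
  using K_subgroup comm_group.subgroup_imp_normal[OF comm_group_F] by blast

lemma K_subset: "x \<in> K \<Longrightarrow> x \<in> carrier F"
  using subgroup.subset[OF K_subgroup] by auto

lemma K_zero: "0 \<in> K"
  using subgroup.one_closed[OF K_subgroup] by simp

lemma K_add: "x \<in> K \<Longrightarrow> y \<in> K \<Longrightarrow> x + y \<in> K"
  using subgroup.m_closed[OF K_subgroup, of x y] by simp

lemma K_uminus: "x \<in> K \<Longrightarrow> - x \<in> K"
  using subgroup.m_inv_closed[OF K_subgroup, of x] by (simp add: F_inv K_subset)

abbreviation coset where "coset x \<equiv> K #>\<^bsub>F\<^esub> x"

lemma coset_def: "coset x = {k + x | k. k \<in> K}"
  by (auto simp: r_coset_def)

lemma mem_coset: "y \<in> coset x \<longleftrightarrow> y - x \<in> K"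
proof -
  have "y = (y - x) + x" by simp
  then show ?thesis unfolding coset_def by force
qed

lemma coset_eq_iff: "coset x = coset y \<longleftrightarrow> x - y \<in> K"
proof
  assume "coset x = coset y"
  then show "x - y \<in> K"
    using mem_coset[of x x] mem_coset[of x y] K_zero by simp
next
  assume *: "x - y \<in> K"
  have "z - x \<in> K \<longleftrightarrow> z - y \<in> K" for z
    using K_add[OF _ *, of "z - x"] K_add[OF _ K_uminus[OF *], of "z - y"] by auto
  then show "coset x = coset y"
    by (auto simp: mem_coset)
qed

lemma T_carrier: "carrier T = coset ` carrier F"
  by (auto simp: tensor_module_def FactGroup_def RCOSETS_def)

lemma T_add: "x \<in> carrier F \<Longrightarrow> y \<in> carrier F \<Longrightarrow> coset x \<oplus>\<^bsub>T\<^esub> coset y = coset (x + y)"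
  using normal.rcos_sum[OF K_normal, of x y] by (simp add: tensor_module_def FactGroup_def)

lemma T_zero: "\<zero>\<^bsub>T\<^esub> = coset 0"
  using coset_def[of 0] by (simp add: tensor_module_def FactGroup_def)

definition lmul :: "'r \<Rightarrow> (('r \<times> 'n) \<Rightarrow>\<^sub>0 int) \<Rightarrow> (('r \<times> 'n) \<Rightarrow>\<^sub>0 int)" where
  "lmul r = frag_extend (\<lambda>(s, n). frag_of (r \<otimes> s, n))"

lemma lmul_simps [simp]: "lmul r (frag_of (s, n)) = frag_of (r \<otimes> s, n)"
  "lmul r (x + y) = lmul r x + lmul r y" "lmul r (x - y) = lmul r x - lmul r y"
  "lmul r (- x) = - lmul r x" "lmul r 0 = 0"
  by (simp_all add: lmul_def frag_extend_add frag_extend_diff frag_extend_minus)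

text \<open>Each of the three families of relators is stable by itself: the first by distributivity,
  the second trivially, the third by associativity. Hence left multiplication descends to the tensor
  product.\<close>

lemma lmul_gens:
  assumes r: "r \<in> carrier R" and x: "x \<in> gens"
  shows "lmul r x \<in> gens"
proof -
  from x consider
    (1) s t n where "x = frag_of (s \<oplus> t, n) - frag_of (s, n) - frag_of (t, n)"
        "s \<in> carrier R" "t \<in> carrier R" "n \<in> carrier N"
  | (2) s n m where "x = frag_of (s, n \<oplus>\<^bsub>N\<^esub> m) - frag_of (s, n) - frag_of (s, m)"
        "s \<in> carrier R" "n \<in> carrier N" "m \<in> carrier N"
  | (3) s b n where "x = frag_of (s \<otimes> \<iota> b, n) - frag_of (s, b \<odot>\<^bsub>N\<^esub> n)"
        "s \<in> carrier R" "b \<in> carrier B" "n \<in> carrier N"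
    unfolding gens_def by blast
  then show ?thesis
  proof cases
    case 1
    then have "lmul r x = frag_of ((r \<otimes> s) \<oplus> (r \<otimes> t), n) - frag_of (r \<otimes> s, n) - frag_of (r \<otimes> t, n)"
      using r by (simp add: r_distr)
    then show ?thesis
      unfolding gens_def using 1 r by blast
  next
    case 2
    then have "lmul r x = frag_of (r \<otimes> s, n \<oplus>\<^bsub>N\<^esub> m) - frag_of (r \<otimes> s, n) - frag_of (r \<otimes> s, m)"
      by simp
    then show ?thesis
      unfolding gens_def using 2 r by blast
  next
    case 3
    then have "lmul r x = frag_of ((r \<otimes> s) \<otimes> \<iota> b, n) - frag_of (r \<otimes> s, b \<odot>\<^bsub>N\<^esub> n)"
      using r by (simp add: m_assoc \<iota>_closed)
    then show ?thesis
      unfolding gens_def using 3 r by blast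
  qed
qed

lemma lmul_K:
  assumes r: "r \<in> carrier R" and x: "x \<in> K"
  shows "lmul r x \<in> K"
proof -
  have gens: "lmul r h \<in> K" if "h \<in> gens" for h
    using lmul_gens[OF r that] by (simp add: K_eq generate.incl)
  from x have "x \<in> generate F gens"
    by (simp add: K_eq)
  then show ?thesis
  proof (induction rule: generate.induct)
    case (inv h)
    then have "inv\<^bsub>F\<^esub> h = - h"
      using gens_subset by (auto simp: F_inv)
    then show ?case
      using K_uminus[OF gens[OF inv]] by simp
  qed (auto intro: K_add K_zero gens)
qed

lemma T_smult:
  assumes "r \<in> carrier R"
  shows "r \<odot>\<^bsub>T\<^esub> coset x = coset (lmul r x)"
proof -
  have "coset (lmul r y) = coset (lmul r x)" if "y \<in> coset x" for y
    using that lmul_K[OF assms, of "y - x"] by (simp add: coset_eq_iff mem_coset)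
  moreover have "x \<in> coset x"
    by (simp add: mem_coset K_zero)
  ultimately have "(\<Union>y\<in>coset x. coset (lmul r y)) = coset (lmul r x)"
    by blast
  then show ?thesis
    by (simp add: tensor_module_def lmul_def)
qed

lemma pure_coset: "pure r n = coset (frag_of (r, n))"
  by (simp add: pure_tensor_def)

lemma pure_closed: "r \<in> carrier R \<Longrightarrow> n \<in> carrier N \<Longrightarrow> pure r n \<in> carrier T"
  by (simp add: pure_coset T_carrier)

lemma pure_smult: "r \<in> carrier R \<Longrightarrow> r \<odot>\<^bsub>T\<^esub> pure s n = pure (r \<otimes> s) n"
  by (simp add: pure_coset T_smult)

lemma gens_K: "x \<in> gens \<Longrightarrow> x \<in> K"
  by (simp add: K_eq generate.incl)

lemma pure_add_left:
  assumes "r \<in> carrier R" "s \<in> carrier R" "n \<in> carrier N"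
  shows "pure (r \<oplus> s) n = pure r n \<oplus>\<^bsub>T\<^esub> pure s n"
proof -
  have "frag_of (r \<oplus> s, n) - frag_of (r, n) - frag_of (s, n) \<in> K"
    by (rule gens_K) (use assms in \<open>unfold gens_def, blast\<close>)
  then show ?thesis
    using assms by (simp add: pure_coset T_add coset_eq_iff diff_diff_eq)
qed

lemma pure_balanced:
  assumes "r \<in> carrier R" "b \<in> carrier B" "n \<in> carrier N"
  shows "pure (r \<otimes> \<iota> b) n = pure r (b \<odot>\<^bsub>N\<^esub> n)"
proof -
  have "frag_of (r \<otimes> \<iota> b, n) - frag_of (r, b \<odot>\<^bsub>N\<^esub> n) \<in> K"
    by (rule gens_K) (use assms in \<open>unfold gens_def, blast\<close>)
  then show ?thesis
    by (simp add: pure_coset coset_eq_iff)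
qed

lemma pure_zero: 
  assumes "n \<in> carrier N"
  shows "pure \<zero> n = \<zero>\<^bsub>T\<^esub>"
proof -
  have "frag_of (\<zero> \<oplus> \<zero>, n) - frag_of (\<zero>, n) - frag_of (\<zero>, n) \<in> K"
    by (rule gens_K) (use assms in \<open>unfold gens_def, blast\<close>)
  then show ?thesis
    using assms K_uminus[of "- frag_of (\<zero>, n)"] by (simp add: pure_coset T_zero coset_eq_iff)
qed

text \<open>The universal property, for maps into the additive group of a type.\<close>

lemma pure_eqD:
  fixes f :: "'r \<Rightarrow> 'n \<Rightarrow> 'v::ab_group_add"
  assumes "\<And>r s n. r \<in> carrier R \<Longrightarrow> s \<in> carrier R \<Longrightarrow> n \<in> carrier N \<Longrightarrow> f (r \<oplus> s) n = f r n + f s n"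
    and "\<And>r n n'. r \<in> carrier R \<Longrightarrow> n \<in> carrier N \<Longrightarrow> n' \<in> carrier N \<Longrightarrow> f r (n \<oplus>\<^bsub>N\<^esub> n') = f r n + f r n'"
    and "\<And>r b n. r \<in> carrier R \<Longrightarrow> b \<in> carrier B \<Longrightarrow> n \<in> carrier N \<Longrightarrow> f (r \<otimes> \<iota> b) n = f r (b \<odot>\<^bsub>N\<^esub> n)"
    and "pure r n = pure s m" "r \<in> carrier R" "s \<in> carrier R" "n \<in> carrier N" "m \<in> carrier N"
  shows "f r n = f s m"
proof -
  let ?G = "\<lparr>carrier = UNIV, monoid.mult = (+), one = (0 :: 'v)\<rparr>"
  obtain h where h: "h \<in> hom F ?G"
    and h_frag: "\<And>x. x \<in> carrier R \<times> carrier N \<Longrightarrow> h (frag_of x) = f (fst x) (snd x)"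
  proof (rule comm_group.free_Abelian_group_universal[OF comm_group_type,
        of "\<lambda>x. f (fst x) (snd x)" "carrier R \<times> carrier N"])
    show "(\<lambda>x. f (fst x) (snd x)) ` (carrier R \<times> carrier N) \<subseteq> carrier ?G"
      by simp
  next
    fix h assume "h \<in> hom (free_Abelian_group (carrier R \<times> carrier N)) ?G"
      "\<And>x. x \<in> carrier R \<times> carrier N \<Longrightarrow> h (frag_of x) = f (fst x) (snd x)"
    then show thesis
      by (intro that) (simp_all add: tensor_free_def)
  qed
  have h_add: "h (x + y) = h x + h y" if "x \<in> carrier F" "y \<in> carrier F" for x y
    using hom_mult[OF h that] by simp
  have h_diff: "h (x - y) = h x - h y" if "x \<in> carrier F" "y \<in> carrier F" for x y
    using h_add[OF F_diff[OF that] that(2)] by (simp add: algebra_simps)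
  have "h x = 0" if "x \<in> K" for x
  proof -
    have "K \<subseteq> {x \<in> carrier F. h x = 0}"
      unfolding K_eq
    proof (rule group.generate_subgroup_incl[OF comm_group.axioms(2)[OF comm_group_F]])
      show "gens \<subseteq> {x \<in> carrier F. h x = 0}"
        using gens_subset unfolding gens_def
        by (auto simp: h_diff h_frag F_diff assms(1-3) N_add_closed N_smult_closed \<iota>_closed)
      have h0: "h 0 = 0"
        using h_diff[of 0 0] F_carrier[of 0] by simp
      have z: "0 \<in> carrier F"
        by (simp add: F_carrier)
      show "subgroup {x \<in> carrier F. h x = 0} F"
      proof (rule group.subgroupI[OF comm_group.axioms(2)[OF comm_group_F]])
        show "{x \<in> carrier F. h x = 0} \<noteq> {}"
          using z h0 by blast
        show "inv\<^bsub>F\<^esub> x \<in> {x \<in> carrier F. h x = 0}" if "x \<in> {x \<in> carrier F. h x = 0}" for x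
          using that h_diff[OF z, of x] F_diff[OF z, of x] h0 by (simp add: F_inv)
      qed (auto simp: h_add F_add)
    qed
    then show ?thesis using that by auto
  qed
  moreover have "frag_of (r, n) - frag_of (s, m) \<in> K"
    using assms(4) by (simp add: pure_coset coset_eq_iff)
  ultimately show ?thesis
    using assms(5-8) h_diff[of "frag_of (r, n)" "frag_of (s, m)"] by (simp add: h_frag)
qed

end

subsection \<open>The symmetric group on three letters\<close>

text \<open>The two 3-cycles; \<open>rot\<close> is the weight of \<open>Mh\<close>.\<close>

definition rot :: S3 where "rot = perm_of T13 * perm_of T23"
definition rot' :: S3 where "rot' = perm_of T23 * perm_of T13"

lemma UNIV_3: "(UNIV :: 3 set) = {1, 2, 3}"
proof -
  have "card {1, 2, 3 :: 3} = 3"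
    by simp
  then show ?thesis
    by (intro card_subset_eq[symmetric]) auto
qed

lemma forall_3: "(\<forall>x::3. P x) \<longleftrightarrow> P 1 \<and> P 2 \<and> P 3"
proof -
  have "(\<forall>x::3. P x) \<longleftrightarrow> (\<forall>x\<in>{1, 2, 3}. P x)"
    unfolding UNIV_3[symmetric] by simp
  then show ?thesis by simp
qed

lemmas S3_simps = perm_eq_iff fun_eq_iff forall_3 apply_times swap.rep_eq transpose_def rot_def rot'_def

lemma S3_apply:
  "Perm.apply (perm_of T12) 1 = 2" "Perm.apply (perm_of T12) 2 = 1" "Perm.apply (perm_of T12) 3 = 3"
  "Perm.apply (perm_of T13) 1 = 3" "Perm.apply (perm_of T13) 2 = 2" "Perm.apply (perm_of T13) 3 = 1"
  "Perm.apply (perm_of T23) 1 = 1" "Perm.apply (perm_of T23) 2 = 3" "Perm.apply (perm_of T23) 3 = 2"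
  "Perm.apply rot 1 = 3" "Perm.apply rot 2 = 1" "Perm.apply rot 3 = 2"
  "Perm.apply rot' 1 = 2" "Perm.apply rot' 2 = 3" "Perm.apply rot' 3 = 1"
  by (simp_all add: S3_simps)

declare perm_of.simps [simp del]

lemma perm_of_mult:
  "perm_of t * perm_of t = 1"
  "perm_of T12 * perm_of T13 = rot" "perm_of T12 * perm_of T23 = rot'"
  "perm_of T13 * perm_of T12 = rot'" "perm_of T13 * perm_of T23 = rot"
  "perm_of T23 * perm_of T12 = rot" "perm_of T23 * perm_of T13 = rot'"
  "perm_of T12 * rot = perm_of T13" "perm_of T12 * rot' = perm_of T23"
  "perm_of T13 * rot = perm_of T23" "perm_of T13 * rot' = perm_of T12"
  "perm_of T23 * rot = perm_of T12" "perm_of T23 * rot' = perm_of T13"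
  "rot * perm_of T12 = perm_of T23" "rot' * perm_of T12 = perm_of T13"
  "rot * perm_of T13 = perm_of T12" "rot' * perm_of T13 = perm_of T23"
  "rot * perm_of T23 = perm_of T13" "rot' * perm_of T23 = perm_of T12"
  by (cases t; simp add: perm_eq_iff forall_3 apply_times S3_apply)+

lemma S3_distinct:
  "distinct [1, perm_of T12, perm_of T13, perm_of T23, rot, rot']"
  by (simp add: perm_eq_iff forall_3 S3_apply)

lemma UNIV_S3: "(UNIV :: S3 set) = {1, perm_of T12, perm_of T13, perm_of T23, rot, rot'}"
proof (intro equalityI subsetI)
  fix g :: S3
  have "Perm.apply g i \<in> {1, 2, 3}" for i
    using UNIV_3 by auto
  then have "Perm.apply g 1 \<in> {1, 2, 3}" "Perm.apply g 2 \<in> {1, 2, 3}" "Perm.apply g 3 \<in> {1, 2, 3}"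
    by blast+
  moreover have "Perm.apply g 1 \<noteq> Perm.apply g 2" "Perm.apply g 1 \<noteq> Perm.apply g 3"
    "Perm.apply g 2 \<noteq> Perm.apply g 3"
    by (simp_all add: apply_inj)
  ultimately show "g \<in> {1, perm_of T12, perm_of T13, perm_of T23, rot, rot'}"
    by (elim insertE emptyE; simp add: perm_eq_iff forall_3 S3_apply)
qed auto

lemma S3_cases [case_names e s12 s13 s23 rot rot']:
  obtains "g = 1" | "g = perm_of T12" | "g = perm_of T13" | "g = perm_of T23" | "g = rot" | "g = rot'"
  using UNIV_S3 by auto

lemma forall_S3: "(\<forall>g::S3. P g) \<longleftrightarrow> P 1 \<and> P (perm_of T12) \<and> P (perm_of T13) \<and> P (perm_of T23) \<and> P rot \<and> P rot'"
proof -
  have "(\<forall>g. P g) \<longleftrightarrow> (\<forall>g\<in>{1, perm_of T12, perm_of T13, perm_of T23, rot, rot'}. P g)"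
    unfolding UNIV_S3[symmetric] by simp
  then show ?thesis by simp
qed

lemma sign_S3:
  "sign (Perm.apply (perm_of t)) = - 1" "sign (Perm.apply rot) = 1" "sign (Perm.apply rot') = 1"
proof -
  have swap: "sign (Perm.apply (Perm.swap i j)) = (if i = j then 1 else - 1)" for i j :: 3
    by (simp add: swap.rep_eq sign_swap_id)
  have t: "sign (Perm.apply (perm_of t)) = - 1" for t
    by (cases t) (simp_all add: swap perm_of.simps)
  show "sign (Perm.apply (perm_of t)) = - 1" by (rule t)
  have comp: "sign (Perm.apply (f * g)) = sign (Perm.apply f) * sign (Perm.apply g)" for f g :: S3
    by (simp add: apply_times sign_compose permutation)
  show "sign (Perm.apply rot) = 1" "sign (Perm.apply rot') = 1"
    by (simp_all add: rot_def rot'_def comp t)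
qed

lemma inj_perm_of: "perm_of s = perm_of t \<Longrightarrow> s = t"
  by (cases s; cases t; simp add: perm_eq_iff forall_3 S3_apply)

text \<open>Stating the conjugation without an inverse lets the multiplication table alone evaluate
  \<open>conj_transp\<close>.\<close>

lemma conj_transp_eqI:
  assumes "g * perm_of s = perm_of t * g"
  shows "conj_transp g t = s"
proof -
  have "inverse g * perm_of t * g = inverse g * (g * perm_of s)"
    by (simp add: assms mult.assoc)
  then have "perm_of s = inverse g * perm_of t * g"
    by (simp flip: mult.assoc)
  then show ?thesis
    unfolding conj_transp_def by (intro the_equality inj_perm_of) simp_all
qed

lemma conj_transp_simps:
  "conj_transp 1 t = t" "conj_transp (perm_of t) t = t"
  "conj_transp (perm_of T12) T13 = T23" "conj_transp (perm_of T12) T23 = T13"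
  "conj_transp (perm_of T13) T12 = T23" "conj_transp (perm_of T13) T23 = T12"
  "conj_transp (perm_of T23) T12 = T13" "conj_transp (perm_of T23) T13 = T12"
  "conj_transp rot T12 = T23" "conj_transp rot T13 = T12" "conj_transp rot T23 = T13"
  "conj_transp rot' T12 = T13" "conj_transp rot' T13 = T23" "conj_transp rot' T23 = T12"
  by (rule conj_transp_eqI; simp add: perm_of_mult)+

lemma S3_neq [simp]:
  "perm_of s = perm_of t \<longleftrightarrow> s = t" 
  "1 \<noteq> perm_of t" "perm_of t \<noteq> 1" "rot \<noteq> perm_of t" "perm_of t \<noteq> rot" "rot' \<noteq> perm_of t" "perm_of t \<noteq> rot'"
  "rot \<noteq> 1" "1 \<noteq> rot" "rot' \<noteq> 1" "1 \<noteq> rot'" "rot \<noteq> rot'" "rot' \<noteq> rot"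
  using S3_distinct by (cases t; auto dest: inj_perm_of)+

lemma sum_S3: "(\<Sum>g\<in>(UNIV :: S3 set). f g)
  = f 1 + f (perm_of T12) + f (perm_of T13) + f (perm_of T23) + f rot + f rot'"
  unfolding UNIV_S3 by (simp add: add.assoc)

declare perm_of_mult [simp]

subsection \<open>An explicit model of the Verma module\<close>

type_synonym 'k model = "S3 \<Rightarrow> 'k \<times> 'k"

definition pscale :: "'k::field \<Rightarrow> 'k \<times> 'k \<Rightarrow> 'k \<times> 'k" where
  "pscale c z = (c * fst z, c * snd z)"

definition mscale :: "'k::field \<Rightarrow> 'k model \<Rightarrow> 'k model" where
  "mscale c u = (\<lambda>g. pscale c (u g))"

text \<open>\<open>step b t h\<close> is the action of \<open>x\<^sub>t\<close> into the weight space of \<open>h\<close>, in the bases that \<open>lift_weight\<close>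
  below spells out; the second basis vectors at \<open>(13)(23)\<close>, \<open>e\<close> and \<open>(12)\<close> are \<open>m_o\<close>, \<open>m_3\<close> and \<open>m_top\<close>.\<close>

primrec step :: "'k::field \<Rightarrow> transp \<Rightarrow> S3 \<Rightarrow> 'k \<times> 'k \<Rightarrow> 'k \<times> 'k" where
  "step b T12 h z =
    (if h = 1 then (fst z, 0) else if h = perm_of T12 then (0, - snd z)
     else if h = perm_of T13 \<or> h = perm_of T23 then pscale (- b) z else z)"
| "step b T13 h z =
    (if h = 1 then (0, - (fst z / b)) else if h = perm_of T12 then (0, - (fst z / b) - snd z)
     else if h = perm_of T13 then (0, fst z) else if h = perm_of T23 then pscale b z
     else if h = rot then z else (fst z, - (fst z / b)))"
| "step b T23 h z =
    (if h = 1 then (0, - (fst z / b)) else if h = perm_of T12 then (0, snd z)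
     else if h = perm_of T13 then pscale b z else if h = perm_of T23 then (0, - fst z)
     else if h = rot then (fst z, 0) else z)"

text \<open>The formula is indexed by the target weight \<open>h\<close>. Since
  \<open>delta h * xgen t\<close> equals \<open>xgen t * delta (perm_of t * h)\<close> in the
  algebra, what arrives at \<open>h\<close> comes from \<open>perm_of t * h\<close>.\<close>

primrec model_op :: "'k::field \<Rightarrow> gen \<Rightarrow> 'k model \<Rightarrow> 'k model" where
  "model_op b (Delta g) u = (\<lambda>h. if h = g then u h else 0)"
| "model_op b (Refl t) u = (\<lambda>h. step b t h (u (perm_of t * h)))"

lemma step_add: "step b t h (z + z') = step b t h z + step b t h z'"
  by (cases t) (auto simp: prod_eq_iff pscale_def algebra_simps add_divide_distrib)

lemma step_scale: "step b t h (pscale c z) = pscale c (step b t h z)"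
  by (cases t) (auto simp: prod_eq_iff pscale_def algebra_simps)

lemma step_zero [simp]: "step b t h 0 = 0"
  by (cases t) (auto simp: prod_eq_iff pscale_def)

lemma model_rep: "free_alg_rep mscale (model_op b)"
proof unfold_locales
  show "model_op b x (u + v) = model_op b x u + model_op b x v" for x u v
    by (cases x) (auto simp: fun_eq_iff step_add)
  show "model_op b x (mscale c u) = mscale c (model_op b x u)" for x c u
    by (cases x) (auto simp: fun_eq_iff mscale_def step_scale, auto simp: pscale_def zero_prod_def)
qed (auto simp: mscale_def pscale_def fun_eq_iff prod_eq_iff algebra_simps)

lemma (in free_alg_rep) act_fun_elt: "act (fun_elt f) v = (\<Sum>g\<in>UNIV. scale (f g) (\<rho> (Delta g) v))"
  by (simp add: fun_elt_def act_sum act_single)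

definition emb :: "S3 \<Rightarrow> 'k \<times> 'k \<Rightarrow> 'k::field model" where
  "emb g z = (\<lambda>h. if h = g then z else 0)"

lemma sum_apply: "(\<Sum>i\<in>I. F i) h = (\<Sum>i\<in>I. F i h)" for F :: "'a \<Rightarrow> 'b \<Rightarrow> 'c::comm_monoid_add"
  by (induction I rule: infinite_finite_induct) auto

lemma model_fun_elt: "rep_act mscale (model_op b) (fun_elt f) u = (\<lambda>h. pscale (f h) (u h))"
proof -
  interpret free_alg_rep mscale "model_op b" by (rule model_rep)
  show ?thesis
    unfolding act_fun_elt
  proof
    fix h
    have "(\<Sum>g\<in>UNIV. mscale (f g) (model_op b (Delta g) u) h) = (\<Sum>g\<in>UNIV. if g = h then pscale (f g) (u g) else 0)"
      by (rule sum.cong) (auto simp: mscale_def pscale_def zero_prod_def)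
    then show "(\<Sum>g\<in>UNIV. mscale (f g) (model_op b (Delta g) u)) h = pscale (f h) (u h)"
      by (simp add: sum_apply)
  qed
qed

section \<open>The relations of the algebra hold in the model\<close>

locale degenerate =
  fixes a :: "transp \<Rightarrow> 'k::field"
  assumes a_neq: "a T12 \<noteq> a T13" and a_eq: "a T13 = a T23"
begin

text \<open>The one parameter that is left: once \<open>a T13 = a T23\<close>, every value of
  \<open>f_fun a t\<close> is \<open>0\<close>, \<open>b\<close> or \<open>- b\<close>.\<close>

definition b :: 'k where "b = a T13 - a T12"

lemma b_nonzero: "b \<noteq> 0"
  using a_neq by (simp add: b_def)

text \<open>The nonzero values sit on four pairs of weights: (12) joins (13) to \<open>rot\<close>
  and (23) to \<open>rot'\<close>, (13) joins (23) to \<open>rot\<close>, and (23) joins (13) to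
  \<open>rot'\<close>. Together they form the four-cycle on \<open>L_index\<close>.\<close>

lemma f_simps:
  "f_fun a t 1 = 0" "f_fun a t (perm_of t) = 0" "f_fun a t (perm_of T12) = 0"
  "f_fun a T12 (perm_of T13) = - b" "f_fun a T12 (perm_of T23) = - b"
  "f_fun a T12 rot = - b" "f_fun a T12 rot' = - b"
  "f_fun a T13 (perm_of T23) = b" "f_fun a T13 rot = b" "f_fun a T13 rot' = 0"
  "f_fun a T23 (perm_of T13) = b" "f_fun a T23 rot = 0" "f_fun a T23 rot' = b"
  using a_eq by (cases t; simp add: f_fun_def conj_transp_simps b_def)+

sublocale V: free_alg_rep mscale "model_op b"
  by (rule model_rep)

text \<open>The relations among the \<open>delta g\<close> and their commutation with
  \<open>xgen t\<close> hold by the shape of \<open>model_op\<close>. The squares and the two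
  cubic-free sums of products become, weight by weight, identities between maps of the plane, which
  \<open>xx\<close> and \<open>braid_relations\<close> verify.\<close>

lemma model_relations:
  assumes "r \<in> relations a"
  shows "V.act r u = 0"
proof -
  have xx: "step b t h (step b t (perm_of t * h) z) = pscale (f_fun a t h) z" for t h z
    by (cases h rule: S3_cases; cases t)
      (simp_all add: f_simps b_nonzero pscale_def prod_eq_iff)
  have tt: "perm_of t * (perm_of t * h) = h" for t h
    by (simp flip: mult.assoc)
  have braid_relations: "step b T13 h (step b T23 (perm_of T13 * h) (u (perm_of T23 * (perm_of T13 * h))))
       + step b T23 h (step b T12 (perm_of T23 * h) (u (perm_of T12 * (perm_of T23 * h))))
       + step b T12 h (step b T13 (perm_of T12 * h) (u (perm_of T13 * (perm_of T12 * h)))) = 0"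
     "step b T23 h (step b T13 (perm_of T23 * h) (u (perm_of T13 * (perm_of T23 * h))))
       + step b T13 h (step b T12 (perm_of T13 * h) (u (perm_of T12 * (perm_of T13 * h))))
       + step b T12 h (step b T23 (perm_of T12 * h) (u (perm_of T23 * (perm_of T12 * h)))) = 0" for h
    by (cases h rule: S3_cases; simp add: b_nonzero pscale_def prod_eq_iff)+
  have one: "V.act (\<Sum>g\<in>UNIV. delta g) u = u"
    using model_fun_elt[of b "\<lambda>_. 1" u] by (simp add: fun_elt_def pscale_def)
  from assms consider
    (1) g h where "r = delta g * delta h - (if g = h then delta g else 0)"
  | (2) "r = (\<Sum>g\<in>UNIV. delta g) - 1"
  | (3) h t where "r = delta h * xgen t - xgen t * delta (perm_of t * h)"
  | (4) t where "r = xgen t * xgen t - fun_elt (f_fun a t)"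
  | (5) "r = xgen T13 * xgen T23 + xgen T23 * xgen T12 + xgen T12 * xgen T13"
  | (6) "r = xgen T23 * xgen T13 + xgen T13 * xgen T12 + xgen T12 * xgen T23"
    unfolding relations_def by blast
  then show ?thesis
  proof cases
    case 1
    then show ?thesis
      by (auto simp: V.act_minus V.act_mult V.act_gen fun_eq_iff)
  next
    case 2
    then show ?thesis
      by (simp add: V.act_minus one)
  next
    case 3
    have "perm_of t * h' = perm_of t * h \<longleftrightarrow> h' = h" for h'
      using tt by metis
    then show ?thesis
      by (simp add: 3 V.act_minus V.act_mult V.act_gen fun_eq_iff)
  next
    case 4
    then show ?thesis
      by (simp add: V.act_minus V.act_mult V.act_gen model_fun_elt fun_eq_iff xx tt)
  next
    case 5
    then show ?thesis
      using braid_relations(1) by (simp add: V.act_plus V.act_mult V.act_gen fun_eq_iff)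
  next
    case 6
    then show ?thesis
      using braid_relations(2) by (simp add: V.act_plus V.act_mult V.act_gen fun_eq_iff)
  qed
qed

lemma model_rel_ideal: "p \<in> rel_ideal a \<Longrightarrow> V.act p u = 0"
  by (rule V.act_rel_ideal[of UNIV a]) (auto simp: V.invariant_def model_relations V.subspace_UNIV)

lemma model_cls_eq: "cls a p = cls a q \<Longrightarrow> V.act p u = V.act q u"
  using model_rel_ideal[of "p - q" u] cls_self[of p a] by (simp add: mem_cls V.act_minus)

end

definition sc :: "'k::field \<Rightarrow> 'k free_alg" where "sc c = Poly_Mapping.single 0 c"

lemma sc_simps: "sc (c + d) = sc c + sc d" "sc (c - d) = sc c - sc d" "sc (- c) = - sc c"
  "sc (c * d) = sc c * sc d" "sc 0 = 0" "sc 1 = 1"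
  by (simp_all add: sc_def single_add single_diff single_uminus mult_single)

lemma sc_single: "sc c * Poly_Mapping.single w d = Poly_Mapping.single w (c * d)"
  "Poly_Mapping.single w d * sc c = Poly_Mapping.single w (c * d)"
  by (simp_all add: sc_def mult_single gen_list_zero gen_list_add mult.commute)

lemma sc_commute: "p * sc c = sc c * p"
  by (induction p rule: poly_mapping_induct_single) (simp_all add: sc_single algebra_simps)

lemma sc_left_commute: "p * (sc c * q) = sc c * (p * q)"
  by (metis sc_commute mult.assoc)

lemma fun_elt_const: "fun_elt (\<lambda>_. c) = (\<Sum>g\<in>UNIV. delta g) * sc c"
  by (simp add: fun_elt_def sum_distrib_right sc_single)

lemma fun_elt_ring:
  "fun_elt f = (\<Sum>g\<in>UNIV. sc (f g) * delta g)"
  by (simp add: fun_elt_def sc_single)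

subsection \<open>Verma modules as quotients of the free algebra\<close>

text \<open>The map sending \<open>p\<close> to \<open>p\<close> tensor \<open>1\<close>. It
  presents the Verma module as a quotient of the free algebra by a left ideal, so that computations
  need no tensors.\<close>

definition vmap :: "(transp \<Rightarrow> 'k::field) \<Rightarrow> S3 \<Rightarrow> 'k free_alg \<Rightarrow> 'k verma_elt" where
  "vmap a g p = pure_tensor (alg a) fun_ring (\<lambda>f. cls a (fun_elt f)) (fun_module g) (cls a p) 1"

lemma verma_tensor: "balanced_tensor (alg a) fun_ring (\<lambda>f. cls a (fun_elt f)) (fun_module g)"
  by (intro balanced_tensor.intro ring_alg balanced_tensor_axioms.intro)
    (auto simp: carrier_alg fun_module_def)

lemma fun_module_sel [simp]: "carrier (fun_module g) = UNIV" "f \<odot>\<^bsub>fun_module g\<^esub> c = f g * c"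
  "add (fun_module g) = (+)"
  by (simp_all add: fun_module_def)

lemma cls_closed [simp]: "cls a p \<in> carrier (alg a)"
  by (simp add: carrier_alg)

lemma vmap_add: "vmap a g (p + q) = vmap a g p \<oplus>\<^bsub>verma a g\<^esub> vmap a g q"
proof -
  interpret balanced_tensor "alg a" fun_ring "\<lambda>f. cls a (fun_elt f)" "fun_module g"
    by (rule verma_tensor)
  show ?thesis
    unfolding vmap_def verma_def by (simp flip: pure_add_left add: cls_add)
qed

lemma vmap_smult: "cls a q \<odot>\<^bsub>verma a g\<^esub> vmap a g p = vmap a g (q * p)"
proof -
  interpret balanced_tensor "alg a" fun_ring "\<lambda>f. cls a (fun_elt f)" "fun_module g"
    by (rule verma_tensor)
  show ?thesis
    unfolding vmap_def verma_def by (simp add: pure_smult cls_mult)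
qed

lemma vmap_cls_eq: "cls a p = cls a q \<Longrightarrow> vmap a g p = vmap a g q"
  by (simp add: vmap_def)

lemma cls_relation:
  assumes "r \<in> relations a"
  shows "cls a (p * r * q) = cls a 0"
proof -
  interpret ideal "rel_ideal a" ring_of_type_algebra by (rule ideal_rel_ideal)
  have "p * r * q \<in> rel_ideal a"
    using assms relations_subset_rel_ideal[of a] I_l_closed[of r p] I_r_closed[of "p * r" q] by auto
  then show ?thesis
    by (intro cls_eqI) simp
qed

text \<open>The scalar \<open>c\<close> is the constant function \<open>c\<close> applied to
  \<open>1\<close>; it moves across the tensor sign as a function element, and the sum of all
  \<open>delta g\<close> is \<open>1\<close> by a relation.\<close>

lemma pure_eq_vmap:
  "pure_tensor (alg a) fun_ring (\<lambda>f. cls a (fun_elt f)) (fun_module g) (cls a p) c = vmap a g (p * sc c)"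
proof -
  interpret balanced_tensor "alg a" fun_ring "\<lambda>f. cls a (fun_elt f)" "fun_module g"
    by (rule verma_tensor)
  have "pure (cls a p) c = pure (cls a p \<otimes>\<^bsub>alg a\<^esub> cls a (fun_elt (\<lambda>_. c))) 1"
    by (subst pure_balanced) auto
  also have "\<dots> = vmap a g (p * fun_elt (\<lambda>_. c))"
    by (simp add: vmap_def cls_mult)
  also have "\<dots> = vmap a g (p * sc c)"
  proof (rule vmap_cls_eq)
    have "(\<Sum>g\<in>UNIV. delta g) - 1 \<in> relations a"
      by (simp add: relations_def)
    from cls_relation[OF this, of p "sc c"]
    have "p * ((\<Sum>g\<in>UNIV. delta g) - 1) * sc c \<in> rel_ideal a"
      using mem_cls[of "p * ((\<Sum>g\<in>UNIV. delta g) - 1) * sc c" a 0] cls_self by auto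
    then show "cls a (p * fun_elt (\<lambda>_. c)) = cls a (p * sc c)"
      by (intro cls_eqI) (simp add: fun_elt_const algebra_simps)
  qed
  finally show ?thesis .
qed

lemma vmap_fun_elt: "vmap a g (p * fun_elt f) = vmap a g (p * sc (f g))"
proof -
  interpret balanced_tensor "alg a" fun_ring "\<lambda>f. cls a (fun_elt f)" "fun_module g"
    by (rule verma_tensor)
  have "vmap a g (p * fun_elt f) = pure (cls a p \<otimes>\<^bsub>alg a\<^esub> cls a (fun_elt f)) 1"
    by (simp add: vmap_def cls_mult)
  also have "\<dots> = pure (cls a p) (f g)"
    by (subst pure_balanced) auto
  finally show ?thesis
    by (simp add: pure_eq_vmap)
qed

lemma vmap_zero: "vmap a g 0 = \<zero>\<^bsub>verma a g\<^esub>"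
proof -
  interpret balanced_tensor "alg a" fun_ring "\<lambda>f. cls a (fun_elt f)" "fun_module g"
    by (rule verma_tensor)
  have "cls a 0 = \<zero>\<^bsub>alg a\<^esub>"
    using ring.ring_simprules(2)[OF ring_alg] cls_add[of a 0 0]
    by (metis cls_closed add.right_neutral l_zero r_zero add.l_cancel_one zero_closed)
  then show ?thesis
    unfolding vmap_def verma_def using pure_zero[of 1] by simp
qed

text \<open>Every pure tensor has the form \<open>p\<close> tensor \<open>1\<close>, and integer
  combinations of such tensors collapse into a single one by additivity in the first factor.\<close>

lemma carrier_verma: "carrier (verma a g) = range (vmap a g)"
proof -
  interpret balanced_tensor "alg a" fun_ring "\<lambda>f. cls a (fun_elt f)" "fun_module g"
    by (rule verma_tensor)
  define fr where "fr p = frag_of (cls a p, 1 :: 'a)" for p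
  have vmap: "vmap a g p = coset (fr p)" for p
    by (simp add: vmap_def pure_coset fr_def)
  \<comment> \<open>Additivity in the first factor, written as an element of \<open>K\<close>:
    modulo \<open>K\<close> the symbol of \<open>p - q\<close> is the difference of the symbols of
    \<open>p\<close> and \<open>q\<close>.\<close>
  have fr: "fr p - (fr (p - q) + fr q) \<in> K" for p q
    using vmap_add[of a g "p - q" q] by (simp add: verma_def vmap T_add coset_eq_iff fr_def)
  have "coset x \<in> range (vmap a g)" if x: "x \<in> carrier F" for x
  proof -
    have "Poly_Mapping.keys x \<subseteq> carrier (alg a) \<times> (UNIV :: 'a set)"
      using x by (simp add: F_carrier)
    then show ?thesis
    proof (rule free_Abelian_group_induct[where P = "\<lambda>x. coset x \<in> range (vmap a g)"])
      show "coset 0 \<in> range (vmap a g)"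
        using vmap_zero[of a g] unfolding verma_def T_zero by (metis rangeI)
    next
      fix x y assume "coset x \<in> range (vmap a g)" "coset y \<in> range (vmap a g)"
      then obtain p q where pq: "coset x = vmap a g p" "coset y = vmap a g q"
        by auto
      have "(x - fr p) + - (y - fr q) + (fr p - (fr (p - q) + fr q)) \<in> K"
        using pq by (intro K_add K_uminus fr) (simp_all add: vmap coset_eq_iff)
      then have "coset (x - y) = vmap a g (p - q)"
        by (simp add: vmap coset_eq_iff algebra_simps)
      then show "coset (x - y) \<in> range (vmap a g)" by blast
    next
      fix z assume "z \<in> carrier (alg a) \<times> (UNIV :: 'a set)"
      then obtain p c where "z = (cls a p, c)"
        by (auto simp: carrier_alg)
      then show "coset (frag_of z) \<in> range (vmap a g)"
        by (simp flip: pure_coset add: pure_eq_vmap)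
    qed
  qed
  moreover have "vmap a g p \<in> carrier (verma a g)" for p
    unfolding vmap_def verma_def by (intro pure_closed) auto
  ultimately show ?thesis
    unfolding verma_def T_carrier by (auto simp: T_carrier)
qed

text \<open>Frobenius reciprocity in the form needed here: a vector \<open>e\<close> of weight
  \<open>g\<close> in a representation satisfying the relations receives the Verma module by
  \<open>p\<close> tensor \<open>1\<close> going to \<open>act p e\<close>. This is the means of
  proving that elements of the Verma module differ.\<close>

lemma (in free_alg_rep) vmap_eqD:
  assumes rel: "\<And>p q v. cls a p = cls a q \<Longrightarrow> act p v = act q v"
    and e: "\<And>f. act (fun_elt f) e = scale (f g) e"
    and eq: "vmap a g p = vmap a g q"
  shows "act p e = act q e"
proof -
  interpret T: balanced_tensor "alg a" fun_ring "\<lambda>f. cls a (fun_elt f)" "fun_module g"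
    by (rule verma_tensor)
  \<comment> \<open>An arbitrary representative of the class is chosen; \<open>rel\<close> makes the
    value independent of the choice.\<close>
  define A where "A C = act (SOME p. C = cls a p) e" for C
  have A: "A (cls a p) = act p e" for p
    unfolding A_def by (rule rel, rule sym, rule someI_ex) blast
  have "scale 1 (A (cls a p)) = scale 1 (A (cls a q))"
    by (rule T.pure_eqD[of "\<lambda>C c. scale c (A C)"])
      (use eq in \<open>auto simp: carrier_alg cls_add cls_mult A act_plus act_mult e act_scale
        scale_right_distrib scale_left_distrib mult.commute vmap_def\<close>)
  then show ?thesis
    by (simp add: A)
qed

lemma vmap_cong_add:
  "vmap a g p = vmap a g p' \<Longrightarrow> vmap a g q = vmap a g q' \<Longrightarrow> vmap a g (p + q) = vmap a g (p' + q')"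
  by (simp add: vmap_add)

lemma vmap_cong_mult: "vmap a g q = vmap a g q' \<Longrightarrow> vmap a g (p * q) = vmap a g (p * q')"
  by (metis vmap_smult)

section \<open>The left ideal of the cyclic generator and weights modulo it\<close>

text \<open>The annihilator in the free algebra of the generator \<open>1\<close> tensor
  \<open>1\<close>. Equalities in the Verma module become membership in this left ideal.\<close>

definition vann :: "(transp \<Rightarrow> 'k::field) \<Rightarrow> S3 \<Rightarrow> 'k free_alg set" where
  "vann a g = {p. vmap a g p = vmap a g 0}"

lemma vmap_eq_iff: "vmap a g p = vmap a g q \<longleftrightarrow> p - q \<in> vann a g"
proof
  assume "vmap a g p = vmap a g q"
  from vmap_cong_add[OF this, of "- q" "- q"] show "p - q \<in> vann a g"
    by (simp add: vann_def)
next
  assume "p - q \<in> vann a g"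
  then have "vmap a g (p - q) = vmap a g 0"
    by (simp add: vann_def)
  from vmap_cong_add[OF this, of q q] show "vmap a g p = vmap a g q"
    by simp
qed

lemma vann_zero: "0 \<in> vann a g"
  by (simp add: vann_def)

lemma vann_add: "p \<in> vann a g \<Longrightarrow> q \<in> vann a g \<Longrightarrow> p + q \<in> vann a g"
  using vmap_cong_add[of a g p 0 q 0] by (simp add: vann_def)

lemma vann_mult: "q \<in> vann a g \<Longrightarrow> p * q \<in> vann a g"
  using vmap_cong_mult[of a g q 0 p] by (simp add: vann_def)

lemma vann_uminus: "p \<in> vann a g \<Longrightarrow> - p \<in> vann a g"
  using vann_mult[of p a g "- 1"] by simp

lemma vann_diff: "p \<in> vann a g \<Longrightarrow> q \<in> vann a g \<Longrightarrow> p - q \<in> vann a g"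
  using vann_add[OF _ vann_uminus, of p a g q] by simp

lemma vann_sum: "(\<And>i. i \<in> I \<Longrightarrow> f i \<in> vann a g) \<Longrightarrow> sum f I \<in> vann a g"
  by (induction I rule: infinite_finite_induct) (auto intro: vann_add vann_zero)

lemma vann_relation: "r \<in> relations a \<Longrightarrow> r * w \<in> vann a g"
  using cls_relation[of r a 1 w] vmap_cls_eq[of a "r * w" 0 g] by (simp add: vann_def)

text \<open>Weights exist only after passing to the Verma module, so the condition is imposed modulo
  \<open>vann\<close>, for all idempotents simultaneously.\<close>

definition has_weight :: "(transp \<Rightarrow> 'k::field) \<Rightarrow> S3 \<Rightarrow> S3 \<Rightarrow> 'k free_alg \<Rightarrow> bool" where
  "has_weight a g h p \<longleftrightarrow> (\<forall>h'. delta h' * p - (if h' = h then p else 0) \<in> vann a g)"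

text \<open>Each \<open>delta h'\<close> is the function element of an indicator function, and
  crossing the tensor sign replaces that function by its value at \<open>g\<close>.\<close>

lemma has_weight_one: "has_weight a g g 1"
  unfolding has_weight_def
proof
  fix h'
  have "delta h' = fun_elt (\<lambda>h. if h = h' then 1 else (0::'a))"
    by (simp add: fun_elt_ring sc_simps if_distrib[of sc] sum.delta' if_distrib[of "\<lambda>x. x * _"] cong: if_cong)
  then have "vmap a g (delta h') = vmap a g (sc (if g = h' then 1 else 0))"
    using vmap_fun_elt[of a g 1 "\<lambda>h. if h = h' then 1 else (0::'a)"] by simp
  then show "delta h' * 1 - (if h' = g then 1 else 0) \<in> vann a g"
    by (auto simp: vmap_eq_iff sc_simps)
qed

lemma has_weight_xgen:
  assumes "has_weight a g h p"
  shows "has_weight a g (perm_of t * h) (xgen t * p)"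
  unfolding has_weight_def
proof
  fix h'
  have "delta h' * xgen t - xgen t * delta (perm_of t * h') \<in> relations a"
    unfolding relations_def by blast
  from vann_relation[OF this, of p g]
  have 1: "(delta h' * xgen t - xgen t * delta (perm_of t * h')) * p \<in> vann a g" .
  have 2: "xgen t * (delta (perm_of t * h') * p - (if perm_of t * h' = h then p else 0)) \<in> vann a g"
    using assms by (intro vann_mult) (simp add: has_weight_def)
  have tt: "perm_of t * (perm_of t * k) = k" for k
    by (simp flip: mult.assoc)
  have "perm_of t * h' = h \<longleftrightarrow> h' = perm_of t * h"
    using tt by metis
  with vann_add[OF 1 2] show "delta h' * (xgen t * p) - (if h' = perm_of t * h then xgen t * p else 0) \<in> vann a g"
    by (simp add: algebra_simps split: if_splits)
qed

lemma has_weight_sc: "has_weight a g h p \<Longrightarrow> has_weight a g h (sc c * p)"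
  unfolding has_weight_def
proof
  fix h'
  assume "\<forall>h'. delta h' * p - (if h' = h then p else 0) \<in> vann a g"
  then have "sc c * (delta h' * p - (if h' = h then p else 0)) \<in> vann a g"
    by (intro vann_mult) auto
  then show "delta h' * (sc c * p) - (if h' = h then sc c * p else 0) \<in> vann a g"
    by (simp add: sc_left_commute algebra_simps split: if_splits)
qed

lemma has_weight_add: "has_weight a g h p \<Longrightarrow> has_weight a g h q \<Longrightarrow> has_weight a g h (p + q)"
  unfolding has_weight_def
proof
  fix h'
  assume "\<forall>h'. delta h' * p - (if h' = h then p else 0) \<in> vann a g"
    "\<forall>h'. delta h' * q - (if h' = h then q else 0) \<in> vann a g"
  then have "(delta h' * p - (if h' = h then p else 0)) + (delta h' * q - (if h' = h then q else 0)) \<in> vann a g"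
    by (intro vann_add) auto
  then show "delta h' * (p + q) - (if h' = h then p + q else 0) \<in> vann a g"
    by (simp add: algebra_simps split: if_splits)
qed

lemma has_weight_fun_elt:
  assumes "has_weight a g h p"
  shows "fun_elt f * p - sc (f h) * p \<in> vann a g"
proof -
  have "fun_elt f * p - sc (f h) * p
      = (\<Sum>k\<in>UNIV. sc (f k) * (delta k * p - (if k = h then p else 0)))"
    by (simp add: fun_elt_ring sum_distrib_right right_diff_distrib sum_subtractf mult.assoc
        if_distrib[of "\<lambda>x. _ * x"] cong: if_cong)
  also have "\<dots> \<in> vann a g"
    using assms by (intro vann_sum vann_mult) (simp add: has_weight_def)
  finally show ?thesis .
qed

text \<open>On an element of weight \<open>h\<close> the function element on the right of the
  relation acts by its value at \<open>h\<close>, so a square of a generator at the left of a word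
  can be replaced by a scalar.\<close>

lemma xgen_square:
  assumes "has_weight a g h p"
  shows "xgen t * (xgen t * p) - sc (f_fun a t h) * p \<in> vann a g"
proof -
  have "xgen t * xgen t - fun_elt (f_fun a t) \<in> relations a"
    unfolding relations_def by blast
  from vann_add[OF vann_relation[OF this, of p g] has_weight_fun_elt[OF assms, of "f_fun a t"]]
  show ?thesis by (simp add: algebra_simps)
qed

section \<open>Rewriting words in the Verma module of weight (12)\<close>

context degenerate
begin

abbreviation "g0 \<equiv> perm_of T12"
abbreviation "J \<equiv> vann a g0"
abbreviation (input) "A \<equiv> xgen T12 :: 'k free_alg"
abbreviation (input) "B \<equiv> xgen T13 :: 'k free_alg"
abbreviation (input) "C \<equiv> xgen T23 :: 'k free_alg"

text \<open>At \<open>rot\<close> the basis is \<open>C\<close>, \<open>A * B * A\<close>; the bases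
  at the other weights of \<open>L_index\<close> are its transports along the four-cycle. For
  instance \<open>B\<close> takes \<open>C\<close> to \<open>B * C\<close>, which
  \<open>step\<close> wants to be \<open>b\<close> times the first vector at (23), and
  \<open>B * (A * B * A)\<close> is congruent to \<open>b\<close> times
  \<open>B * C + A * B\<close>; applying \<open>A\<close> then gives the vectors at
  \<open>rot'\<close>. The sign at (12) makes the second vector there equal to
  \<open>m_top\<close>.\<close>

definition lift_weight :: "S3 \<Rightarrow> 'k \<times> 'k \<Rightarrow> 'k free_alg" where
  "lift_weight g z =
    (if g = 1 then sc (fst z) * A + sc (snd z) * (B * A * C)
     else if g = perm_of T12 then sc (fst z) - sc (snd z) * (A * B * A * C)
     else if g = perm_of T13 then sc (snd z) * (B * A) - sc (fst z / b) * (A * C)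
     else if g = perm_of T23 then sc (fst z / b) * (B * C) + sc (snd z) * (B * C + A * B)
     else if g = rot then sc (fst z) * C + sc (snd z) * (A * B * A)
     else sc (fst z / b) * (A * B * C) + sc (snd z) * (A * B * C - sc b * B))"

definition lift :: "'k model \<Rightarrow> 'k free_alg" where
  "lift u = (\<Sum>g\<in>UNIV. lift_weight g (u g))"

lemma lift_weight_add: "lift_weight g (z + z') = lift_weight g z + lift_weight g z'"
  by (simp add: lift_weight_def sc_simps add_divide_distrib algebra_simps)

lemma lift_weight_scale: "lift_weight g (pscale c z) = sc c * lift_weight g z"
  by (simp add: lift_weight_def pscale_def sc_simps algebra_simps flip: times_divide_eq_right)

lemma lift_weight_zero [simp]: "lift_weight g 0 = 0"
  by (simp add: lift_weight_def sc_simps)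

lemma words_have_weight:
  "has_weight a g0 1 A" "has_weight a g0 rot' B" "has_weight a g0 rot C"
  "has_weight a g0 (perm_of T13) (B * A)" "has_weight a g0 (perm_of T13) (A * C)"
  "has_weight a g0 (perm_of T23) (B * C)" "has_weight a g0 (perm_of T23) (A * B)"
  "has_weight a g0 rot (A * (B * A))" "has_weight a g0 rot' (A * (B * C))" "has_weight a g0 1 (B * (A * C))"
  "has_weight a g0 (perm_of T12) (A * (B * (A * C)))"
proof -
  note w = has_weight_xgen[of a g0]
  show A: "has_weight a g0 1 A" and B: "has_weight a g0 rot' B" and C: "has_weight a g0 rot C"
    using w[OF has_weight_one, of T12] w[OF has_weight_one, of T13] w[OF has_weight_one, of T23]
    by simp_all
  show BA: "has_weight a g0 (perm_of T13) (B * A)" and AC: "has_weight a g0 (perm_of T13) (A * C)"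
    and BC: "has_weight a g0 (perm_of T23) (B * C)" and "has_weight a g0 (perm_of T23) (A * B)"
    using w[OF A, of T13] w[OF C, of T12] w[OF C, of T13] w[OF B, of T12] by simp_all
  show "has_weight a g0 rot (A * (B * A))" "has_weight a g0 rot' (A * (B * C))"
    and BAC: "has_weight a g0 1 (B * (A * C))"
    using w[OF BA, of T12] w[OF BC, of T12] w[OF AC, of T13] by simp_all
  show "has_weight a g0 (perm_of T12) (A * (B * (A * C)))"
    using w[OF BAC, of T12] by simp
qed

lemma has_weight_diff: "has_weight a g h p \<Longrightarrow> has_weight a g h q \<Longrightarrow> has_weight a g h (p - q)"
  using has_weight_add[of a g h p "sc (- 1) * q"] has_weight_sc[of a g h q "- 1"] by (simp add: sc_simps)

lemma has_weight_lift: "has_weight a g0 g (lift_weight g z)"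
proof -
  have "has_weight a g0 g0 (sc c)" for c
    using has_weight_sc[OF has_weight_one, of a g0 c] by simp
  then show ?thesis
    by (cases g rule: S3_cases)
      (auto simp: lift_weight_def mult.assoc intro!: has_weight_add has_weight_diff has_weight_sc words_have_weight)
qed

lemma square_relations:
  "A * A \<in> J" "B * B \<in> J" "C * C \<in> J" "A * (A * (B * (A * C))) \<in> J" "B * (B * (A * C)) \<in> J"
  "B * (B * (A * (B * C))) \<in> J" "B * (B * (A * B)) - sc b * (A * B) \<in> J" "B * (B * A) \<in> J"
  "A * (A * C) + sc b * C \<in> J" "A * (A * (B * C)) + sc b * (B * C) \<in> J"
  "B * (B * C) - sc b * C \<in> J" "A * (A * (B * A)) + sc b * (B * A) \<in> J"
  "A * (A * B) + sc b * B \<in> J"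
  using xgen_square[OF has_weight_one[of a g0], of T12] xgen_square[OF has_weight_one[of a g0], of T13]
    xgen_square[OF has_weight_one[of a g0], of T23]
    xgen_square[OF words_have_weight(10), of T12] xgen_square[OF words_have_weight(5), of T13]
    xgen_square[OF words_have_weight(9), of T13] xgen_square[OF words_have_weight(7), of T13]
    xgen_square[OF words_have_weight(1), of T13] xgen_square[OF words_have_weight(3), of T12]
    xgen_square[OF words_have_weight(6), of T12] xgen_square[OF words_have_weight(3), of T13]
    xgen_square[OF words_have_weight(4), of T12] xgen_square[OF words_have_weight(2), of T12]
  by (simp_all add: f_simps sc_simps)

lemma braid_relations: "(B * C + C * A + A * B) * w \<in> J" "(C * B + B * A + A * C) * w \<in> J"
  by (rule vann_relation; simp add: relations_def)+

lemmas braid_relation1 = braid_relations(1)[of 1, simplified] and braid_relation2 = braid_relations(2)[of 1, simplified]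

text \<open>The reductions below are proved by certificates: the element is written as an explicit
  combination of known members of \<open>J\<close>, the identity is checked in the free algebra with
  \<open>cert\<close>, and membership follows from closure under sums and left
  multiplication.\<close>

lemmas J_intros = square_relations braid_relations braid_relation1 braid_relation2 vann_add vann_diff vann_uminus vann_mult

lemmas cert = algebra_simps sc_left_commute[of "xgen _"] sc_commute[of "xgen _"]

text \<open>From the second braid relation applied to \<open>B * C\<close>: the term
  \<open>C * B * B * C\<close> dies because \<open>B * B * C\<close> is \<open>b\<close> times
  \<open>C\<close> and \<open>C * C\<close> vanishes, and \<open>C * B * C\<close> is rewritten by
  the same relation once more.\<close>

lemma reduce_BABC: "B * (A * (B * C)) - A * (B * (A * C)) \<in> J"
proof -
  have "B * (A * (B * C)) - A * (B * (A * C)) = (C * B + B * A + A * C) * (B * C)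
      - C * (B * (B * C) - sc b * C) - sc b * (C * C) - A * ((C * B + B * A + A * C) * C)
      + A * (A * (C * C))"
    by (simp add: cert)
  then show ?thesis
    by (simp only:) (rule J_intros)+
qed

text \<open>The second braid relation applied to \<open>A * C\<close> leaves
  \<open>B * A * A * C\<close> and \<open>A * C * A * C\<close>, which contribute opposite multiples
  of \<open>b\<close> times \<open>B * C\<close>.\<close>

lemma reduce_CBAC: "C * (B * (A * C)) \<in> J"
proof -
  have "C * (B * (A * C)) = (C * B + B * A + A * C) * (A * C) - B * (A * (A * C) + sc b * C)
      - A * ((B * C + C * A + A * B) * C) + A * (B * (C * C)) + (A * (A * (B * C)) + sc b * (B * C))"
    by (simp add: cert)
  then show ?thesis
    by (simp only:) (rule J_intros)+
qed

text \<open>Both ways of reducing \<open>B * (B * C + C * A + A * B)\<close> are compared. The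
  outcome identifies \<open>m_o\<close>, which is \<open>B * A * B\<close> plus \<open>b\<close>
  times \<open>C\<close>, with the word \<open>A * B * A\<close>.\<close>

lemma reduce_BAB: "B * (A * B) - A * (B * A) + sc b * C \<in> J"
proof -
  have "B * (A * B) - A * (B * A) + sc b * C = B * (B * C + C * A + A * B) - (B * (B * C) - sc b * C)
      - (B * C + C * A + A * B) * A + C * (A * A)"
    by (simp add: cert)
  then show ?thesis
    by (simp only:) (rule J_intros)+
qed

lemma reduce_CBA: "C * (B * A) - A * (B * C) + sc b * B \<in> J"
proof -
  have "C * (B * A) - A * (B * C) + sc b * B = (C * B + B * A + A * C) * A - B * (A * A)
      - A * (B * C + C * A + A * B) + (A * (A * B) + sc b * B)"
    by (simp add: cert)
  then show ?thesis
    by (simp only:) (rule J_intros)+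
qed

lemma reduce_CBC: "C * (B * C) + B * (A * C) \<in> J"
proof -
  have "C * (B * C) + B * (A * C) = (C * B + B * A + A * C) * C - A * (C * C)"
    by (simp add: cert)
  then show ?thesis
    by (simp only:) (rule J_intros)+
qed

text \<open>The first braid relation applied to \<open>B * C\<close>; its term
  \<open>B * C * B * C\<close> vanishes by \<open>reduce_CBC\<close> followed by
  \<open>B * B * A * C\<close> being in \<open>J\<close>.\<close>

lemma reduce_CABC: "C * (A * (B * C)) + sc b * (A * C) \<in> J"
proof -
  have "C * (A * (B * C)) + sc b * (A * C) = (B * C + C * A + A * B) * (B * C)
      - B * (C * (B * C) + B * (A * C)) + B * (B * (A * C)) - A * (B * (B * C) - sc b * C)"
    by (simp add: cert)
  then show ?thesis
    by (simp only:) (rule reduce_CBC J_intros)+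
qed

text \<open>The twelve words span a subspace that is stable under the generators modulo
  \<open>J\<close>, with the matrices recorded in \<open>step\<close>. There are eighteen cases,
  three generators at six weights, each with its own certificate.\<close>

lemma xgen_lift_weight:
  "xgen t * lift_weight g z - lift_weight (perm_of t * g) (step b t (perm_of t * g) z) \<in> J" (is "?L \<in> J")
proof -
  \<comment> \<open>Writing the first coordinate as a multiple of \<open>b\<close> clears the
    denominators in \<open>lift_weight\<close> and \<open>step\<close>.\<close>
  obtain x' y where z: "z = (x' * b, y)"
    using b_nonzero by (cases z) (metis nonzero_eq_divide_eq)
  define P where "P = sc x'"
  define Q where "Q = sc y"
  note S = z lift_weight_def pscale_def b_nonzero sc_simps P_def[symmetric] Q_def[symmetric]
  have P: "w * P = P * w" "w * (P * v) = P * (w * v)" for w v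
    by (simp_all add: P_def sc_commute sc_left_commute)
  have Q: "w * Q = Q * w" "w * (Q * v) = Q * (w * v)" for w v
    by (simp_all add: Q_def sc_commute sc_left_commute)
  \<comment> \<open>Central scalars are moved to the front past generators and past
    \<open>sc b\<close> only, which gives the rewriting a direction.\<close>
  have PQ: "xgen t * P = P * xgen t" "xgen t * (P * v) = P * (xgen t * v)"
    "xgen t * Q = Q * xgen t" "xgen t * (Q * v) = Q * (xgen t * v)"
    "sc b * P = P * sc b" "sc b * (P * v) = P * (sc b * v)"
    "sc b * Q = Q * sc b" "sc b * (Q * v) = Q * (sc b * v)" for v t
    using P Q by blast+
  note C = S cert PQ
  show ?thesis
  proof (cases g rule: S3_cases)
    case e
    show ?thesis
    proof (cases t)
      case T12
      have "?L = P * (sc b * (A * A))" by (simp add: e T12 C)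
      then show ?thesis by (simp only:) (rule J_intros)+
    next
      case T13
      have "?L = Q * (B * (B * (A * C)))" by (simp add: e T13 C)
      then show ?thesis by (simp only:) (rule J_intros)+
    next
      case T23
      have "?L = P * (sc b * (B * C + C * A + A * B)) + Q * (C * (B * (A * C)))"
        by (simp add: e T23 C)
      then show ?thesis by (simp only:) (rule reduce_CBAC J_intros)+
    qed
  next
    case s12
    show ?thesis
    proof (cases t)
      case T12
      have "?L = - (Q * (A * (A * (B * (A * C)))))" by (simp add: s12 T12 C)
      then show ?thesis by (simp only:) (rule J_intros)+
    next
      case T13
      have "?L = Q * (B * (B * (A * (B * C)) - A * (B * (A * C))) - B * (B * (A * (B * C))))"
        by (simp add: s12 T13 C)
      then show ?thesis by (simp only:) (rule reduce_BABC J_intros)+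
    next
      case T23
      have "?L = - (Q * ((B * C + C * A + A * B) * (B * (A * C)) - B * (C * (B * (A * C)))
          - A * (B * (B * (A * C)))))"
        by (simp add: s12 T23 C)
      then show ?thesis by (simp only:) (rule reduce_CBAC J_intros)+
    qed
  next
    case s13
    show ?thesis
    proof (cases t)
      case T12
      have "?L = - (P * (A * (A * C) + sc b * C))" by (simp add: s13 T12 C)
      then show ?thesis by (simp only:) (rule J_intros)+
    next
      case T13
      have "?L = Q * (B * (B * A))" by (simp add: s13 T13 C)
      then show ?thesis by (simp only:) (rule J_intros)+
    next
      case T23
      have "?L = - (P * ((B * C + C * A + A * B) * C - B * (C * C)))
          + Q * (C * (B * A) - A * (B * C) + sc b * B)"
        by (simp add: s13 T23 C)
      then show ?thesis by (simp only:) (rule reduce_CBA J_intros)+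
    qed
  next
    case s23
    show ?thesis
    proof (cases t)
      case T12
      have "?L = Q * (A * (A * B) + sc b * B)" by (simp add: s23 T12 C)
      then show ?thesis by (simp only:) (rule J_intros)+
    next
      case T13
      have "?L = P * (B * (B * C) - sc b * C)
          + Q * ((B * (B * C) - sc b * C) + (B * (A * B) - A * (B * A) + sc b * C))"
        by (simp add: s23 T13 C)
      then show ?thesis by (simp only:) (rule reduce_BAB J_intros)+
    next
      case T23
      have "?L = P * (C * (B * C) + B * (A * C)) + Q * ((C * (B * C) + B * (A * C))
          + (B * C + C * A + A * B) * B - B * (C * B + B * A + A * C) + B * (B * A) - A * (B * B))"
        by (simp add: s23 T23 C)
      then show ?thesis by (simp only:) (rule reduce_CBC J_intros)+
    qed
  next
    case rot
    show ?thesis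
    proof (cases t)
      case T12
      have "?L = Q * (A * (A * (B * A)) + sc b * (B * A))" by (simp add: rot T12 C)
      then show ?thesis by (simp only:) (rule J_intros)+
    next
      case T13
      have "?L = Q * ((B * (B * (A * B)) - sc b * (A * B)) - B * (B * (A * B) - A * (B * A) + sc b * C))"
        by (simp add: rot T13 C)
      then show ?thesis by (simp only:) (rule reduce_BAB J_intros)+
    next
      case T23
      have "?L = P * (sc b * (C * C)) + Q * ((B * C + C * A + A * B) * (B * A)
          - B * (C * (B * A) - A * (B * C) + sc b * B) - (B * (A * (B * C)) - A * (B * (A * C)))
          + sc b * (B * B) - A * (B * (B * A)))"
        by (simp add: rot T23 C)
      then show ?thesis by (simp only:) (rule reduce_CBA reduce_BABC J_intros)+
    qed
  next
    case rot'
    show ?thesis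
    proof (cases t)
      case T12
      have "?L = (P + Q) * (A * (A * (B * C)) + sc b * (B * C))" by (simp add: rot' T12 C)
      then show ?thesis by (simp only:) (rule J_intros)+
    next
      case T13
      have "?L = (P + Q) * (B * (A * (B * C)) - A * (B * (A * C))) - Q * (sc b * (B * B))"
        by (simp add: rot' T13 C)
      then show ?thesis by (simp only:) (rule reduce_BABC J_intros)+
    next
      case T23
      have "?L = (P + Q) * (C * (A * (B * C)) + sc b * (A * C))
          - Q * (sc b * (C * B + B * A + A * C))"
        by (simp add: rot' T23 C)
      then show ?thesis by (simp only:) (rule reduce_CABC J_intros)+
    qed
  qed
qed

section \<open>Comparison of the model with the Verma module\<close>

lemma lift_add: "lift (u + v) = lift u + lift v"
  by (simp add: lift_def lift_weight_add sum.distrib)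

lemma lift_scale: "lift (mscale c u) = sc c * lift u"
  by (simp add: lift_def mscale_def lift_weight_scale sum_distrib_left)

lemma lift_op: "Poly_Mapping.single [x] 1 * lift u - lift (model_op b x u) \<in> J"
proof (cases x)
  case (Delta h)
  have "(\<Sum>g\<in>UNIV. lift_weight g (model_op b (Delta h) u g)) = (\<Sum>g\<in>UNIV. if h = g then lift_weight g (u g) else 0)"
    by (rule sum.cong) auto
  then have "delta h * lift u - lift (model_op b x u)
      = (\<Sum>g\<in>UNIV. delta h * lift_weight g (u g) - (if h = g then lift_weight g (u g) else 0))"
    by (simp add: Delta lift_def sum_distrib_left sum_subtractf)
  also have "\<dots> \<in> J"
    using has_weight_lift by (intro vann_sum) (simp add: has_weight_def)
  finally show ?thesis
    by (simp add: Delta)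
next
  case (Refl t)
  have tt: "perm_of t * (perm_of t * k) = k" for k
    by (simp flip: mult.assoc)
  \<comment> \<open>The model indexes by the target weight and \<open>xgen_lift_weight\<close> by
    the source; left multiplication by the transposition exchanges the two indexings.\<close>
  have "lift (model_op b x u) = (\<Sum>g\<in>UNIV. lift_weight (perm_of t * g) (step b t (perm_of t * g) (u g)))"
    unfolding lift_def
    by (rule sum.reindex_bij_witness[of _ "\<lambda>g. perm_of t * g" "\<lambda>g. perm_of t * g"]) (simp_all add: Refl tt)
  then have "xgen t * lift u - lift (model_op b x u)
      = (\<Sum>g\<in>UNIV. xgen t * lift_weight g (u g) - lift_weight (perm_of t * g) (step b t (perm_of t * g) (u g)))"
    by (simp add: lift_def sum_distrib_left sum_subtractf)
  also have "\<dots> \<in> J"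
    by (intro vann_sum xgen_lift_weight)
  finally show ?thesis
    by (simp add: Refl)
qed

text \<open>Modulo \<open>J\<close> the map \<open>lift\<close> intertwines the two actions. At the
  cyclic vector, where \<open>lift\<close> is \<open>1\<close>, this says that every
  \<open>p\<close> is congruent to a lift, which is the surjectivity of
  \<open>\<Phi>\<close>.\<close>

lemma lift_act: "p * lift u - lift (V.act p u) \<in> J"
proof (induction p rule: poly_mapping_induct_single)
  case zero
  have "lift 0 = 0" by (simp add: lift_def)
  then show ?case using vann_zero[of a g0] by (simp add: zero_fun_def)
next
  case (single w c)
  have "Poly_Mapping.single w 1 * lift u - lift (foldr (model_op b) w u) \<in> J"
  proof (induction w)
    case Nil
    have "(Poly_Mapping.single [] 1 :: 'k free_alg) = 1"
      by (metis gen_list_zero single_one)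
    then show ?case using vann_zero[of a g0] by simp
  next
    case (Cons x w)
    have "(Poly_Mapping.single (x # w) 1 :: 'k free_alg) = Poly_Mapping.single [x] 1 * Poly_Mapping.single w 1"
      by (simp add: mult_single gen_list_add)
    moreover have "Poly_Mapping.single [x] 1 * (Poly_Mapping.single w 1 * lift u - lift (foldr (model_op b) w u))
      + (Poly_Mapping.single [x] 1 * lift (foldr (model_op b) w u)
          - lift (model_op b x (foldr (model_op b) w u))) \<in> J"
      by (intro vann_add vann_mult lift_op Cons)
    ultimately show ?case
      by (simp add: algebra_simps)
  qed
  from vann_mult[OF this, of "sc c"] show ?case
    by (simp add: V.act_single lift_scale right_diff_distrib sc_single flip: mult.assoc)
next
  case (add p q)
  from vann_add[OF this] show ?case
    by (simp only: V.act_plus lift_add) (simp add: algebra_simps)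
qed

lemma lift_e: "lift (emb g0 (1, 0)) = 1"
  by (simp add: lift_def sum_S3 emb_def) (simp add: lift_weight_def sc_simps)

text \<open>The basis words, evaluated at the cyclic vector, return the basis vectors of the model.
  Hence \<open>lift\<close> has a left inverse, from which injectivity will follow.\<close>

lemma act_lift_e: "V.act (lift u) (emb g0 (1, 0)) = u"
proof -
  have s: "V.act (sc c) v = mscale c v" for c v
    by (simp add: sc_def V.act_const)
  show ?thesis
    unfolding fun_eq_iff forall_S3
    by (simp add: lift_def sum_S3 lift_weight_def V.act_plus V.act_minus V.act_mult V.act_gen s emb_def
        mscale_def pscale_def prod_eq_iff b_nonzero)
qed

definition \<Phi> :: "'k model \<Rightarrow> 'k verma_elt" where "\<Phi> u = vmap a g0 (lift u)"

lemma vmap_eq_\<Phi>: "vmap a g0 p = \<Phi> (V.act p (emb g0 (1, 0)))"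
  using lift_act[of p "emb g0 (1, 0)"] by (simp add: \<Phi>_def vmap_eq_iff lift_e)

text \<open>Equal images under \<open>\<Phi>\<close> act equally on the cyclic vector, because the
  relations hold in the model and that vector has weight (12); \<open>act_lift_e\<close> then
  recovers the arguments.\<close>

lemma bij_\<Phi>: "bij_betw \<Phi> UNIV (carrier (M12 a))"
proof (rule bij_betw_imageI)
  show "inj \<Phi>"
  proof (rule injI)
    fix u v assume eq: "\<Phi> u = \<Phi> v"
    have "V.act (lift u) (emb g0 (1, 0)) = V.act (lift v) (emb g0 (1, 0))"
    proof (rule V.vmap_eqD)
      show "V.act p w = V.act q w" if "cls a p = cls a q" for p q w
        by (rule model_cls_eq[OF that])
      show "V.act (fun_elt f) (emb g0 (1, 0)) = mscale (f g0) (emb g0 (1, 0))" for f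
        unfolding model_fun_elt by (auto simp: emb_def mscale_def pscale_def zero_prod_def fun_eq_iff)
      show "vmap a g0 (lift u) = vmap a g0 (lift v)"
        using eq by (simp only: \<Phi>_def)
    qed
    then show "u = v"
      by (simp add: act_lift_e)
  qed
  show "\<Phi> ` UNIV = carrier (M12 a)"
  proof
    show "\<Phi> ` UNIV \<subseteq> carrier (M12 a)"
      unfolding M12_def carrier_verma by (auto simp: \<Phi>_def)
    show "carrier (M12 a) \<subseteq> \<Phi> ` UNIV"
      unfolding M12_def carrier_verma by (auto simp: vmap_eq_\<Phi>)
  qed
qed

lemma \<Phi>_add: "\<Phi> u \<oplus>\<^bsub>M12 a\<^esub> \<Phi> v = \<Phi> (u + v)"
  by (simp add: \<Phi>_def M12_def lift_add vmap_add)

lemma \<Phi>_zero: "\<zero>\<^bsub>M12 a\<^esub> = \<Phi> 0"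
  using vmap_zero[of a g0] by (simp add: \<Phi>_def M12_def lift_def)

lemma \<Phi>_act: "cls a p \<odot>\<^bsub>M12 a\<^esub> \<Phi> u = \<Phi> (V.act p u)"
  using lift_act[of p u] by (simp add: \<Phi>_def M12_def vmap_smult vmap_eq_iff)

lemma inj_\<Phi>: "\<Phi> u = \<Phi> v \<longleftrightarrow> u = v"
  using bij_\<Phi> by (auto simp: bij_betw_def inj_eq)

lemma carrier_M12: "carrier (M12 a) = range \<Phi>"
  using bij_\<Phi> by (simp add: bij_betw_def)

section \<open>Transport of submodules and distinguished elements along \<Phi>\<close>

lemma comm_group_M12: "comm_group (add_monoid (M12 a))"
proof (rule comm_groupI)
  fix x assume "x \<in> carrier (add_monoid (M12 a))"
  then obtain u where u: "x = \<Phi> u"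
    by (auto simp: carrier_M12)
  have "\<Phi> (- u) \<oplus>\<^bsub>M12 a\<^esub> x = \<zero>\<^bsub>M12 a\<^esub>"
    by (simp only: u \<Phi>_add \<Phi>_zero) simp
  then show "\<exists>y\<in>carrier (add_monoid (M12 a)). y \<otimes>\<^bsub>add_monoid (M12 a)\<^esub> x = \<one>\<^bsub>add_monoid (M12 a)\<^esub>"
    by (auto simp: carrier_M12)
qed (auto simp: carrier_M12 \<Phi>_add \<Phi>_zero inj_\<Phi> add_ac)

lemma \<Phi>_inv: "inv\<^bsub>add_monoid (M12 a)\<^esub> \<Phi> u = \<Phi> (- u)"
proof (rule group.inv_equality[OF comm_group.axioms(2)[OF comm_group_M12]])
  show "\<Phi> (- u) \<otimes>\<^bsub>add_monoid (M12 a)\<^esub> \<Phi> u = \<one>\<^bsub>add_monoid (M12 a)\<^esub>"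
    by (simp only: partial_object.simps monoid.simps \<Phi>_add \<Phi>_zero) simp
qed (auto simp: carrier_M12)

lemma submodule_subset: "submodule N R (M12 a) \<Longrightarrow> \<exists>W. N = \<Phi> ` W"
  using subgroup.subset[OF submodule.axioms(1)] by (force simp: carrier_M12 subset_image_iff)

text \<open>The ring record \<open>R\<close> is left arbitrary so that the same criterion covers
  submodules over \<open>alg a\<close> and linear subspaces, which are submodules over
  \<open>scalars a\<close>.\<close>

lemma submodule_iff:
  "submodule (\<Phi> ` W) R (M12 a) \<longleftrightarrow>
     0 \<in> W \<and> (\<forall>u\<in>W. \<forall>v\<in>W. u + v \<in> W) \<and> (\<forall>u\<in>W. - u \<in> W) \<and>
     (\<forall>r\<in>carrier R. \<forall>u\<in>W. r \<odot>\<^bsub>M12 a\<^esub> \<Phi> u \<in> \<Phi> ` W)"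
proof
  assume "submodule (\<Phi> ` W) R (M12 a)"
  then interpret submodule "\<Phi> ` W" R "M12 a" .
  have m: "\<Phi> v \<in> \<Phi> ` W \<longleftrightarrow> v \<in> W" for v
    by (auto simp: inj_\<Phi>)
  have "0 \<in> W"
    using one_closed by (simp add: \<Phi>_zero m)
  moreover have "u + v \<in> W" if "u \<in> W" "v \<in> W" for u v
    using m_closed[of "\<Phi> u" "\<Phi> v"] that by (simp add: \<Phi>_add m)
  moreover have "- u \<in> W" if "u \<in> W" for u
    using m_inv_closed[of "\<Phi> u"] that by (simp add: \<Phi>_inv m)
  ultimately show "0 \<in> W \<and> (\<forall>u\<in>W. \<forall>v\<in>W. u + v \<in> W) \<and> (\<forall>u\<in>W. - u \<in> W) \<and>
     (\<forall>r\<in>carrier R. \<forall>u\<in>W. r \<odot>\<^bsub>M12 a\<^esub> \<Phi> u \<in> \<Phi> ` W)"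
    by auto
next
  assume *: "0 \<in> W \<and> (\<forall>u\<in>W. \<forall>v\<in>W. u + v \<in> W) \<and> (\<forall>u\<in>W. - u \<in> W) \<and>
     (\<forall>r\<in>carrier R. \<forall>u\<in>W. r \<odot>\<^bsub>M12 a\<^esub> \<Phi> u \<in> \<Phi> ` W)"
  have "subgroup (\<Phi> ` W) (add_monoid (M12 a))"
  proof (rule group.subgroupI[OF comm_group.axioms(2)[OF comm_group_M12]])
    show "inv\<^bsub>add_monoid (M12 a)\<^esub> x \<in> \<Phi> ` W" if "x \<in> \<Phi> ` W" for x
      using that * by (force simp only: image_iff \<Phi>_inv)
  qed (use * in \<open>auto simp: carrier_M12 \<Phi>_add\<close>)
  then show "submodule (\<Phi> ` W) R (M12 a)"
    using * by (intro submodule.intro submodule_axioms.intro) auto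
qed

lemma \<Phi>_mem: "\<Phi> u \<in> \<Phi> ` W \<longleftrightarrow> u \<in> W"
  by (auto simp: inj_\<Phi>)

lemma submodule_alg_iff: "submodule (\<Phi> ` W) (alg a) (M12 a) \<longleftrightarrow> V.invariant W"
proof -
  have "- u \<in> W" if "V.invariant W" "u \<in> W" for u
    using that V.subspace_neg by (auto simp: V.invariant_def)
  then show ?thesis
    unfolding submodule_iff V.invariant_iff_act by (auto simp: carrier_alg \<Phi>_act \<Phi>_mem V.invariant_iff_act)
qed

lemma submodule_scalars_iff: "submodule (\<Phi> ` W) (scalars a) (M12 a) \<longleftrightarrow> V.subspace W"
proof -
  have "- u \<in> W" if "V.subspace W" "u \<in> W" for u
    using that V.subspace_neg by auto
  then show ?thesis
    unfolding submodule_iff by (auto simp: scalars_def \<Phi>_act \<Phi>_mem V.act_const V.subspace_def)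
qed

lemma gen_submodule_\<Phi>:
  assumes iff: "\<And>W. submodule (\<Phi> ` W) R (M12 a) \<longleftrightarrow> P W"
    and W: "P W" "U \<subseteq> W" "\<And>W'. P W' \<Longrightarrow> U \<subseteq> W' \<Longrightarrow> W \<subseteq> W'"
  shows "gen_submodule R (M12 a) (\<Phi> ` U) = \<Phi> ` W"
proof -
  have sub: "\<Phi> ` S \<subseteq> \<Phi> ` S' \<longleftrightarrow> S \<subseteq> S'" for S S'
    by (auto simp: inj_\<Phi>)
  have "\<Phi> ` W \<subseteq> N" if N: "submodule N R (M12 a)" "\<Phi> ` U \<subseteq> N" for N
  proof -
    obtain W' where W': "N = \<Phi> ` W'"
      using submodule_subset[OF N(1)] by blast
    show ?thesis
      using N W(3)[of W'] by (simp only: W' iff sub)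
  qed
  then show ?thesis
    unfolding gen_submodule_def using W iff by (intro antisym Inter_greatest Inter_lower) (auto simp: sub)
qed

lemma sub12_\<Phi>:
  assumes "V.invariant W" "U \<subseteq> W" "\<And>W'. V.invariant W' \<Longrightarrow> U \<subseteq> W' \<Longrightarrow> W \<subseteq> W'"
  shows "sub12 a (\<Phi> ` U) = \<Phi> ` W"
  unfolding sub12_def using submodule_alg_iff assms by (rule gen_submodule_\<Phi>)

lemma span12_\<Phi>: "span12 a (\<Phi> ` U) = \<Phi> ` V.span U"
  unfolding span12_def lin_span_def using submodule_scalars_iff
  by (rule gen_submodule_\<Phi>) (auto intro: V.span_base dest: V.span_minimal)

lemma weight_space_\<Phi>: "weight_space a (M12 a) g = \<Phi> ` range (emb g)"
proof -
  have "model_op b (Delta g) u = emb g (u g)" for u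
    by (auto simp: emb_def)
  moreover have "\<exists>u. emb g z = emb g (u g)" for z :: "'k \<times> 'k"
    by (rule exI[of _ "\<lambda>_. z"]) simp
  ultimately show ?thesis
    by (auto simp: weight_space_def carrier_M12 \<Phi>_act V.act_gen image_image)
qed

lemma m12_\<Phi>: "m12 a ts = \<Phi> (V.act (prod_list (map xgen ts)) (emb g0 (1, 0)))"
  by (simp add: m12_def verma_mon_def vmap_eq_\<Phi> flip: vmap_def)

lemma m_3_\<Phi>: "m_3 a = \<Phi> (emb 1 (0, 1))"
proof -
  have "V.act (prod_list (map xgen [T13, T12, T23])) (emb g0 (1, 0)) = emb 1 (0, 1)"
    unfolding fun_eq_iff forall_S3
    by (simp add: V.act_mult V.act_gen emb_def pscale_def prod_eq_iff b_nonzero)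
  then show ?thesis
    by (simp only: m_3_def m12_\<Phi>)
qed

lemma m_top_\<Phi>: "m_top a = \<Phi> (emb g0 (0, 1))"
proof -
  have "V.act (prod_list (map xgen [T13, T12, T23, T12])) (emb g0 (1, 0)) = emb g0 (0, 1)"
    unfolding fun_eq_iff forall_S3
    by (simp add: V.act_mult V.act_gen emb_def pscale_def prod_eq_iff b_nonzero)
  then show ?thesis
    by (simp only: m_top_def m12_\<Phi>)
qed

lemma m_o_\<Phi>: "m_o a = \<Phi> (emb rot (0, 1))"
proof -
  have "V.act (prod_list (map xgen [T13, T12, T13])) (emb g0 (1, 0))
      + mscale b (V.act (prod_list (map xgen [T23])) (emb g0 (1, 0))) = emb rot (0, 1)"
    unfolding fun_eq_iff forall_S3
    by (simp add: V.act_mult V.act_gen emb_def mscale_def pscale_def prod_eq_iff b_nonzero)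
  then show ?thesis
    by (simp only: m_o_def m12_\<Phi> f_simps \<Phi>_act V.act_const \<Phi>_add)
qed

text \<open>The first isomorphism theorem for a map \<open>T\<close> on \<open>W\<close> with kernel
  \<open>W'\<close>. Since \<open>T\<close> is onto \<open>U\<close> and the relations hold in the
  model, it also shows that \<open>rep_module\<close> has a well-defined action, which its
  definition leaves open.\<close>

lemma subquotient_isomorphic:
  fixes s :: "'k \<Rightarrow> 'w::ab_group_add \<Rightarrow> 'w"
  assumes W: "V.invariant W" and W': "V.invariant W'" "W' \<subseteq> W" and rep: "free_alg_rep s \<rho>"
    and add: "\<And>u v. u \<in> W \<Longrightarrow> v \<in> W \<Longrightarrow> T (u + v) = T u + T v"
    and scale: "\<And>c u. u \<in> W \<Longrightarrow> T (mscale c u) = s c (T u)"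
    and gen: "\<And>x u. u \<in> W \<Longrightarrow> T (model_op b x u) = \<rho> x (T u)"
    and surj: "T ` W = U" and ker: "\<And>u. u \<in> W \<Longrightarrow> T u = 0 \<longleftrightarrow> u \<in> W'"
  shows "module_isomorphic (alg a) (subquotient (M12 a) (\<Phi> ` W) (\<Phi> ` W')) (rep_module s U \<rho>)"
proof -
  let ?Q = "subquotient (M12 a) (\<Phi> ` W) (\<Phi> ` W')" and ?N = "rep_module s U \<rho>"
  define co where "co u = \<Phi> ` {w + u | w. w \<in> W'}" for u
  interpret N: free_alg_rep s \<rho> by (rule rep)
  have Tact: "T (V.act p u) = N.act p (T u)" if "u \<in> W" for p u
    using free_alg_rep_equivariant[OF V.free_alg_rep_axioms rep W add scale gen that] by simp
  \<comment> \<open>Two representatives of a class differ by an element that kills every model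
    vector; pulling \<open>x\<close> back along \<open>T\<close> shows that they act alike on
    \<open>x\<close>, so the set inside \<open>the_elem\<close> is a singleton.\<close>
  have smult: "cls a p \<odot>\<^bsub>?N\<^esub> x = N.act p x" if x: "x \<in> U" for p x
  proof -
    obtain u where u: "u \<in> W" "x = T u"
      using x surj by auto
    have eq: "N.act q x = N.act p x" if "q \<in> cls a p" for q
      using that model_rel_ideal[of "q - p" u] u by (simp add: mem_cls V.act_minus flip: Tact)
    have "(\<lambda>q. N.act q x) ` cls a p = (\<lambda>q. N.act p x) ` cls a p"
      by (rule image_cong[OF refl eq])
    also have "\<dots> = {N.act p x}"
      using cls_self[of p a] by auto
    finally show ?thesis
      by (simp add: rep_module_def)
  qed
  have sW: "V.subspace W" and sW': "V.subspace W'"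
    using W W' by (auto simp: V.invariant_def)
  have diff: "T (u - v) = T u - T v" if "u \<in> W" "v \<in> W" for u v
    using add[of "u - v" v] that V.subspace_diff[OF sW] by (simp add: algebra_simps)
  have mem_co: "\<Phi> v \<in> co u \<longleftrightarrow> v - u \<in> W'" for u v
  proof -
    have "v - u \<in> W' \<longleftrightarrow> (\<exists>w. w \<in> W' \<and> v = w + u)"
      by (metis add_diff_cancel_right' diff_add_cancel)
    then show ?thesis
      unfolding co_def \<Phi>_mem by blast
  qed
  have co_mono: "co u \<subseteq> range \<Phi>" for u
    by (auto simp: co_def)
  have co_eqI: "co u = co v" if "u - v \<in> W'" for u v
  proof -
    have "x - u \<in> W' \<longleftrightarrow> x - v \<in> W'" for x
      using V.subspace_add[OF sW' _ that, of "x - u"] V.subspace_diff[OF sW' _ that, of "x - v"] by auto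
    then have "\<Phi> x \<in> co u \<longleftrightarrow> \<Phi> x \<in> co v" for x
      by (simp add: mem_co)
    then show ?thesis
      using co_mono by blast
  qed
  have coset: "(\<Phi> ` W') #>\<^bsub>add_monoid (M12 a\<lparr>carrier := \<Phi> ` W\<rparr>)\<^esub> \<Phi> u = co u" for u
    by (auto simp: r_coset_def co_def \<Phi>_add)
  have coset': "(\<Phi> ` W') +>\<^bsub>M12 a\<lparr>carrier := \<Phi> ` W\<rparr>\<^esub> \<Phi> u = co u" for u
    using coset by (simp add: a_r_coset_def)
  have carrier: "carrier ?Q = co ` W"
    unfolding subquotient_def quot_module_def A_RCOSETS_def RCOSETS_def
    using coset by auto
  have Qadd: "co u \<oplus>\<^bsub>?Q\<^esub> co v = co (u + v)" for u v
  proof -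
    have co: "co u = \<Phi> ` {v. v - u \<in> W'}" for u
      using co_mono[of u] by (auto simp: mem_co)
    have "co u \<oplus>\<^bsub>?Q\<^esub> co v = (\<Union>x\<in>{x. x - u \<in> W'}. \<Union>y\<in>{y. y - v \<in> W'}. {\<Phi> (x + y)})"
      by (simp add: subquotient_def quot_module_def set_add_def set_mult_def co \<Phi>_add)
    also have "\<dots> = co (u + v)"
    proof (intro equalityI subsetI)
      fix m assume "m \<in> (\<Union>x\<in>{x. x - u \<in> W'}. \<Union>y\<in>{y. y - v \<in> W'}. {\<Phi> (x + y)})"
      then obtain x y where "m = \<Phi> (x + y)" "x - u \<in> W'" "y - v \<in> W'"
        by blast
      then show "m \<in> co (u + v)"
        using V.subspace_add[OF sW', of "x - u" "y - v"] by (simp add: mem_co algebra_simps)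
    next
      fix m assume m: "m \<in> co (u + v)"
      then obtain z where z: "m = \<Phi> z" "z - (u + v) \<in> W'"
        by (auto simp: co)
      then have "z - v - u \<in> W'" "v - v \<in> W'" "m = \<Phi> (z - v + v)"
        using V.subspace_0[OF sW'] by (simp_all add: algebra_simps)
      then show "m \<in> (\<Union>x\<in>{x. x - u \<in> W'}. \<Union>y\<in>{y. y - v \<in> W'}. {\<Phi> (x + y)})"
        by blast
    qed
    finally show ?thesis .
  qed
  have Qsmult: "cls a p \<odot>\<^bsub>?Q\<^esub> co u = co (V.act p u)" for p u
  proof -
    have eq: "co (V.act p v) = co (V.act p u)" if "v - u \<in> W'" for v
      using V.invariant_act[OF W'(1) that, of p] V.act_add_right[of p "v - u" u]
      by (intro co_eqI) (simp add: algebra_simps)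
    have co: "co u = \<Phi> ` {v. v - u \<in> W'}"
      using co_mono[of u] by (auto simp: mem_co)
    have "cls a p \<odot>\<^bsub>?Q\<^esub> co u = (\<Union>m\<in>co u. (\<Phi> ` W') +>\<^bsub>M12 a\<lparr>carrier := \<Phi> ` W\<rparr>\<^esub> (cls a p \<odot>\<^bsub>M12 a\<^esub> m))"
      by (simp add: subquotient_def quot_module_def)
    also have "\<dots> = (\<Union>v\<in>{v. v - u \<in> W'}. co (V.act p v))"
      by (simp only: co image_image \<Phi>_act coset')
    also have "\<dots> = (\<Union>v\<in>{v. v - u \<in> W'}. co (V.act p u))"
      by (rule SUP_cong[OF refl], rule eq) simp
    also have "\<dots> = co (V.act p u)"
    proof -
      have "u \<in> {v. v - u \<in> W'}"
        using V.subspace_0[OF sW'] by simp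
      then show ?thesis by blast
    qed
    finally show ?thesis .
  qed
  \<comment> \<open>The induced map on cosets: \<open>T\<close> is constant on a coset of an element
    of \<open>W\<close> because it kills \<open>W'\<close>.\<close>
  define h where "h C = the_elem ((\<lambda>m. T (inv_into UNIV \<Phi> m)) ` C)" for C
  have h: "h (co u) = T u" if "u \<in> W" for u
  proof -
    have inv: "inv_into UNIV \<Phi> (\<Phi> v) = v" for v
      by (simp add: inj_def inj_\<Phi>)
    have "T (w + u) = T u" if "w \<in> W'" for w
      using that \<open>u \<in> W\<close> ker[of w] W'(2) by (auto simp: add)
    then have "(\<lambda>m. T (inv_into UNIV \<Phi> m)) ` co u = {T u}"
      using V.subspace_0[OF sW'] by (auto simp: co_def inv image_image)
    then show ?thesis
      by (simp add: h_def)
  qed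
  have N_sel: "carrier ?N = U" "add ?N = (+)"
    by (simp_all add: rep_module_def)
  have "h \<in> iso (add_monoid ?Q) (add_monoid ?N)"
    unfolding iso_def hom_def bij_betw_def
  proof (intro CollectI conjI ballI)
    show "h \<in> carrier (add_monoid ?Q) \<rightarrow> carrier (add_monoid ?N)"
      using surj by (auto simp: carrier N_sel h)
    show "h (C \<otimes>\<^bsub>add_monoid ?Q\<^esub> D) = h C \<otimes>\<^bsub>add_monoid ?N\<^esub> h D"
      if "C \<in> carrier (add_monoid ?Q)" "D \<in> carrier (add_monoid ?Q)" for C D
      using that V.subspace_add[OF sW] by (auto simp: carrier Qadd N_sel h add)
    show "inj_on h (carrier (add_monoid ?Q))"
    proof (rule inj_onI)
      fix C D assume CD: "C \<in> carrier (add_monoid ?Q)" "D \<in> carrier (add_monoid ?Q)" "h C = h D"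
      then obtain u v where uv: "C = co u" "D = co v" "u \<in> W" "v \<in> W"
        by (auto simp: carrier)
      then have "T (u - v) = 0"
        using CD by (simp add: h diff)
      then have "u - v \<in> W'"
        using uv ker[of "u - v"] V.subspace_diff[OF sW] by blast
      then show "C = D"
        unfolding uv by (rule co_eqI)
    qed
    show "h ` carrier (add_monoid ?Q) = carrier (add_monoid ?N)"
      using surj by (auto simp: carrier N_sel h image_image)
  qed
  moreover have "h (r \<odot>\<^bsub>?Q\<^esub> C) = r \<odot>\<^bsub>?N\<^esub> h C" if rC: "r \<in> carrier (alg a)" "C \<in> carrier ?Q" for r C
  proof -
    obtain p u where "r = cls a p" "C = co u" "u \<in> W"
      using rC by (auto simp: carrier carrier_alg)
    moreover from this have "T u \<in> U"
      using surj by blast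
    ultimately show ?thesis
      using V.invariant_act[OF W] by (simp add: Qsmult h smult Tact)
  qed
  ultimately show ?thesis
    unfolding module_isomorphic_def by blast
qed

end

subsection \<open>Subspaces of the plane\<close>

text \<open>The line \<open>0 \<times> k\<close> is \<open>PB\<close>; the line of slope \<open>c\<close> is \<open>PL c\<close>.\<close>

datatype 'k psub = PZ | PB | PL 'k | PF

primrec plane :: "'k::field psub \<Rightarrow> ('k \<times> 'k) set" where
  "plane PZ = {0}"
| "plane PB = {z. fst z = 0}"
| "plane (PL c) = {z. snd z = c * fst z}"
| "plane PF = UNIV"

lemma plane_zero: "0 \<in> plane s"
  and plane_add: "z \<in> plane s \<Longrightarrow> z' \<in> plane s \<Longrightarrow> z + z' \<in> plane s"
  and plane_scale: "z \<in> plane s \<Longrightarrow> pscale c z \<in> plane s"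
  by (cases s; auto simp: pscale_def prod_eq_iff algebra_simps)+

lemma plane_subset: "plane s \<subseteq> plane t \<longleftrightarrow> s = PZ \<or> t = PF \<or> s = t"
proof
  assume *: "plane s \<subseteq> plane t"
  have "(0, 1) \<in> plane s \<Longrightarrow> (0, 1) \<in> plane t" "(1, c) \<in> plane s \<Longrightarrow> (1, c) \<in> plane t" for c
    using * by auto
  \<comment> \<open>Three test vectors separate the cases: \<open>(0, 1)\<close>,
    \<open>(1, 0)\<close> and, if \<open>s\<close> is a line with slope, the vector
    \<open>(1, c)\<close> on it.\<close>
  from this(1) this(2)[of 0] this(2)[of "case s of PL c \<Rightarrow> c | _ \<Rightarrow> 0"]
  show "s = PZ \<or> t = PF \<or> s = t"
    by (cases s; cases t) (auto simp: prod_eq_iff)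
next
  assume "s = PZ \<or> t = PF \<or> s = t"
  then show "plane s \<subseteq> plane t"
    using plane_zero by auto
qed

text \<open>If some vector has a nonzero first coordinate, \<open>S\<close> contains the line of its
  slope, and any vector off that line completes it to the plane. Otherwise \<open>S\<close> lies in
  \<open>0 \<times> k\<close>.\<close>

lemma plane_cases:
  fixes S :: "('k::field \<times> 'k) set"
  assumes zero: "0 \<in> S" and add: "\<And>z z'. z \<in> S \<Longrightarrow> z' \<in> S \<Longrightarrow> z + z' \<in> S"
    and scale: "\<And>c z. z \<in> S \<Longrightarrow> pscale c z \<in> S"
  obtains s where "S = plane s"
proof (cases "\<exists>z\<in>S. fst z \<noteq> 0")
  case True
  then obtain x y where xy: "(x, y) \<in> S" "x \<noteq> 0" by auto
  define c where "c = y / x"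
  have c: "(1, c) \<in> S"
    using scale[OF xy(1), of "1 / x"] xy(2) by (simp add: pscale_def c_def)
  have line: "plane (PL c) \<subseteq> S"
  proof
    fix z assume "z \<in> plane (PL c)"
    then have "z = pscale (fst z) (1, c)"
      by (simp add: pscale_def prod_eq_iff mult.commute)
    then show "z \<in> S"
      using scale[OF c] by metis
  qed
  show thesis
  proof (cases "S \<subseteq> plane (PL c)")
    case True
    then show ?thesis using line that by blast
  next
    case False
    then obtain z where z: "z \<in> S" "snd z - c * fst z \<noteq> 0" by auto
    define d where "d = snd z - c * fst z"
    have "z + pscale (- fst z) (1, c) \<in> S"
      using add scale c z by blast
    also have "z + pscale (- fst z) (1, c) = (0, d)"
      by (simp add: prod_eq_iff pscale_def d_def algebra_simps)
    finally have "pscale (1 / d) (0, d) \<in> S"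
      by (rule scale)
    then have 01: "(0, 1) \<in> S"
      using z by (simp add: pscale_def d_def)
    have "w \<in> S" for w
    proof -
      have "w = pscale (fst w) (1, c) + pscale (snd w - c * fst w) (0, 1)"
        by (simp add: pscale_def prod_eq_iff)
      then show ?thesis
        using add scale c 01 by metis
    qed
    then have "S = plane PF" by auto
    then show ?thesis by (rule that)
  qed
next
  case False
  show thesis
  proof (cases "S = {0}")
    case True
    then show ?thesis using that[of PZ] by simp
  next
    case nz: False
    then obtain z where z: "z \<in> S" "z \<noteq> 0"
      using zero by auto
    with False have sz: "fst z = 0" "snd z \<noteq> 0"
      by (auto simp: prod_eq_iff)
    have "w \<in> S" if "fst w = 0" for w
      using scale[OF z(1), of "snd w / snd z"] that sz by (simp add: pscale_def prod_eq_iff) (metis prod.collapse)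
    with False have "S = plane PB" by auto
    then show ?thesis by (rule that)
  qed
qed

text \<open>Apart from two exceptional subspaces, \<open>s\<close> contains a vector whose relevant
  coordinate is \<open>1\<close>; then \<open>t\<close> has to contain the corresponding unit
  vector, which leaves two possibilities for \<open>t\<close>.\<close>

lemma plane_conditions:
  "(\<forall>z\<in>plane s. (0, fst z) \<in> plane t) \<longleftrightarrow> s = PZ \<or> s = PB \<or> t = PB \<or> t = PF" (is ?A)
  "(\<forall>z\<in>plane s. (0, snd z) \<in> plane t) \<longleftrightarrow> s = PZ \<or> s = PL 0 \<or> t = PB \<or> t = PF" (is ?B)
  "(\<forall>z\<in>plane s. (fst z, 0) \<in> plane t) \<longleftrightarrow> s = PZ \<or> s = PB \<or> t = PL 0 \<or> t = PF" (is ?C)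
proof -
  have "\<exists>y. (1 :: 'a, y) \<in> plane s" if "s \<noteq> PZ" "s \<noteq> PB"
    using that by (cases s) auto
  moreover have "\<exists>x. (x, 1 :: 'a) \<in> plane s" if "s \<noteq> PZ" "s \<noteq> PL 0"
    using that by (cases s) (auto intro: exI[of _ "1 / _"])
  ultimately show ?A ?B ?C
    by (cases s; cases t; fastforce simp: prod_eq_iff)+
qed

lemma ex_psub: "(\<exists>s. P s) \<longleftrightarrow> P PZ \<or> P PB \<or> P PF \<or> (\<exists>c. P (PL c))"
  by (metis psub.exhaust)

context degenerate
begin

subsection \<open>Invariant subspaces of the model\<close>

definition sub3 :: "'k psub \<Rightarrow> 'k psub \<Rightarrow> 'k psub \<Rightarrow> 'k model set" where
  "sub3 P Q R = {u. (\<forall>g\<in>L_index. u g \<in> plane P) \<and> u 1 \<in> plane Q \<and> u g0 \<in> plane R}"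

lemma L_index: "L_index = {perm_of T13, perm_of T23, rot, rot'}"
  by (simp add: L_index_def)

lemma emb_sub3:
  "emb 1 z \<in> sub3 P Q R \<longleftrightarrow> z \<in> plane Q" "emb g0 z \<in> sub3 P Q R \<longleftrightarrow> z \<in> plane R"
  "g \<in> L_index \<Longrightarrow> emb g z \<in> sub3 P Q R \<longleftrightarrow> z \<in> plane P"
  "emb rot z \<in> sub3 P Q R \<longleftrightarrow> z \<in> plane P"
  by (auto simp: sub3_def emb_def plane_zero L_index)

lemma sub3_subset:
  "sub3 P Q R \<subseteq> sub3 P' Q' R' \<longleftrightarrow> plane P \<subseteq> plane P' \<and> plane Q \<subseteq> plane Q' \<and> plane R \<subseteq> plane R'"
proof
  assume *: "sub3 P Q R \<subseteq> sub3 P' Q' R'"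
  show "plane P \<subseteq> plane P' \<and> plane Q \<subseteq> plane Q' \<and> plane R \<subseteq> plane R'"
    using * emb_sub3 by (metis subset_iff)
qed (auto simp: sub3_def)

text \<open>The clauses are the generators between weights not both on the four-cycle, with nonzero
  scalars removed. Two generators mix coordinates, namely (13) from \<open>rot'\<close> to (12) and
  back; subtracting the effect of (23) between \<open>rot\<close> and (12) leaves the pure clauses
  in \<open>fst z\<close>.\<close>

definition admissible :: "'k psub \<Rightarrow> 'k psub \<Rightarrow> 'k psub \<Rightarrow> bool" where
  "admissible P Q R \<longleftrightarrow>
    (\<forall>z\<in>plane P. (0, fst z) \<in> plane Q) \<and> (\<forall>z\<in>plane P. (0, snd z) \<in> plane R) \<and>
    (\<forall>z\<in>plane P. (0, fst z) \<in> plane R) \<and>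
    (\<forall>z\<in>plane Q. (0, fst z) \<in> plane P) \<and> (\<forall>z\<in>plane Q. (0, snd z) \<in> plane R) \<and>
    (\<forall>z\<in>plane R. (fst z, 0) \<in> plane Q) \<and> (\<forall>z\<in>plane R. (fst z, 0) \<in> plane P) \<and>
    (\<forall>z\<in>plane R. (0, fst z) \<in> plane P)"

definition compatible :: "'k psub \<Rightarrow> 'k psub \<Rightarrow> bool" where
  "compatible P Q \<longleftrightarrow> (P = PZ \<or> P = PB \<or> Q = PB \<or> Q = PF) \<and> (Q = PZ \<or> Q = PB \<or> P = PB \<or> P = PF)"

text \<open>A vector in \<open>R\<close> with nonzero first coordinate puts both unit vectors into
  \<open>P\<close>, and then \<open>Q\<close> and \<open>R\<close> are full as well. If
  \<open>R\<close> is zero, both coordinates vanish on \<open>P\<close>, and \<open>Q\<close> has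
  second coordinate zero and then also first, as otherwise \<open>(0, 1)\<close> would be in
  \<open>P\<close>. For \<open>R\<close> equal to \<open>PB\<close> only the coupling of
  \<open>P\<close> and \<open>Q\<close> remains.\<close>

lemma admissible_iff:
  "admissible P Q R \<longleftrightarrow> R = PZ \<and> P = PZ \<and> Q = PZ \<or> R = PB \<and> compatible P Q \<or> R = PF \<and> P = PF \<and> Q = PF"
  unfolding admissible_def plane_conditions compatible_def
  by (cases P; cases Q; cases R) auto

lemma subspace_sub3: "V.subspace (sub3 P Q R)"
  by (auto simp: V.subspace_def sub3_def mscale_def plane_zero plane_add plane_scale)

lemma op_emb: "model_op b (Refl t) (emb g z) = emb (perm_of t * g) (step b t (perm_of t * g) z)"
proof
  fix h
  have tt: "perm_of t * (perm_of t * k) = k" for k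
    by (simp flip: mult.assoc)
  then have "perm_of t * h = g \<longleftrightarrow> h = perm_of t * g"
    by metis
  then show "model_op b (Refl t) (emb g z) h = emb (perm_of t * g) (step b t (perm_of t * g) z) h"
    by (auto simp: emb_def tt)
qed

lemma op_delta: "model_op b (Delta g) u = emb g (u g)"
  by (auto simp: emb_def)

lemma emb_sum: "u = (\<Sum>g\<in>UNIV. emb g (u g))"
  by (rule ext) (simp add: sum_apply emb_def)

lemma emb_add: "emb g (z + z') = emb g z + emb g z'" and emb_scale: "emb g (pscale c z) = mscale c (emb g z)"
  and emb_zero: "emb g 0 = 0"
  by (auto simp: emb_def mscale_def pscale_def zero_prod_def fun_eq_iff)

lemma invariant_sub3:
  assumes "admissible P Q R"
  shows "V.invariant (sub3 P Q R)"
proof -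
  have neg: "(0, - y) \<in> plane s" if "(0, y) \<in> plane s" for y and s :: "'k psub"
    using plane_scale[OF that, of "- 1"] by (simp add: pscale_def)
  have div: "(0, - (y / b)) \<in> plane s" if "(0, y) \<in> plane s" for y and s :: "'k psub"
    using plane_scale[OF that, of "- (1 / b)"] by (simp add: pscale_def)
  have c: "z \<in> plane P \<Longrightarrow> (0, fst z) \<in> plane Q" "z \<in> plane P \<Longrightarrow> (0, snd z) \<in> plane R"
    "z \<in> plane P \<Longrightarrow> (0, fst z) \<in> plane R" "z \<in> plane Q \<Longrightarrow> (0, fst z) \<in> plane P"
    "z \<in> plane Q \<Longrightarrow> (0, snd z) \<in> plane R" "z \<in> plane R \<Longrightarrow> (fst z, 0) \<in> plane Q"
    "z \<in> plane R \<Longrightarrow> (fst z, 0) \<in> plane P" "z \<in> plane R \<Longrightarrow> (0, fst z) \<in> plane P" for z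
    using assms unfolding admissible_def by blast+
  have c': "(fst z, - (fst z / b)) \<in> plane P" if "z \<in> plane R" for z
    using plane_add[OF c(7)[OF that] div[OF c(8)[OF that]]] by simp
  have c'': "(0, - (fst z / b) - snd z) \<in> plane R" if "z \<in> plane P" for z
    using plane_add[OF div[OF c(3)[OF that]] neg[OF c(2)[OF that]]] by simp
  have "model_op b x u \<in> sub3 P Q R" if u: "u \<in> sub3 P Q R" for x u
  proof (cases x)
    case (Delta g)
    then show ?thesis
      using u by (auto simp: sub3_def plane_zero)
  next
    case (Refl t)
    have "u (perm_of T13) \<in> plane P" "u (perm_of T23) \<in> plane P" "u rot \<in> plane P" "u rot' \<in> plane P"
      "u 1 \<in> plane Q" "u g0 \<in> plane R"
      using u by (simp_all add: sub3_def L_index)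
    then show ?thesis
      unfolding Refl sub3_def
      by (cases t) (simp_all add: L_index neg div c c' c'' plane_scale)
  qed
  then show ?thesis
    by (simp add: V.invariant_def subspace_sub3)
qed

text \<open>The idempotents split \<open>W\<close> into weight components, invertibility along the
  four-cycle makes four of these equal, and the remaining generators yield the clauses of
  \<open>admissible\<close>.\<close>

lemma invariant_cases:
  assumes W: "V.invariant W"
  obtains P Q R where "admissible P Q R" "W = sub3 P Q R"
proof -
  have sub: "V.subspace W" and op: "\<And>x u. u \<in> W \<Longrightarrow> model_op b x u \<in> W"
    using W by (auto simp: V.invariant_def)
  have comp: "\<exists>s. \<forall>z. emb g z \<in> W \<longleftrightarrow> z \<in> plane s" for g
  proof (rule plane_cases[of "{z. emb g z \<in> W}"])
    fix s assume "{z. emb g z \<in> W} = plane s"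
    then show ?thesis by blast
  qed (auto simp: emb_add emb_scale emb_zero V.subspace_0[OF sub] V.subspace_add[OF sub] V.subspace_scale[OF sub])
  obtain P where P: "\<And>z. emb rot z \<in> W \<longleftrightarrow> z \<in> plane P" using comp by metis
  obtain Q where Q: "\<And>z. emb 1 z \<in> W \<longleftrightarrow> z \<in> plane Q" using comp by metis
  obtain R where R: "\<And>z. emb g0 z \<in> W \<longleftrightarrow> z \<in> plane R" using comp by metis
  have opr: "emb g z \<in> W \<Longrightarrow> emb (perm_of t * g) (step b t (perm_of t * g) z) \<in> W" for t g z
    using op[of "emb g z" "Refl t"] by (simp only: op_emb)
  have scale: "emb g (pscale b z) \<in> W \<longleftrightarrow> emb g z \<in> W" for g z
    using V.subspace_scale[OF sub, of "emb g (pscale b z)" "1 / b"] V.subspace_scale[OF sub, of "emb g z" b]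
    by (auto simp: emb_scale b_nonzero)
  \<comment> \<open>Inclusions once around the four-cycle: (13), \<open>rot\<close>, (23),
    \<open>rot'\<close>, (13). Closing the cycle turns them into equalities.\<close>
  have "emb (perm_of T13) z \<in> W \<Longrightarrow> emb rot z \<in> W"
    "emb rot z \<in> W \<Longrightarrow> emb (perm_of T23) z \<in> W"
    "emb (perm_of T23) z \<in> W \<Longrightarrow> emb rot' z \<in> W"
    "emb rot' z \<in> W \<Longrightarrow> emb (perm_of T13) z \<in> W" for z
    using opr[of "perm_of T13" z T12] opr[of rot z T13] opr[of "perm_of T23" z T12] opr[of rot' z T23]
    by (simp_all add: scale)
  then have L: "emb g z \<in> W \<longleftrightarrow> z \<in> plane P" if "g \<in> L_index" for g z
    using that P unfolding L_index by blast
  have "u \<in> W \<longleftrightarrow> u \<in> sub3 P Q R" for u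
  proof -
    have "u \<in> W \<longleftrightarrow> (\<forall>g. emb g (u g) \<in> W)"
      using op[of u "Delta _"] emb_sum[of u] V.subspace_sum[OF sub, of UNIV "\<lambda>g. emb g (u g)"]
      by (metis op_delta)
    then show ?thesis
      using L P Q R by (simp add: forall_S3 sub3_def L_index) blast
  qed
  then have eq: "W = sub3 P Q R" by blast
  have neg: "(0, y) \<in> plane s" if "(0, - y) \<in> plane s" for y and s :: "'k psub"
    using plane_scale[OF that, of "- 1"] by (simp add: pscale_def)
  have div: "(0, y) \<in> plane s" if "(0, - (y / b)) \<in> plane s" for y and s :: "'k psub"
    using plane_scale[OF that, of "- b"] by (simp add: pscale_def b_nonzero)
  have "admissible P Q R"
    unfolding admissible_def
  proof (intro conjI ballI)
    fix z assume "z \<in> plane P"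
    then have z: "emb g z \<in> W" if "g \<in> L_index" for g
      using L that by blast
    show "(0, fst z) \<in> plane Q"
      using opr[OF z[of "perm_of T13"], of T13] by (auto simp: L_index Q intro: div)
    show snd: "(0, snd z) \<in> plane R"
      using opr[OF z[of rot], of T23] by (simp add: L_index R)
    have "(0, - (fst z / b) - snd z) \<in> plane R"
      using opr[OF z[of rot'], of T13] by (simp add: L_index R)
    \<comment> \<open>The generator (13) mixes both coordinates; adding the vector supplied by (23)
      removes \<open>snd z\<close>, and the factor \<open>-1/b\<close> is scaled away.\<close>
    from plane_add[OF this snd] show "(0, fst z) \<in> plane R"
      by (auto intro: div)
  next
    fix z assume "z \<in> plane Q"
    then have z: "emb 1 z \<in> W"
      by (simp add: Q)
    show "(0, fst z) \<in> plane P"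
      using opr[OF z, of T13] by (simp add: L L_index)
    show "(0, snd z) \<in> plane R"
      using opr[OF z, of T12] by (auto simp: R intro: neg)
  next
    fix z assume "z \<in> plane R"
    then have z: "emb g0 z \<in> W"
      by (simp add: R)
    show "(fst z, 0) \<in> plane Q"
      using opr[OF z, of T12] by (simp add: Q)
    show fst: "(fst z, 0) \<in> plane P"
      using opr[OF z, of T23] by (simp add: P)
    have "(fst z, - (fst z / b)) \<in> plane P"
      using opr[OF z, of T13] by (simp add: L L_index)
    from plane_add[OF this plane_scale[OF fst, of "- 1"]] show "(0, fst z) \<in> plane P"
      by (auto simp: pscale_def intro: div)
  qed
  with eq show thesis using that by blast
qed

end

section \<open>The simple subquotients\<close>

lemma Ke_rep: "free_alg_rep ((*) :: 'k::field \<Rightarrow> 'k \<Rightarrow> 'k) Ke_op"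
proof unfold_locales
  show "Ke_op x (u + v) = Ke_op x u + Ke_op x v" for x and u v :: 'k
    by (cases x) auto
  show "Ke_op x (c * u) = c * Ke_op x u" for x and c u :: 'k
    by (cases x) auto
qed (auto simp: algebra_simps)

lemma L_rep: "free_alg_rep (fun_scale :: 'k::field \<Rightarrow> (S3 \<Rightarrow> 'k) \<Rightarrow> S3 \<Rightarrow> 'k) (L_op a)"
proof unfold_locales
  show "L_op a x (u + v) = L_op a x u + L_op a x v" for x and u v :: "S3 \<Rightarrow> 'k"
    by (cases x) (auto simp: fun_scale_def fun_eq_iff sum_apply algebra_simps sum.distrib)
  show "L_op a x (fun_scale c u) = fun_scale c (L_op a x u)" for x and c and u :: "S3 \<Rightarrow> 'k"
    by (cases x) (auto simp: fun_scale_def fun_eq_iff sum_apply sum_distrib_left algebra_simps)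
qed (auto simp: fun_scale_def fun_eq_iff algebra_simps)

definition psub_covers :: "'k psub \<Rightarrow> 'k psub \<Rightarrow> bool" where
  "psub_covers s t \<longleftrightarrow> s = PF \<and> (t = PB \<or> (\<exists>c. t = PL c)) \<or> t = PZ \<and> (s = PB \<or> (\<exists>c. s = PL c))"

text \<open>A cover in the lattice of subspaces has codimension one, so \<open>t\<close> is the
  kernel on \<open>s\<close> of a linear functional with coefficients \<open>p\<close>,
  \<open>q\<close>; the vector \<open>z0\<close> is normalised to value \<open>1\<close> and serves
  to prove surjectivity.\<close>

lemma psub_covers_functional:
  fixes s t :: "'k::field psub"
  assumes "psub_covers s t"
  obtains p q z0 where "\<And>z. z \<in> plane s \<Longrightarrow> p * fst z + q * snd z = 0 \<longleftrightarrow> z \<in> plane t"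
    and "z0 \<in> plane s" "p * fst z0 + q * snd z0 = 1" "plane t \<subseteq> plane s"
proof -
  from assms consider "s = PF" "t = PB" | c where "s = PF" "t = PL c" | "s = PB" "t = PZ"
    | c where "s = PL c" "t = PZ"
    unfolding psub_covers_def by blast
  then show thesis
  proof cases
    case 1
    then show ?thesis by (intro that[of 1 0 "(1, 0)"]) auto
  next
    case (2 c)
    then show ?thesis by (intro that[of "- c" 1 "(0, 1)"]) (auto simp: algebra_simps)
  next
    case 3
    then show ?thesis by (intro that[of 0 1 "(0, 1)"]) (auto simp: prod_eq_iff)
  next
    case (4 c)
    then show ?thesis by (intro that[of 1 0 "(1, c)"]) (auto simp: prod_eq_iff)
  qed
qed

lemma sum_L_index: "(\<Sum>g\<in>L_index. F g) = F (perm_of T13) + F (perm_of T23) + F rot + F rot'"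
  for F :: "S3 \<Rightarrow> 'a::comm_monoid_add"
  by (simp add: L_index_def add.assoc)

context degenerate
begin

definition verma_sub :: "'k psub \<Rightarrow> 'k psub \<Rightarrow> 'k verma_elt set" where
  "verma_sub P Q = \<Phi> ` sub3 P Q PB"

lemma invariant_compatible: "compatible P Q \<Longrightarrow> V.invariant (sub3 P Q PB)"
  by (simp add: invariant_sub3 admissible_iff)

lemma verma_sub_subset: "verma_sub P Q \<subseteq> verma_sub P' Q' \<longleftrightarrow> plane P \<subseteq> plane P' \<and> plane Q \<subseteq> plane Q'"
proof -
  have "verma_sub P Q \<subseteq> verma_sub P' Q' \<longleftrightarrow> sub3 P Q PB \<subseteq> sub3 P' Q' PB"
    unfolding verma_sub_def by (auto simp: inj_\<Phi>)
  then show ?thesis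
    by (simp add: sub3_subset)
qed

lemma verma_sub_eq: "verma_sub P Q = verma_sub P' Q' \<longleftrightarrow> P = P' \<and> Q = Q'"
  by (auto simp: set_eq_subset verma_sub_subset plane_subset)

text \<open>The projection is the functional cutting out \<open>Q'\<close>, applied to the component
  at \<open>e\<close>. What needs an argument is that every \<open>x_t\<close> becomes zero on the
  quotient.\<close>

lemma verma_sub_Ke_quotient:
  assumes "compatible P Q" "compatible P Q'" "psub_covers Q Q'"
  shows "module_isomorphic (alg a) (subquotient (M12 a) (verma_sub P Q) (verma_sub P Q')) Ke"
proof -
  obtain p q z0 where ker: "\<And>z. z \<in> plane Q \<Longrightarrow> p * fst z + q * snd z = 0 \<longleftrightarrow> z \<in> plane Q'"
    and z0: "z0 \<in> plane Q" "p * fst z0 + q * snd z0 = 1" and sub: "plane Q' \<subseteq> plane Q"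
    by (rule psub_covers_functional[OF assms(3)]) (rule that)
  define T where "T u = p * fst (u 1) + q * snd (u 1)" for u :: "'k model"
  show ?thesis
    unfolding verma_sub_def Ke_def
  proof (rule subquotient_isomorphic[where T = T])
    show "V.invariant (sub3 P Q PB)" "V.invariant (sub3 P Q' PB)"
      using assms by (auto intro: invariant_compatible)
    show "sub3 P Q' PB \<subseteq> sub3 P Q PB"
      using sub by (simp add: sub3_subset)
    show "free_alg_rep (*) Ke_op" by (rule Ke_rep)
    show "T (u + v) = T u + T v" for u v
      by (simp add: T_def algebra_simps)
    show "T (mscale c u) = c * T u" for c u
      by (simp add: T_def mscale_def pscale_def algebra_simps)
    show "T u = 0 \<longleftrightarrow> u \<in> sub3 P Q' PB" if "u \<in> sub3 P Q PB" for u
      using that ker[of "u 1"] by (auto simp: sub3_def T_def)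
    show "T ` sub3 P Q PB = UNIV"
    proof (intro equalityI subsetI)
      fix c :: 'k
      have "T (emb 1 (pscale c z0)) = c * (p * fst z0 + q * snd z0)"
        by (simp add: T_def emb_def pscale_def algebra_simps)
      also have "\<dots> = c"
        using z0 by simp
      finally have "c = T (emb 1 (pscale c z0))" by simp
      moreover have "emb 1 (pscale c z0) \<in> sub3 P Q PB"
        using z0 by (simp add: emb_sub3 plane_scale)
      ultimately show "c \<in> T ` sub3 P Q PB" by blast
    qed simp
    show "T (model_op b x u) = Ke_op x (T u)" if u: "u \<in> sub3 P Q PB" for x u
    proof (cases x)
      case (Delta g)
      then show ?thesis by (auto simp: T_def)
    next
      case (Refl t)
      \<comment> \<open>Deleting the component at \<open>e\<close> puts the vector into the smaller
        submodule, yet does not change the component of \<open>x_t u\<close> at \<open>e\<close>,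
        which comes from weight \<open>t\<close>. So that component lies in \<open>Q'\<close>, where
        the functional vanishes.\<close>
      define u' where "u' = (\<lambda>g. if g = 1 then 0 else u g)"
      have "u' \<in> sub3 P Q' PB"
        using u by (auto simp: sub3_def u'_def plane_zero L_index)
      then have "model_op b (Refl t) u' \<in> sub3 P Q' PB"
        using invariant_compatible[OF assms(2)] by (simp only: V.invariant_def)
      moreover have "model_op b (Refl t) u' 1 = model_op b (Refl t) u 1"
        by (simp add: u'_def)
      ultimately have "model_op b (Refl t) u 1 \<in> plane Q'"
        by (simp add: sub3_def)
      then have "T (model_op b (Refl t) u) = 0"
        unfolding T_def using ker sub by blast
      then show ?thesis
        by (simp add: Refl)
    qed
  qed
qed

text \<open>The same functional is applied at all four weights of \<open>L_index\<close>, which is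
  possible because the generators between these weights are scalars in the common
  coordinates.\<close>

lemma verma_sub_L_quotient:
  assumes "compatible P Q" "compatible P' Q" "psub_covers P P'"
  shows "module_isomorphic (alg a) (subquotient (M12 a) (verma_sub P Q) (verma_sub P' Q)) (L_module a)"
proof -
  obtain p q z0 where ker: "\<And>z. z \<in> plane P \<Longrightarrow> p * fst z + q * snd z = 0 \<longleftrightarrow> z \<in> plane P'"
    and z0: "z0 \<in> plane P" "p * fst z0 + q * snd z0 = 1" and sub: "plane P' \<subseteq> plane P"
    by (rule psub_covers_functional[OF assms(3)]) (rule that)
  define l where "l z = p * fst z + q * snd z" for z :: "'k \<times> 'k"
  define T where "T u = (\<lambda>g. if g \<in> L_index then l (u g) else 0)" for u :: "'k model"
  have l_simps: "l 0 = 0" "l (pscale c z) = c * l z" for c z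
    by (simp_all add: l_def pscale_def algebra_simps)
  show ?thesis
    unfolding verma_sub_def L_module_def
  proof (rule subquotient_isomorphic[where T = T])
    show "V.invariant (sub3 P Q PB)" "V.invariant (sub3 P' Q PB)"
      using assms by (auto intro: invariant_compatible)
    show "sub3 P' Q PB \<subseteq> sub3 P Q PB"
      using sub by (simp add: sub3_subset)
    show "free_alg_rep fun_scale (L_op a)" by (rule L_rep)
    show "T (u + v) = T u + T v" for u v
      by (auto simp: T_def l_def algebra_simps)
    show "T (mscale c u) = fun_scale c (T u)" for c u
      by (auto simp: T_def mscale_def l_simps fun_scale_def)
    show "T u = 0 \<longleftrightarrow> u \<in> sub3 P' Q PB" if "u \<in> sub3 P Q PB" for u
      using that ker by (auto simp: sub3_def T_def l_def fun_eq_iff)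
    show "T ` sub3 P Q PB = {u. \<forall>h. h \<notin> L_index \<longrightarrow> u h = 0}"
    proof (intro equalityI subsetI)
      fix w :: "S3 \<Rightarrow> 'k" assume w: "w \<in> {u. \<forall>h. h \<notin> L_index \<longrightarrow> u h = 0}"
      define u where "u = (\<lambda>g. if g \<in> L_index then pscale (w g) z0 else 0)"
      have "u \<in> sub3 P Q PB"
        using z0 by (auto simp: sub3_def u_def plane_scale plane_zero L_index)
      moreover have "w = T u"
        using w z0 by (auto simp: T_def u_def l_simps fun_eq_iff) (simp add: l_def)
      ultimately show "w \<in> T ` sub3 P Q PB" by blast
    qed (auto simp: T_def)
    show "T (model_op b x u) = L_op a x (T u)" if u: "u \<in> sub3 P Q PB" for x u
    proof (cases x)
      case (Delta g)
      then show ?thesis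
        by (auto simp: T_def fun_scale_def L_vec_def l_simps fun_eq_iff)
    next
      case (Refl t)
      \<comment> \<open>The part of \<open>u\<close> away from \<open>L_index\<close> lies in the
        smaller submodule, so whatever the generators send from there into the weights of
        \<open>L_index\<close> is killed by \<open>l\<close>.\<close>
      define u' where "u' = (\<lambda>g. if g \<in> L_index then 0 else u g)"
      have "u' \<in> sub3 P' Q PB"
        using u by (auto simp: sub3_def u'_def plane_zero L_index)
      then have "model_op b (Refl t) u' \<in> sub3 P' Q PB"
        using invariant_compatible[OF assms(2)] by (simp only: V.invariant_def)
      then have P': "model_op b (Refl t) u' g \<in> plane P'" if "g \<in> L_index" for g
        using that by (simp only: sub3_def mem_Collect_eq)
      have vanish: "l (step b t g (u (perm_of t * g))) = 0" if "g \<in> L_index" "perm_of t * g \<notin> L_index" for g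
        using P'[OF that(1)] that(2) ker[of "step b t g (u (perm_of t * g))"] sub
        by (auto simp: u'_def l_def)
      show ?thesis
        \<comment> \<open>Between weights of \<open>L_index\<close>, \<open>step\<close> multiplies
          by \<open>1\<close> into even permutations and by the value of \<open>f_fun\<close> into
          odd ones; these are the coefficients in \<open>L_x\<close>.\<close>
        unfolding Refl fun_eq_iff forall_S3
        by (cases t) (insert vanish[of "perm_of T13"] vanish[of "perm_of T23"] vanish[of rot] vanish[of rot'],
          simp_all add: sum_L_index sum_apply T_def L_index fun_scale_def L_x_def L_vec_def sign_S3 f_simps l_simps)
    qed
  qed
qed

subsection \<open>The lattice of submodules\<close>

lemma proper_submodules_eq: "proper_submodules a = {verma_sub P Q | P Q. compatible P Q}"
proof -
  have full: "carrier (M12 a) = \<Phi> ` sub3 PF PF PF"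
    by (simp add: carrier_M12 sub3_def)
  have "sub3 PZ PZ PZ = {0}"
    by (auto simp: sub3_def L_index fun_eq_iff forall_S3)
  then have zero: "{\<zero>\<^bsub>M12 a\<^esub>} = \<Phi> ` sub3 PZ PZ PZ"
    by (simp add: \<Phi>_zero)
  have eq: "\<Phi> ` sub3 P Q R = \<Phi> ` sub3 P' Q' R' \<longleftrightarrow> P = P' \<and> Q = Q' \<and> R = R'" for P Q R P' Q' R'
  proof -
    have "\<Phi> ` sub3 P Q R = \<Phi> ` sub3 P' Q' R' \<longleftrightarrow> sub3 P Q R = sub3 P' Q' R'"
      by (rule inj_image_eq_iff) (simp add: inj_def inj_\<Phi>)
    then show ?thesis
      by (auto simp: set_eq_subset sub3_subset plane_subset)
  qed
  have sub: "submodule U (alg a) (M12 a) \<longleftrightarrow> (\<exists>P Q R. admissible P Q R \<and> U = \<Phi> ` sub3 P Q R)" for U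
  proof
    assume U: "submodule U (alg a) (M12 a)"
    then obtain W where W: "U = \<Phi> ` W"
      using submodule_subset by blast
    then have "V.invariant W"
      using U by (simp add: submodule_alg_iff)
    then show "\<exists>P Q R. admissible P Q R \<and> U = \<Phi> ` sub3 P Q R"
      using W invariant_cases by metis
  qed (auto simp: submodule_alg_iff intro: invariant_sub3)
  have proper: "U \<in> proper_submodules a \<longleftrightarrow>
      (\<exists>P Q R. (admissible P Q R \<and> U = \<Phi> ` sub3 P Q R) \<and> \<not> (P = PF \<and> Q = PF \<and> R = PF) \<and> \<not> (P = PZ \<and> Q = PZ \<and> R = PZ))" for U
    unfolding proper_submodules_def full zero mem_Collect_eq sub by (auto simp: eq)
  have R: "(\<exists>P Q R. (admissible P Q R \<and> U = \<Phi> ` sub3 P Q R) \<and> \<not> (P = PF \<and> Q = PF \<and> R = PF) \<and>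
      \<not> (P = PZ \<and> Q = PZ \<and> R = PZ)) \<longleftrightarrow> (\<exists>P Q. compatible P Q \<and> U = \<Phi> ` sub3 P Q PB)" for U
  proof
    assume "\<exists>P Q. compatible P Q \<and> U = \<Phi> ` sub3 P Q PB"
    then obtain P Q where "compatible P Q" "U = \<Phi> ` sub3 P Q PB" by blast
    then show "\<exists>P Q R. (admissible P Q R \<and> U = \<Phi> ` sub3 P Q R) \<and> \<not> (P = PF \<and> Q = PF \<and> R = PF) \<and>
        \<not> (P = PZ \<and> Q = PZ \<and> R = PZ)"
      by (intro exI[of _ P] exI[of _ Q] exI[of _ PB]) (simp add: admissible_iff)
  qed (auto simp: admissible_iff)
  show ?thesis
  proof (rule Set.set_eqI)
    fix U show "U \<in> proper_submodules a \<longleftrightarrow> U \<in> {verma_sub P Q | P Q. compatible P Q}"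
      unfolding proper R verma_sub_def mem_Collect_eq by (simp only: conj_commute)
  qed
qed

section \<open>The covering relation\<close>

text \<open>Inclusion of planes is a condition on constructors by \<open>plane_subset\<close>, so
  the covering relation becomes a finite case check in which slopes are opaque parameters.\<close>

definition below :: "'k psub \<Rightarrow> 'k psub \<Rightarrow> 'k psub \<Rightarrow> 'k psub \<Rightarrow> bool" where
  "below P' Q' P Q \<longleftrightarrow> (P' = PZ \<or> P = PF \<or> P' = P) \<and> (Q' = PZ \<or> Q = PF \<or> Q' = Q) \<and> (P' \<noteq> P \<or> Q' \<noteq> Q)"

lemma verma_sub_psubset: "verma_sub P' Q' \<subset> verma_sub P Q \<longleftrightarrow> below P' Q' P Q"
  by (auto simp: psubset_eq verma_sub_subset verma_sub_eq plane_subset below_def)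

text \<open>If both components change, some compatible pair lies strictly between. If one component
  jumps from \<open>PZ\<close> to \<open>PF\<close>, compatibility forces the other to be
  \<open>PB\<close>, and then \<open>PB\<close> can be inserted.\<close>

lemma below_covers:
  assumes "compatible P Q" "compatible P' Q'"
  shows "below P' Q' P Q \<and> \<not> (\<exists>R S. compatible R S \<and> below P' Q' R S \<and> below R S P Q) \<longleftrightarrow>
    P = P' \<and> psub_covers Q Q' \<or> Q = Q' \<and> psub_covers P P'"
  using assms unfolding ex_psub compatible_def below_def psub_covers_def
  by (cases P; cases Q; simp; cases P'; cases Q'; simp; blast?)

definition covers_Ke :: "('k verma_elt set \<times> 'k verma_elt set) set" where
  "covers_Ke = {(verma_sub P Q, verma_sub P Q') | P Q Q'. compatible P Q \<and> compatible P Q' \<and> psub_covers Q Q'}"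

definition covers_L :: "('k verma_elt set \<times> 'k verma_elt set) set" where
  "covers_L = {(verma_sub P Q, verma_sub P' Q) | P P' Q. compatible P Q \<and> compatible P' Q \<and> psub_covers P P'}"

lemma covering_pairs_eq: "covering_pairs (proper_submodules a) = covers_Ke \<union> covers_L"
proof -
  have verma_sub: "(verma_sub P Q, verma_sub P' Q') \<in> covering_pairs (proper_submodules a) \<longleftrightarrow>
      P = P' \<and> psub_covers Q Q' \<or> Q = Q' \<and> psub_covers P P'" if compatible: "compatible P Q" "compatible P' Q'" for P Q P' Q'
  proof -
    have mem: "verma_sub P Q \<in> proper_submodules a" "verma_sub P' Q' \<in> proper_submodules a"
      using compatible unfolding proper_submodules_eq by blast+
    have ex: "(\<exists>Z\<in>proper_submodules a. verma_sub P' Q' \<subset> Z \<and> Z \<subset> verma_sub P Q) \<longleftrightarrow>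
        (\<exists>R S. compatible R S \<and> verma_sub P' Q' \<subset> verma_sub R S \<and> verma_sub R S \<subset> verma_sub P Q)"
      unfolding proper_submodules_eq by blast
    have "(verma_sub P Q, verma_sub P' Q') \<in> covering_pairs (proper_submodules a) \<longleftrightarrow>
        verma_sub P' Q' \<subset> verma_sub P Q \<and> \<not> (\<exists>Z\<in>proper_submodules a. verma_sub P' Q' \<subset> Z \<and> Z \<subset> verma_sub P Q)"
      unfolding covering_pairs_def using mem by blast
    also have "\<dots> \<longleftrightarrow> P = P' \<and> psub_covers Q Q' \<or> Q = Q' \<and> psub_covers P P'"
      unfolding ex unfolding verma_sub_psubset by (rule below_covers[OF compatible])
    finally show ?thesis .
  qed
  have dom: "(\<exists>P Q. compatible P Q \<and> U = verma_sub P Q) \<and> (\<exists>P Q. compatible P Q \<and> Y = verma_sub P Q)"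
    if "(U, Y) \<in> covering_pairs (proper_submodules a)" for U Y
    using that unfolding covering_pairs_def proper_submodules_eq by blast
  show ?thesis
  proof (intro equalityI subrelI)
    fix U Y assume UY: "(U, Y) \<in> covering_pairs (proper_submodules a)"
    then obtain P Q P' Q' where PQ: "compatible P Q" "U = verma_sub P Q" "compatible P' Q'" "Y = verma_sub P' Q'"
      using dom by blast
    then have "P = P' \<and> psub_covers Q Q' \<or> Q = Q' \<and> psub_covers P P'"
      using UY verma_sub[OF PQ(1,3)] by simp
    then show "(U, Y) \<in> covers_Ke \<union> covers_L"
      using PQ unfolding covers_Ke_def covers_L_def by blast
  next
    fix U Y assume "(U, Y) \<in> covers_Ke \<union> covers_L"
    then obtain P Q P' Q' where PQ: "compatible P Q" "U = verma_sub P Q" "compatible P' Q'" "Y = verma_sub P' Q'"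
        "P = P' \<and> psub_covers Q Q' \<or> Q = Q' \<and> psub_covers P P'"
      unfolding covers_Ke_def covers_L_def by blast
    then show "(U, Y) \<in> covering_pairs (proper_submodules a)"
      using verma_sub[OF PQ(1,3)] by simp
  qed
qed

section \<open>Submodules generated by the distinguished elements\<close>

text \<open>Minimality has to be tested against admissible triples only. Excluding \<open>PZ\<close>
  in the third place is enough there, since an admissible third component is then \<open>PB\<close>
  or \<open>PF\<close>, and either contains \<open>plane PB\<close>.\<close>

lemma sub12_eq_verma_sub:
  assumes "compatible P Q" "U \<subseteq> sub3 P Q PB"
    and "\<And>P' Q' R'. admissible P' Q' R' \<Longrightarrow> U \<subseteq> sub3 P' Q' R' \<Longrightarrow>
      plane P \<subseteq> plane P' \<and> plane Q \<subseteq> plane Q' \<and> R' \<noteq> PZ"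
  shows "sub12 a (\<Phi> ` U) = verma_sub P Q"
  unfolding verma_sub_def
proof (rule sub12_\<Phi>)
  show "V.invariant (sub3 P Q PB)" "U \<subseteq> sub3 P Q PB"
    using assms by (auto intro: invariant_compatible)
  fix W' assume W': "V.invariant W'" "U \<subseteq> W'"
  obtain P' Q' R' where adm: "admissible P' Q' R'" "W' = sub3 P' Q' R'"
    using invariant_cases[OF W'(1)] by blast
  then have "R' = PB \<or> R' = PF"
    using assms(3)[OF adm(1)] W'(2) by (auto simp: admissible_iff)
  then show "sub3 P Q PB \<subseteq> W'"
    using assms(3)[OF adm(1)] W'(2) adm(2) by (auto simp: sub3_subset plane_subset)
qed

lemma Mh_\<Phi>: "Mh a = \<Phi> ` range (emb rot)" and Me_\<Phi>: "Me a = \<Phi> ` range (emb 1)"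
  by (simp_all add: Mh_def Me_def weight_space_\<Phi>)

lemma range_emb_sub3: "range (emb rot) \<subseteq> sub3 P Q R \<longleftrightarrow> P = PF" "range (emb 1) \<subseteq> sub3 P Q R \<longleftrightarrow> Q = PF"
  using plane_subset[of PF P] plane_subset[of PF Q] by (auto simp: image_subset_iff emb_sub3)

lemma sub12_Mh: "sub12 a (Mh a) = verma_sub PF PB"
  unfolding Mh_\<Phi> by (rule sub12_eq_verma_sub) (auto simp: range_emb_sub3 admissible_iff compatible_def plane_subset)

lemma sub12_Me: "sub12 a (Me a) = verma_sub PB PF"
  unfolding Me_\<Phi> by (rule sub12_eq_verma_sub) (auto simp: range_emb_sub3 admissible_iff compatible_def plane_subset)

lemma N12_eq: "N12 a = verma_sub PF PF"
proof -
  define U :: "'k model set" where "U = {emb rot z + emb 1 w | z w. True}"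
  have "Mh a <+>\<^bsub>M12 a\<^esub> Me a = \<Phi> ` U"
    by (auto simp: U_def Mh_\<Phi> Me_\<Phi> set_add_def set_mult_def \<Phi>_add intro!: imageI)
  moreover have "sub12 a (\<Phi> ` U) = verma_sub PF PF"
  proof (rule sub12_eq_verma_sub)
    fix P Q R assume *: "admissible P Q R" "U \<subseteq> sub3 P Q R"
    have "emb rot z + emb 1 w \<in> sub3 P Q R" for z w
      using *(2) unfolding U_def by blast
    then have "plane PF \<subseteq> plane P" "plane PF \<subseteq> plane Q"
      by (auto simp: sub3_def L_index emb_def)
    then show "plane PF \<subseteq> plane P \<and> plane PF \<subseteq> plane Q \<and> R \<noteq> PZ"
      using *(1) by (auto simp: admissible_iff plane_subset simp del: plane.simps)
  qed (auto simp: compatible_def U_def sub3_def emb_def)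
  ultimately show ?thesis
    by (simp add: N12_def)
qed

text \<open>A vector at \<open>rot\<close> with nonzero first coordinate forces its line into
  \<open>P\<close> and, by compatibility, \<open>0 \<times> k\<close> into \<open>Q\<close>; the
  situation at \<open>e\<close> is symmetric. The vector \<open>(0, 1)\<close> forces
  \<open>0 \<times> k\<close> into its own component and nothing into the other.\<close>

lemma sub12_single:
  "fst z \<noteq> 0 \<Longrightarrow> sub12 a {\<Phi> (emb rot z)} = verma_sub (PL (snd z / fst z)) PB"
  "fst z \<noteq> 0 \<Longrightarrow> sub12 a {\<Phi> (emb 1 z)} = verma_sub PB (PL (snd z / fst z))"
  "sub12 a {\<Phi> (emb rot (0, 1))} = verma_sub PB PZ"
  "sub12 a {\<Phi> (emb 1 (0, 1))} = verma_sub PZ PB"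
proof -
  have *: "plane (PL (snd z / fst z)) \<subseteq> plane P" if "z \<in> plane P" "fst z \<noteq> 0" for P
    using that by (cases P) (auto simp: plane_subset)
  have 1: "z \<in> plane P \<Longrightarrow> fst z \<noteq> 0 \<Longrightarrow> P = PF \<or> (\<exists>c. P = PL c)" for P
    by (cases P) auto
  have 2: "(0, 1) \<in> plane P \<Longrightarrow> P = PF \<or> P = PB" for P
    by (cases P) (auto simp: prod_eq_iff)
  have 01: "(0, 1) \<in> plane (PB :: 'k psub)" by simp
  have im: "{\<Phi> u} = \<Phi> ` {u}" for u by simp
  show "fst z \<noteq> 0 \<Longrightarrow> sub12 a {\<Phi> (emb rot z)} = verma_sub (PL (snd z / fst z)) PB"
    unfolding im
    by (rule sub12_eq_verma_sub) (use 1 * in \<open>auto simp: compatible_def emb_sub3 admissible_iff plane_subset\<close>)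
  show "fst z \<noteq> 0 \<Longrightarrow> sub12 a {\<Phi> (emb 1 z)} = verma_sub PB (PL (snd z / fst z))"
    unfolding im
    by (rule sub12_eq_verma_sub) (use 1 * in \<open>auto simp: compatible_def emb_sub3 admissible_iff plane_subset\<close>)
  show "sub12 a {\<Phi> (emb rot (0, 1))} = verma_sub PB PZ"
    unfolding im
    by (rule sub12_eq_verma_sub)
      (use 2 01 in \<open>auto simp: compatible_def emb_sub3 admissible_iff plane_subset simp del: plane.simps\<close>)
  show "sub12 a {\<Phi> (emb 1 (0, 1))} = verma_sub PZ PB"
    unfolding im
    by (rule sub12_eq_verma_sub)
      (use 2 01 in \<open>auto simp: compatible_def emb_sub3 admissible_iff plane_subset simp del: plane.simps\<close>)
qed

lemma sub12_m_3_m_o: "sub12 a (span12 a {m_3 a, m_o a}) = verma_sub PB PB"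
proof -
  let ?S = "{emb 1 (0, 1), emb rot (0, 1)}"
  have span: "span12 a {m_3 a, m_o a} = \<Phi> ` V.span ?S"
    using span12_\<Phi>[of ?S] by (simp add: m_3_\<Phi> m_o_\<Phi>)
  have sub: "V.span ?S \<subseteq> sub3 P Q R \<longleftrightarrow> (0, 1) \<in> plane Q \<and> (0, 1) \<in> plane P" for P Q R
  proof -
    have "V.span ?S \<subseteq> sub3 P Q R \<longleftrightarrow> ?S \<subseteq> sub3 P Q R"
      using V.span_minimal[OF _ subspace_sub3] V.span_superset by blast
    then show ?thesis by (simp add: emb_sub3)
  qed
  have "sub12 a (\<Phi> ` V.span ?S) = verma_sub PB PB"
  proof (rule sub12_eq_verma_sub)
    have *: "(0, 1) \<in> plane P \<Longrightarrow> P = PF \<or> P = PB" for P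
      by (cases P) (auto simp: prod_eq_iff)
    show "plane PB \<subseteq> plane P \<and> plane PB \<subseteq> plane Q \<and> R \<noteq> PZ"
      if "admissible P Q R" "V.span ?S \<subseteq> sub3 P Q R" for P Q R
      using that *[of P] *[of Q] unfolding sub plane_subset by (auto simp: admissible_iff)
  qed (auto simp: compatible_def sub)
  then show ?thesis
    by (simp only: span)
qed

lemma span_emb: "V.span {emb g z} = range (\<lambda>c. emb g (pscale c z))"
  by (simp add: V.span_singleton emb_scale)

lemma span12_m_top: "span12 a {m_top a} = verma_sub PZ PZ"
proof -
  have "V.span {emb g0 (0, 1)} = sub3 PZ PZ PB"
  proof (intro equalityI subsetI)
    fix u assume "u \<in> sub3 PZ PZ PB"
    then have "u = emb g0 (pscale (snd (u g0)) (0, 1))"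
      by (simp add: sub3_def L_index fun_eq_iff forall_S3 emb_def pscale_def prod_eq_iff)
    then show "u \<in> V.span {emb g0 (0, 1)}"
      unfolding span_emb by blast
  qed (auto simp: span_emb emb_sub3 pscale_def)
  then show ?thesis
    using span12_\<Phi>[of "{emb g0 (0, 1)}"] by (simp add: m_top_\<Phi> verma_sub_def)
qed

lemma emb_inj: "emb g z = emb g z' \<longleftrightarrow> z = z'"
  by (metis emb_def)

lemma range_emb_span: "range (emb g) = V.span {emb g z, emb g (0, 1)} \<longleftrightarrow> fst z \<noteq> 0"
proof
  assume eq: "range (emb g) = V.span {emb g z, emb g (0, 1)}"
  show "fst z \<noteq> 0"
  proof
    assume z: "fst z = 0"
    have "V.span {emb g z, emb g (0, 1)} \<subseteq> {u. fst (u g) = 0}"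
      by (rule V.span_minimal) (auto simp: V.subspace_def emb_def z mscale_def pscale_def)
    moreover have "emb g (1, 0) \<in> V.span {emb g z, emb g (0, 1)}"
      unfolding eq[symmetric] by simp
    ultimately show False by (auto simp: emb_def)
  qed
next
  assume z: "fst z \<noteq> 0"
  show "range (emb g) = V.span {emb g z, emb g (0, 1)}"
  proof (intro equalityI)
    show "range (emb g) \<subseteq> V.span {emb g z, emb g (0, 1)}"
    proof (rule image_subsetI)
      fix w
      have "w = pscale (fst w / fst z) z + pscale (snd w - fst w / fst z * snd z) (0, 1)"
        using z by (simp add: pscale_def prod_eq_iff)
      then have "emb g w = mscale (fst w / fst z) (emb g z) + mscale (snd w - fst w / fst z * snd z) (emb g (0, 1))"
        by (metis emb_add emb_scale)
      then show "emb g w \<in> V.span {emb g z, emb g (0, 1)}"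
        by (simp add: V.span_add V.span_scale V.span_base)
    qed
    have "V.subspace (range (emb g))"
      by (rule V.subspaceI) (auto simp flip: emb_add emb_scale intro: range_eqI emb_zero[symmetric])
    then show "V.span {emb g z, emb g (0, 1)} \<subseteq> range (emb g)"
      by (intro V.span_minimal) auto
  qed
qed

lemma v_set_eq: "v_set a = {\<Phi> (emb rot z) | z. fst z \<noteq> 0}"
  and w_set_eq: "w_set a = {\<Phi> (emb 1 z) | z. fst z \<noteq> 0}"
proof -
  have *: "\<Phi> ` range (emb g) = span12 a {\<Phi> (emb g z), \<Phi> (emb g (0, 1))} \<longleftrightarrow> fst z \<noteq> 0" for g z
  proof -
    have "span12 a {\<Phi> (emb g z), \<Phi> (emb g (0, 1))} = \<Phi> ` V.span {emb g z, emb g (0, 1)}"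
      using span12_\<Phi>[of "{emb g z, emb g (0, 1)}"] by simp
    moreover have "\<Phi> ` S = \<Phi> ` S' \<longleftrightarrow> S = S'" for S S'
      by (rule inj_image_eq_iff) (simp add: inj_def inj_\<Phi>)
    ultimately show ?thesis
      by (simp only: range_emb_span)
  qed
  show "v_set a = {\<Phi> (emb rot z) | z. fst z \<noteq> 0}"
    unfolding v_set_def Mh_\<Phi> m_o_\<Phi> using * by blast
  show "w_set a = {\<Phi> (emb 1 z) | z. fst z \<noteq> 0}"
    unfolding w_set_def Me_\<Phi> m_3_\<Phi> using * by blast
qed

text \<open>Replaces a family indexed by the generators \<open>v\<close> or \<open>w\<close> with
  one indexed by slopes, the latter being free of repetitions.\<close>

lemma ex_slope: "(\<exists>z :: 'k \<times> 'k. fst z \<noteq> 0 \<and> P (snd z / fst z)) \<longleftrightarrow> (\<exists>c. P c)"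
proof
  assume "\<exists>c. P c"
  then obtain c where "P c" ..
  then show "\<exists>z :: 'k \<times> 'k. fst z \<noteq> 0 \<and> P (snd z / fst z)"
    by (intro exI[of _ "(1, c)"]) simp
qed auto

text \<open>The function \<open>F\<close> allows the same rewriting for the list of submodules and
  for edges having \<open>sub12 a {v}\<close> as their upper or lower end.\<close>

lemma sub12_v: "{F (sub12 a {v}) | v. v \<in> v_set a} = range (\<lambda>c. F (verma_sub (PL c) PB))"
proof -
  have "{F (sub12 a {v}) | v. v \<in> v_set a} = {y. \<exists>z. fst z \<noteq> 0 \<and> y = F (verma_sub (PL (snd z / fst z)) PB)}"
    unfolding v_set_eq by (force simp: sub12_single(1))
  also have "\<dots> = range (\<lambda>c. F (verma_sub (PL c) PB))"
    using ex_slope[of "\<lambda>c. y = F (verma_sub (PL c) PB)" for y] by (simp add: full_SetCompr_eq)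
  finally show ?thesis .
qed

lemma sub12_w: "{F (sub12 a {w}) | w. w \<in> w_set a} = range (\<lambda>c. F (verma_sub PB (PL c)))"
proof -
  have "{F (sub12 a {v}) | v. v \<in> w_set a} = {y. \<exists>z. fst z \<noteq> 0 \<and> y = F (verma_sub PB (PL (snd z / fst z)))}"
    unfolding w_set_eq by (force simp: sub12_single(2))
  also have "\<dots> = range (\<lambda>c. F (verma_sub PB (PL c)))"
    using ex_slope[of "\<lambda>c. y = F (verma_sub PB (PL c))" for y] by (simp add: full_SetCompr_eq)
  finally show ?thesis .
qed

lemmas sub12_values = N12_eq sub12_Mh sub12_Me sub12_m_3_m_o span12_m_top
  m_3_\<Phi>[THEN arg_cong[where f = "\<lambda>x. sub12 a {x}"], unfolded sub12_single]
  m_o_\<Phi>[THEN arg_cong[where f = "\<lambda>x. sub12 a {x}"], unfolded sub12_single]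

lemma edges_Ke_eq: "edges_Ke a = covers_Ke"
proof -
  have "edges_Ke a = {(verma_sub PF PF, verma_sub PF PB), (verma_sub PB PF, verma_sub PB PB), (verma_sub PB PB, verma_sub PB PZ), (verma_sub PZ PB, verma_sub PZ PZ)}
      \<union> range (\<lambda>c. (verma_sub PB PF, verma_sub PB (PL c))) \<union> range (\<lambda>c. (verma_sub PB (PL c), verma_sub PB PZ))"
    unfolding edges_Ke_def sub12_values sub12_w[of "\<lambda>U. (_, U)"] sub12_w[of "\<lambda>U. (U, _)"] ..
  also have "\<dots> = covers_Ke" (is "?L = _")
  proof (intro equalityI subsetI)
    fix x assume "x \<in> ?L"
    then show "x \<in> covers_Ke"
      by (auto simp: covers_Ke_def verma_sub_eq compatible_def psub_covers_def)
  next
    fix x assume "x \<in> covers_Ke"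
    then obtain P Q Q' where "x = (verma_sub P Q, verma_sub P Q')" "compatible P Q" "compatible P Q'" "psub_covers Q Q'"
      unfolding covers_Ke_def by blast
    then show "x \<in> ?L"
      unfolding psub_covers_def by (cases P) (auto simp: compatible_def)
  qed
  finally show ?thesis .
qed

lemma edges_L_eq: "edges_L a = covers_L"
proof -
  have "edges_L a = {(verma_sub PF PF, verma_sub PB PF), (verma_sub PF PB, verma_sub PB PB), (verma_sub PB PB, verma_sub PZ PB), (verma_sub PB PZ, verma_sub PZ PZ)}
      \<union> range (\<lambda>c. (verma_sub PF PB, verma_sub (PL c) PB)) \<union> range (\<lambda>c. (verma_sub (PL c) PB, verma_sub PZ PB))"
    unfolding edges_L_def sub12_values sub12_v[of "\<lambda>U. (_, U)"] sub12_v[of "\<lambda>U. (U, _)"] ..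
  also have "\<dots> = covers_L" (is "?L = _")
  proof (intro equalityI subsetI)
    fix x assume "x \<in> ?L"
    then show "x \<in> covers_L"
      by (auto simp: covers_L_def verma_sub_eq compatible_def psub_covers_def)
  next
    fix x assume "x \<in> covers_L"
    then obtain P P' Q where "x = (verma_sub P Q, verma_sub P' Q)" "compatible P Q" "compatible P' Q" "psub_covers P P'"
      unfolding covers_L_def by blast
    then show "x \<in> ?L"
      unfolding psub_covers_def by (cases Q) (auto simp: compatible_def)
  qed
  finally show ?thesis .
qed

lemma compatible_set: "{verma_sub P Q | P Q. compatible P Q} =
  {verma_sub PF PF, verma_sub PF PB, verma_sub PB PF, verma_sub PB PB, verma_sub PZ PB, verma_sub PB PZ, verma_sub PZ PZ}
   \<union> range (\<lambda>c. verma_sub (PL c) PB) \<union> range (\<lambda>c. verma_sub PB (PL c))" (is "?L = ?R")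
proof (intro equalityI subsetI)
  fix U assume "U \<in> ?L"
  then obtain P Q where "U = verma_sub P Q" "compatible P Q" by blast
  then show "U \<in> ?R"
    by (cases P; cases Q) (auto simp: compatible_def)
next
  fix U assume "U \<in> ?R"
  then show "U \<in> ?L"
    by (auto simp: compatible_def)
qed

text \<open>Both proportionality of two such vectors and equality of the submodules that they
  generate amount to having the same slope; this is what the coincidence criteria compare.\<close>

lemma mem_span_emb_iff:
  assumes "fst z \<noteq> 0" "fst z' \<noteq> 0"
  shows "\<Phi> (emb g z) \<in> span12 a {\<Phi> (emb g z')} \<longleftrightarrow> snd z / fst z = snd z' / fst z'"
proof -
  have "\<Phi> (emb g z) \<in> span12 a {\<Phi> (emb g z')} \<longleftrightarrow> emb g z \<in> V.span {emb g z'}"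
    using span12_\<Phi>[of "{emb g z'}"] by (simp add: \<Phi>_mem)
  also have "\<dots> \<longleftrightarrow> (\<exists>c. z = pscale c z')"
    by (auto simp: span_emb emb_inj)
  also have "\<dots> \<longleftrightarrow> snd z / fst z = snd z' / fst z'"
  proof
    assume "snd z / fst z = snd z' / fst z'"
    then have "z = pscale (fst z / fst z') z'"
      using assms by (simp add: pscale_def prod_eq_iff field_simps)
    then show "\<exists>c. z = pscale c z'" ..
  qed (use assms in \<open>auto simp: pscale_def field_simps\<close>)
  finally show ?thesis .
qed

end

theorem lemma19:
  fixes a :: "transp \<Rightarrow> 'k::{alg_closed_field, field_char_0}"
  assumes "a T12 + a T13 + a T23 = 0"
    and "a T12 \<noteq> a T13"
    and "a T13 = a T23"
  shows "proper_submodules a =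
      {N12 a, sub12 a (Mh a), sub12 a (Me a), sub12 a (span12 a {m_3 a, m_o a}),
       sub12 a {m_3 a}, sub12 a {m_o a}, span12 a {m_top a}}
      \<union> {sub12 a {v} | v. v \<in> v_set a} \<union> {sub12 a {w} | w. w \<in> w_set a} \<and>
    covering_pairs (proper_submodules a) = edges_Ke a \<union> edges_L a \<and>
    (\<forall>(U, Y)\<in>edges_Ke a. module_isomorphic (alg a) (subquotient (M12 a) U Y) Ke) \<and>
    (\<forall>(U, Y)\<in>edges_L a. module_isomorphic (alg a) (subquotient (M12 a) U Y) (L_module a)) \<and>
    (\<forall>v\<in>v_set a. \<forall>v1\<in>v_set a. sub12 a {v} = sub12 a {v1} \<longleftrightarrow> v \<in> span12 a {v1}) \<and>
    (\<forall>w\<in>w_set a. \<forall>w1\<in>w_set a. sub12 a {w} = sub12 a {w1} \<longleftrightarrow> w \<in> span12 a {w1})"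
proof -
  interpret degenerate a
    using assms(2,3) by unfold_locales
  show ?thesis
  proof (intro conjI)
    show "proper_submodules a =
      {N12 a, sub12 a (Mh a), sub12 a (Me a), sub12 a (span12 a {m_3 a, m_o a}),
       sub12 a {m_3 a}, sub12 a {m_o a}, span12 a {m_top a}}
      \<union> {sub12 a {v} | v. v \<in> v_set a} \<union> {sub12 a {w} | w. w \<in> w_set a}"
      unfolding proper_submodules_eq compatible_set sub12_values sub12_v[of "\<lambda>U. U"] sub12_w[of "\<lambda>U. U"] ..
    show "covering_pairs (proper_submodules a) = edges_Ke a \<union> edges_L a"
      by (simp only: covering_pairs_eq edges_Ke_eq edges_L_eq)
    show "\<forall>(U, Y)\<in>edges_Ke a. module_isomorphic (alg a) (subquotient (M12 a) U Y) Ke"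
      unfolding edges_Ke_eq covers_Ke_def using verma_sub_Ke_quotient by blast
    show "\<forall>(U, Y)\<in>edges_L a. module_isomorphic (alg a) (subquotient (M12 a) U Y) (L_module a)"
      unfolding edges_L_eq covers_L_def using verma_sub_L_quotient by blast
    show "\<forall>v\<in>v_set a. \<forall>v1\<in>v_set a. sub12 a {v} = sub12 a {v1} \<longleftrightarrow> v \<in> span12 a {v1}"
      by (auto simp: v_set_eq sub12_single mem_span_emb_iff verma_sub_eq)
    show "\<forall>w\<in>w_set a. \<forall>w1\<in>w_set a. sub12 a {w} = sub12 a {w1} \<longleftrightarrow> w \<in> span12 a {w1}"
      by (auto simp: w_set_eq sub12_single mem_span_emb_iff verma_sub_eq)
  qed
qed

end
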